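(* Let $\mathcal{H}$ be a hypergraph and let $F$ be an edge of $\mathcal{H}$ with $\dim F>0$. (1) Let $\mathcal{H}_S$ be an open string of length $\mu$. If $\mathcal{H}=\mathcal{H}_S\cup\{F\}$, where all vertices of $F$ are vertices of $\mathcal{H}_S$, then either $\mathrm{pd}(\mathcal{H})=\mathrm{pd}(\mathcal{H}_S)=\mu-\lfloor \mu/3\rfloor$ or $\mathrm{pd}(\mathcal{H})=\mathrm{pd}(\mathcal{H}_S)+1$, and which of the two holds depends on the position of the vertices of $F$ on the string. (2) Let $\mathcal{H}_{C_\mu}$ be an open cycle of length $\mu$. If $\mathcal{H}=\mathcal{H}_{C_\mu}\cup\{F\}$, where all vertices of $F$ are vertices of $\mathcal{H}_{C_\mu}$, then $\mathrm{pd}(\mathcal{H})=\mathrm{pd}(\mathcal{H}_{C_\mu})=\mu-1-\left\lfloor\frac{\mu-2}{3}\right\rfloor$.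
   Context: A hypergraph $\mathcal{H}$ on a finite vertex set $V$ is a set of nonempty subsets of $V$ (called edges) covering $V$; the dimension of an edge $F$ is $\dim F=|F|-1$. All hypergraphs are assumed separated: for any two distinct vertices $v,w$ there are edges $F_1,F_2$ with $v\in F_1\setminus F_2$ and $w\in F_2\setminus F_1$. Let $\mathbb{K}$ be a field. To $\mathcal{H}$ one associates the square-free monomial ideal $I(\mathcal{H})$ in the polynomial ring $R=\mathbb{K}[x_E : E\in\mathcal{H}]$ (one variable for each edge), minimally generated by the monomials $m_v=\prod_{E\ni v}x_E$, $v\in V$. Put $\mathrm{pd}(\mathcal{H})=\mathrm{pd}_R(R/I(\mathcal{H}))$, the projective dimension. A vertex $v$ is closed if $\{v\}\in\mathcal{H}$, and open otherwise. Open string of length $\mu$: the hypergraph on $\{w_1,\dots,w_\mu\}$ whose edges are $\{w_i,w_{i+1}\}$ for $1\le i\le \mu-1$ together with $\{w_1\}$ and $\{w_\mu\}$ (so only the end vertices are closed). Open cycle of length $\mu$: the hypergraph on $\{w_1,\dots,w_\mu\}$ whose edges are $\{w_i,w_{i+1}\}$ for $1\le i\le\mu-1$ and $\{w_\mu,w_1\}$ (all vertices are open; being separated forces $\mu\ge 3$). *)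

theory Defs
  imports "HOL-Algebra.QuotRing" "HOL-Algebra.Module"
    "HOL-Library.Poly_Mapping" "HOL-Library.Extended_Nat"
begin

section \<open>Projective dimension of modules\<close>

text \<open>Modules are those of the locale \<^locale>\<open>Module.module\<close>; the fields \<^const>\<open>mult\<close> and \<^const>\<open>one\<close> of
  the underlying record play no role there and are left \<^const>\<open>undefined\<close> in free modules.\<close>

definition mod_hom :: "'r ring \<Rightarrow> ('r, 'm) module \<Rightarrow> ('r, 'n) module \<Rightarrow> ('m \<Rightarrow> 'n) set" where
  "mod_hom R M N = {f \<in> carrier M \<rightarrow> carrier N.
     (\<forall>x \<in> carrier M. \<forall>y \<in> carrier M. f (x \<oplus>\<^bsub>M\<^esub> y) = f x \<oplus>\<^bsub>N\<^esub> f y) \<and>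
     (\<forall>a \<in> carrier R. \<forall>x \<in> carrier M. f (a \<odot>\<^bsub>M\<^esub> x) = a \<odot>\<^bsub>N\<^esub> f x)}"

text \<open>The free module on a basis \<open>X\<close>: finitely supported functions from \<open>X\<close> to \<open>R\<close>,
  extended by zero outside \<open>X\<close>.\<close>

definition free_module :: "'r ring \<Rightarrow> 'x set \<Rightarrow> ('r, 'x \<Rightarrow> 'r) module" where
  "free_module R X =
    \<lparr>carrier = {f. range f \<subseteq> carrier R \<and> finite {x. f x \<noteq> \<zero>\<^bsub>R\<^esub>} \<and> (\<forall>x. x \<notin> X \<longrightarrow> f x = \<zero>\<^bsub>R\<^esub>)},
     mult = undefined, one = undefined,
     zero = (\<lambda>x. \<zero>\<^bsub>R\<^esub>), add = (\<lambda>f g x. f x \<oplus>\<^bsub>R\<^esub> g x),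
     smult = (\<lambda>a f x. a \<otimes>\<^bsub>R\<^esub> f x)\<rparr>"

text \<open>Projective modules are the direct summands of free modules, that is, the modules \<open>P\<close> with
  linear maps \<open>i\<close> from \<open>P\<close> to a free module and \<open>p\<close> back such that \<open>p \<circ> i\<close> is the identity.
  Taking the basis \<open>X\<close> from the type \<open>'m\<close> of elements of \<open>P\<close> is no restriction: if \<open>P\<close> is
  projective, then it is a direct summand of the free module on \<open>X = carrier P\<close>.\<close>

definition projective_module :: "'r ring \<Rightarrow> ('r, 'm) module \<Rightarrow> bool" where
  "projective_module R P \<longleftrightarrow> Module.module R P \<and>
     (\<exists>(X :: 'm set) i p. i \<in> mod_hom R P (free_module R X) \<and> p \<in> mod_hom R (free_module R X) P \<and>
        (\<forall>x \<in> carrier P. p (i x) = x))"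

text \<open>\<open>0 \<rightarrow> P n \<rightarrow> \<dots> \<rightarrow> P 1 \<rightarrow> P 0 \<rightarrow> M \<rightarrow> 0\<close> is exact, with \<open>d i\<close> the map from \<open>P (Suc i)\<close> to \<open>P i\<close>
  and \<open>e\<close> the augmentation; the sequence is continued by zero modules beyond \<open>n\<close>.\<close>

definition projective_resolution ::
  "'r ring \<Rightarrow> ('r, 'm) module \<Rightarrow> nat \<Rightarrow> (nat \<Rightarrow> ('r, 'p) module) \<Rightarrow> (nat \<Rightarrow> 'p \<Rightarrow> 'p) \<Rightarrow> ('p \<Rightarrow> 'm) \<Rightarrow> bool"
  where
  "projective_resolution R M n P d e \<longleftrightarrow>
     (\<forall>i. projective_module R (P i)) \<and> (\<forall>i>n. carrier (P i) = {\<zero>\<^bsub>P i\<^esub>}) \<and>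
     e \<in> mod_hom R (P 0) M \<and> (\<forall>i. d i \<in> mod_hom R (P (Suc i)) (P i)) \<and>
     e ` carrier (P 0) = carrier M \<and>
     d 0 ` carrier (P 1) = a_kernel (P 0) M e \<and>
     (\<forall>i. d (Suc i) ` carrier (P (Suc (Suc i))) = a_kernel (P (Suc i)) (P i) (d i))"

text \<open>The least length of a projective resolution, and \<open>\<infinity>\<close> if there is no finite one.
  The modules of the resolution have to live in some fixed type. The type \<open>'m + nat \<Rightarrow> 'r\<close>
  is large enough to lose nothing: the standard resolution, which starts with the free module on
  \<open>carrier M\<close> and continues with the free module on the elements of each successive kernel, only
  involves modules of cardinality at most that of \<open>carrier R\<close>, \<open>carrier M\<close> and \<open>nat\<close> together,
  and cutting it off at a projective kernel gives a resolution of least length.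
  (The zero module gets the value \<open>0\<close>.)\<close>

definition proj_dim :: "'r ring \<Rightarrow> ('r, 'm) module \<Rightarrow> enat" where
  "proj_dim R M = (INF n \<in> {n. \<exists>(P :: nat \<Rightarrow> ('r, 'm + nat \<Rightarrow> 'r) module) d e.
     projective_resolution R M n P d e}. enat n)"

definition quotient_module :: "'r ring \<Rightarrow> 'r set \<Rightarrow> ('r, 'r set) module" where
  "quotient_module R I =
    \<lparr>carrier = carrier (R Quot I), mult = mult (R Quot I), one = one (R Quot I),
     zero = zero (R Quot I), add = add (R Quot I),
     smult = (\<lambda>a. mult (R Quot I) (I +>\<^bsub>R\<^esub> a))\<rparr>"


section \<open>Polynomial rings\<close>

text \<open>Monomials in variables from \<open>'x\<close> are exponent functions \<open>'x \<Rightarrow>\<^sub>0 nat\<close>, and polynomials are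
  finitely supported coefficient functions on monomials, with convolution as product.
  The ring \<open>poly_ring X\<close> consists of the polynomials in which only variables from \<open>X\<close> occur.\<close>

definition poly_ring :: "'x set \<Rightarrow> (('x \<Rightarrow>\<^sub>0 nat) \<Rightarrow>\<^sub>0 'k::field) ring" where
  "poly_ring X = \<lparr>carrier = {p. \<forall>m \<in> Poly_Mapping.keys p. Poly_Mapping.keys m \<subseteq> X},
     mult = (*), one = 1, zero = 0, add = (+)\<rparr>"

definition poly_var :: "'x \<Rightarrow> ('x \<Rightarrow>\<^sub>0 nat) \<Rightarrow>\<^sub>0 'k::field" where
  "poly_var x = Poly_Mapping.single (Poly_Mapping.single x 1) 1"


section \<open>Hypergraphs\<close>

definition hypergraph :: "'v set \<Rightarrow> 'v set set \<Rightarrow> bool" where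
  "hypergraph V H \<longleftrightarrow> finite V \<and> H \<subseteq> Pow V \<and> {} \<notin> H \<and> \<Union>H = V"

definition separated :: "'v set \<Rightarrow> 'v set set \<Rightarrow> bool" where
  "separated V H \<longleftrightarrow> (\<forall>v \<in> V. \<forall>w \<in> V. v \<noteq> w \<longrightarrow>
     (\<exists>F1 \<in> H. \<exists>F2 \<in> H. v \<in> F1 - F2 \<and> w \<in> F2 - F1))"

definition edge_dim :: "'v set \<Rightarrow> int" where
  "edge_dim F = int (card F) - 1"

definition vertex_monomial :: "'v set set \<Rightarrow> 'v \<Rightarrow> ('v set \<Rightarrow>\<^sub>0 nat) \<Rightarrow>\<^sub>0 'k::field" where
  "vertex_monomial H v = (\<Prod>E \<in> {E \<in> H. v \<in> E}. poly_var E)"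

definition hypergraph_ideal :: "'v set \<Rightarrow> 'v set set \<Rightarrow> (('v set \<Rightarrow>\<^sub>0 nat) \<Rightarrow>\<^sub>0 'k::field) set" where
  "hypergraph_ideal V H = Idl\<^bsub>poly_ring H\<^esub> (vertex_monomial H ` V)"

text \<open>The first argument only serves to fix the coefficient field.\<close>

definition pd :: "'k::field itself \<Rightarrow> 'v set \<Rightarrow> 'v set set \<Rightarrow> enat" where
  "pd _ V H = proj_dim (poly_ring H :: (('v set \<Rightarrow>\<^sub>0 nat) \<Rightarrow>\<^sub>0 'k) ring)
     (quotient_module (poly_ring H) (hypergraph_ideal V H))"

definition open_string :: "nat \<Rightarrow> (nat \<Rightarrow> 'v) \<Rightarrow> 'v set \<Rightarrow> 'v set set \<Rightarrow> bool" where
  "open_string \<mu> w V H \<longleftrightarrow> \<mu> \<ge> 1 \<and> inj_on w {1..\<mu>} \<and> V = w ` {1..\<mu>} \<and>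
     H = {{w i, w (i + 1)} | i. 1 \<le> i \<and> i < \<mu>} \<union> {{w 1}, {w \<mu>}}"

definition open_cycle :: "nat \<Rightarrow> (nat \<Rightarrow> 'v) \<Rightarrow> 'v set \<Rightarrow> 'v set set \<Rightarrow> bool" where
  "open_cycle \<mu> w V H \<longleftrightarrow> \<mu> \<ge> 3 \<and> inj_on w {1..\<mu>} \<and> V = w ` {1..\<mu>} \<and>
     H = {{w i, w (i + 1)} | i. 1 \<le> i \<and> i < \<mu>} \<union> {{w \<mu>, w 1}}"

end

theory Submission
  imports Defs "HOL-Library.Function_Algebras"
begin

text \<open>The vertices of a string or cycle give the monomials \<open>u\<^sub>i u\<^sub>i\<^sub>+\<^sub>1\<close> in the variables \<open>u\<^sub>i\<close> attached to
  its edges; adding the edge \<open>F\<close> multiplies those with \<open>i\<close> in a set \<open>A\<close> by one new variable \<open>y\<close>.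

  Upper bounds: the generators are added one at a time. By the mapping cone of multiplication by
  \<open>m\<close>, the projective dimension of \<open>R/(I + (m))\<close> is at most the maximum of those of \<open>R/I\<close> and of
  \<open>R/(I : m)\<close> plus one. Starting with the generators that do not involve \<open>y\<close>, all colon ideals that
  occur are generated by at most two variables and the edges of some paths, since dividing by a
  generator that contains \<open>y\<close> removes \<open>y\<close> from all the others.

  Lower bounds: if \<open>R/I\<close> has projective dimension less than \<open>j\<close>, then, by dimension shifting, the
  Koszul complex of any set of variables with coefficients in \<open>R/I\<close> is exact in degree \<open>j\<close>.
  An explicit cycle, detected by summing coefficients over the facets of a cross-polytope, shows that it
  is not. For strings and for cycles of length not congruent to 1 modulo 3 the cycle is a single
  monomial, and the bound is the height of a minimal prime; the remaining cycles, and the string of length 6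
  whose projective dimension grows, need a sum of several monomials.

  That only the position of \<open>F\<close> matters is the invariance of the projective dimension under relabelling.\<close>

section \<open>Koszul complexes\<close>

text \<open>In a fixed multidegree the Koszul complex of \<open>R/I\<close> is, up to complementing
  index sets, the cochain complex of the simplicial complex of those sets whose monomial stays
  outside \<open>I\<close>. A lower bound is therefore a nonzero cohomology class, and the
  cross-polytope is the sphere on which the class is evaluated. The 3 in the formulas comes from the
  last edge of a path: dividing by it turns the neighbouring edge into a variable, and that variable
  swallows the edge before. Two generators are paid for and three edges disappear. The string and
  the cycle behave differently because of rounding. Dividing by an edge cuts a string into two
  segments, each with a cost rounded to an integer, and the two roundings together can exceed the
  rounding for the whole string by one. A cycle is cut into a single arc, so there is one rounding
  only and the added edge costs nothing. No Tor and no homology groups occur: cycles are lifted and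
  corrected by hand, and all modules of a resolution live in the one type over which
  \<open>proj_dim\<close> quantifies.\<close>

lemma mod_homD:
  assumes "f \<in> mod_hom R M N"
  shows "x \<in> carrier M \<Longrightarrow> f x \<in> carrier N"
    and "x \<in> carrier M \<Longrightarrow> y \<in> carrier M \<Longrightarrow> f (x \<oplus>\<^bsub>M\<^esub> y) = f x \<oplus>\<^bsub>N\<^esub> f y"
    and "a \<in> carrier R \<Longrightarrow> x \<in> carrier M \<Longrightarrow> f (a \<odot>\<^bsub>M\<^esub> x) = a \<odot>\<^bsub>N\<^esub> f x"
  using assms by (auto simp: mod_hom_def)

lemma mod_hom_zero:
  assumes "Module.module R M" "Module.module R N" "f \<in> mod_hom R M N"
  shows "f \<zero>\<^bsub>M\<^esub> = \<zero>\<^bsub>N\<^esub>"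
proof -
  interpret M: Module.module R M by fact
  interpret N: Module.module R N by fact
  have "f (\<zero>\<^bsub>R\<^esub> \<odot>\<^bsub>M\<^esub> \<zero>\<^bsub>M\<^esub>) = \<zero>\<^bsub>R\<^esub> \<odot>\<^bsub>N\<^esub> f \<zero>\<^bsub>M\<^esub>"
    by (rule mod_homD(3)[OF assms(3)]) auto
  then show ?thesis using mod_homD(1)[OF assms(3)] by simp
qed

text \<open>The Koszul sign: the parity of the position at which \<open>v\<close> enters the
  increasing enumeration of \<open>S\<close>.\<close>

definition signed :: "'r ring \<Rightarrow> (nat \<Rightarrow> 'r) \<Rightarrow> nat \<Rightarrow> nat set \<Rightarrow> 'r" where
  "signed R x v S = (if even (card {u \<in> S. u < v}) then x v else \<ominus>\<^bsub>R\<^esub> x v)"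

text \<open>A chain of degree \<open>j\<close> assigns to each \<open>S \<subseteq> {..<n}\<close> of size \<open>j\<close> its coefficient at the
  exterior monomial \<open>e\<^sub>S\<close>; the values at all other sets are irrelevant.\<close>

primrec koszul :: "'r ring \<Rightarrow> ('r, 'm) module \<Rightarrow> (nat \<Rightarrow> 'r) \<Rightarrow> nat \<Rightarrow> (nat set \<Rightarrow> 'm) \<Rightarrow> nat set \<Rightarrow> 'm" where
  "koszul R M x 0 f S = \<zero>\<^bsub>M\<^esub>"
| "koszul R M x (Suc n) f S = koszul R M x n f S \<oplus>\<^bsub>M\<^esub>
     (if n \<in> S then \<zero>\<^bsub>M\<^esub> else signed R x n S \<odot>\<^bsub>M\<^esub> f (insert n S))"

text \<open>Exactness at the chains of degree \<open>j\<close>. In degree 0 every chain is a cycle,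
  since \<open>Suc (card S) = j\<close> then holds for no \<open>S\<close>. Chains take values in
  the carrier at all sets, relevant or not, which keeps the closure lemmas free of side
  conditions.\<close>

definition koszul_exact :: "'r ring \<Rightarrow> ('r, 'm) module \<Rightarrow> (nat \<Rightarrow> 'r) \<Rightarrow> nat \<Rightarrow> nat \<Rightarrow> bool" where
  "koszul_exact R M x n j \<longleftrightarrow> (\<forall>f. (\<forall>S. f S \<in> carrier M) \<and>
     (\<forall>S \<subseteq> {..<n}. Suc (card S) = j \<longrightarrow> koszul R M x n f S = \<zero>\<^bsub>M\<^esub>) \<longrightarrow>
     (\<exists>g. (\<forall>S. g S \<in> carrier M) \<and> (\<forall>S \<subseteq> {..<n}. card S = j \<longrightarrow> f S = koszul R M x n g S)))"

lemma koszul_exactI: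
  assumes "\<And>f. (\<And>S. f S \<in> carrier M) \<Longrightarrow>
     (\<And>S. S \<subseteq> {..<n} \<Longrightarrow> Suc (card S) = j \<Longrightarrow> koszul R M x n f S = \<zero>\<^bsub>M\<^esub>) \<Longrightarrow>
     \<exists>g. (\<forall>S. g S \<in> carrier M) \<and> (\<forall>S \<subseteq> {..<n}. card S = j \<longrightarrow> f S = koszul R M x n g S)"
  shows "koszul_exact R M x n j"
  unfolding koszul_exact_def using assms by blast

lemma koszul_exactE:
  assumes "koszul_exact R M x n j" "\<And>S. f S \<in> carrier M"
    and "\<And>S. S \<subseteq> {..<n} \<Longrightarrow> Suc (card S) = j \<Longrightarrow> koszul R M x n f S = \<zero>\<^bsub>M\<^esub>"
  obtains g where "\<And>S. g S \<in> carrier M"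
    and "\<And>S. S \<subseteq> {..<n} \<Longrightarrow> card S = j \<Longrightarrow> f S = koszul R M x n g S"
proof -
  from assms have "\<exists>g. (\<forall>S. g S \<in> carrier M) \<and>
    (\<forall>S \<subseteq> {..<n}. card S = j \<longrightarrow> f S = koszul R M x n g S)"
    unfolding koszul_exact_def by blast
  then show ?thesis using that by blast
qed

text \<open>Submodules such as kernels and images are represented by replacing the carrier of the
  ambient module; the differential sees only the operations.\<close>

lemma koszul_carrier_update [simp]: "koszul R (M\<lparr>carrier := Z\<rparr>) x n f S = koszul R M x n f S"
  by (induction n) auto

lemma koszul_cong:
  assumes "\<And>v. v < n \<Longrightarrow> v \<notin> S \<Longrightarrow> f (insert v S) = g (insert v S)"
  shows "koszul R M x n f S = koszul R M x n g S"
  using assms by (induction n) auto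

locale plain_module = Module.module R M for R :: "'r ring" (structure) and M :: "('r, 'm) module" (structure)
begin

lemma minus_zero_module: "\<ominus>\<^bsub>M\<^esub> \<zero>\<^bsub>M\<^esub> = \<zero>\<^bsub>M\<^esub>"
  using M.r_neg[of "\<zero>\<^bsub>M\<^esub>"] by simp

lemma signed_closed: "x v \<in> carrier R \<Longrightarrow> signed R x v S \<in> carrier R"
  by (simp add: signed_def)

lemma signed_swap:
  assumes "u < v" "u \<notin> S" "v \<notin> S" "x u \<in> carrier R" "x v \<in> carrier R"
  shows "signed R x u S \<otimes> signed R x v (insert u S)
    = \<ominus> (signed R x v S \<otimes> signed R x u (insert v S))"
proof -
  have 1: "{w \<in> insert v S. w < u} = {w \<in> S. w < u}" using assms by auto
  have 2: "{w \<in> insert u S. w < v} = insert u {w \<in> S. w < v}" using assms by auto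
  have "card (insert u {w \<in> S. w < v}) = Suc (card {w \<in> S. w < v})"
    using assms by (subst card_insert_disjoint) auto
  then show ?thesis
    using assms(4,5) unfolding signed_def 1 2
    by (auto simp: R.l_minus R.r_minus R.m_comm)
qed

lemma koszul_closed:
  assumes "\<And>v. v < n \<Longrightarrow> x v \<in> carrier R" "\<And>S. f S \<in> carrier M"
  shows "koszul R M x n f S \<in> carrier M"
  using assms by (induction n) (auto simp: signed_closed)

lemma koszul_zero:
  assumes "\<And>v. v < n \<Longrightarrow> x v \<in> carrier R"
  shows "koszul R M x n (\<lambda>_. \<zero>\<^bsub>M\<^esub>) S = \<zero>\<^bsub>M\<^esub>"
  using assms by (induction n) (auto simp: signed_closed)

lemma koszul_add:
  assumes "\<And>v. v < n \<Longrightarrow> x v \<in> carrier R" "\<And>S. f S \<in> carrier M" "\<And>S. g S \<in> carrier M"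
  shows "koszul R M x n (\<lambda>S. f S \<oplus>\<^bsub>M\<^esub> g S) S = koszul R M x n f S \<oplus>\<^bsub>M\<^esub> koszul R M x n g S"
  using assms(1)
proof (induction n)
  case (Suc n)
  have "koszul R M x n f S \<in> carrier M" "koszul R M x n g S \<in> carrier M"
    using Suc.prems assms(2,3) by (auto intro!: koszul_closed)
  with Suc assms(2,3) show ?case
    by (auto simp: signed_closed smult_r_distr M.a_ac)
qed auto

lemma koszul_minus:
  assumes "\<And>v. v < n \<Longrightarrow> x v \<in> carrier R" "\<And>S. f S \<in> carrier M"
  shows "koszul R M x n (\<lambda>S. \<ominus>\<^bsub>M\<^esub> f S) S = \<ominus>\<^bsub>M\<^esub> koszul R M x n f S"
  using assms(1)
proof (induction n)
  case (Suc n)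
  have "koszul R M x n f S \<in> carrier M"
    using Suc.prems assms(2) by (auto intro!: koszul_closed)
  with Suc assms(2) show ?case
    by (auto simp: signed_closed smult_r_minus M.minus_add minus_zero_module)
qed (simp add: minus_zero_module)

text \<open>The part of the differential that belongs to the index \<open>m\<close> anticommutes
  with the part that belongs to smaller indices, because removing two indices in either order gives
  opposite signs (\<open>signed_swap\<close>).\<close>

lemma koszul_smult_commute:
  assumes "\<And>v. v \<le> m \<Longrightarrow> x v \<in> carrier R" "\<And>S. f S \<in> carrier M" "n \<le> m" "m \<notin> S"
  shows "koszul R M x n (\<lambda>T. if m \<in> T then \<zero>\<^bsub>M\<^esub> else signed R x m T \<odot>\<^bsub>M\<^esub> f (insert m T)) S
    = \<ominus>\<^bsub>M\<^esub> (signed R x m S \<odot>\<^bsub>M\<^esub> koszul R M x n f (insert m S))"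
  using assms(3)
proof (induction n)
  case 0
  then show ?case using assms by (simp add: signed_closed minus_zero_module)
next
  case (Suc n)
  let ?k = "koszul R M x n f (insert m S)"
  have k: "?k \<in> carrier M"
    using Suc.prems assms by (auto intro!: koszul_closed)
  have x: "x n \<in> carrier R" "x m \<in> carrier R" using Suc.prems assms by auto
  have nm: "n < m" using Suc.prems by simp
  have sw: "signed R x n S \<odot>\<^bsub>M\<^esub> (signed R x m (insert n S) \<odot>\<^bsub>M\<^esub> y) =
    \<ominus>\<^bsub>M\<^esub> (signed R x m S \<odot>\<^bsub>M\<^esub> (signed R x n (insert m S) \<odot>\<^bsub>M\<^esub> y))"
    if "n \<notin> S" "y \<in> carrier M" for y
    using signed_swap[of n m S x] that nm assms(4) x
    by (simp flip: smult_assoc1 add: signed_closed smult_l_minus)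
  show ?case
    using Suc nm assms(4) k x assms(2)
    by (auto simp: signed_closed smult_r_distr sw insert_commute M.minus_add minus_zero_module)
qed

text \<open>When the index \<open>n\<close> is split off, the square consists of the square for the
  smaller indices, which vanishes by induction, and two mixed terms, which cancel by
  \<open>koszul_smult_commute\<close>.\<close>

lemma koszul_koszul:
  assumes "\<And>v. v < n \<Longrightarrow> x v \<in> carrier R" "\<And>S. f S \<in> carrier M"
  shows "koszul R M x n (koszul R M x n f) S = \<zero>\<^bsub>M\<^esub>"
  using assms(1)
proof (induction n)
  case (Suc n)
  let ?t = "\<lambda>T. if n \<in> T then \<zero>\<^bsub>M\<^esub> else signed R x n T \<odot>\<^bsub>M\<^esub> f (insert n T)"
  have cl: "koszul R M x n f S \<in> carrier M" for S
    using Suc.prems assms(2) by (auto intro!: koszul_closed)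
  have t: "?t T \<in> carrier M" for T using Suc.prems assms(2) by (auto simp: signed_closed)
  have add: "koszul R M x n (koszul R M x (Suc n) f) S
    = koszul R M x n (koszul R M x n f) S \<oplus>\<^bsub>M\<^esub> koszul R M x n ?t S"
    unfolding koszul.simps(2) using Suc.prems cl t by (subst koszul_add) auto
  have IH: "koszul R M x n (koszul R M x n f) S = \<zero>\<^bsub>M\<^esub>" using Suc by auto
  show ?case
  proof (cases "n \<in> S")
    case True
    have "koszul R M x n ?t S = koszul R M x n (\<lambda>_. \<zero>\<^bsub>M\<^esub>) S"
      using True by (intro koszul_cong) auto
    then show ?thesis using True Suc.prems by (simp only: koszul.simps(2)[of _ _ _ n _ S] add IH) (simp add: koszul_zero)
  next
    case False
    have "koszul R M x n ?t S = \<ominus>\<^bsub>M\<^esub> (signed R x n S \<odot>\<^bsub>M\<^esub> koszul R M x n f (insert n S))"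
      using Suc.prems assms(2) False by (intro koszul_smult_commute) auto
    moreover have "koszul R M x (Suc n) f (insert n S) = koszul R M x n f (insert n S)"
      using cl by simp
    ultimately show ?thesis
      using False cl Suc.prems
      by (simp only: koszul.simps(2)[of _ _ _ n "koszul R M x (Suc n) f" S] add IH)
        (simp add: signed_closed M.l_neg)
  qed
qed auto

end

lemma koszul_hom:
  assumes "Module.module R M" "Module.module R N" "h \<in> mod_hom R M N"
    and "\<And>v. v < n \<Longrightarrow> x v \<in> carrier R" "\<And>S. f S \<in> carrier M"
  shows "h (koszul R M x n f S) = koszul R N x n (\<lambda>T. h (f T)) S"
proof -
  interpret M: plain_module R M by (rule plain_module.intro) fact
  interpret N: Module.module R N by fact
  note h = mod_homD[OF assms(3)] mod_hom_zero[OF assms(1-3)]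
  show ?thesis using assms(4)
  proof (induction n)
    case (Suc n)
    have "koszul R M x n f S \<in> carrier M"
      using Suc.prems assms(5) by (auto intro!: M.koszul_closed)
    with Suc assms(5) show ?case by (auto simp: h M.signed_closed)
  qed (simp add: h)
qed

text \<open>One piece of the long exact homology sequence of
  \<open>0 -> ker e -> P -> B -> 0\<close>, by diagram chase: a cycle \<open>f\<close> of
  \<open>B\<close> is lifted to \<open>l\<close>; the boundary of \<open>l\<close> is a cycle in the
  kernel, hence the boundary of some \<open>g\<close> there; then \<open>l - g\<close> is a cycle of
  \<open>P\<close>, hence the boundary of some \<open>h\<close>, and \<open>f\<close> is the
  boundary of the image of \<open>h\<close>.\<close>

lemma koszul_exact_shift:
  assumes M: "Module.module R M" and P: "Module.module R P" and e: "e \<in> mod_hom R P M"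
    and B: "e ` carrier P = B"
    and x: "\<And>v. v < n \<Longrightarrow> x v \<in> carrier R"
    and ex: "koszul_exact R P x n (Suc j)"
    and exZ: "koszul_exact R (P\<lparr>carrier := a_kernel P M e\<rparr>) x n j"
  shows "koszul_exact R (M\<lparr>carrier := B\<rparr>) x n (Suc j)"
proof (rule koszul_exactI)
  interpret M: plain_module R M by (rule plain_module.intro) fact
  interpret P: plain_module R P by (rule plain_module.intro) fact
  note eD = mod_homD[OF e] mod_hom_zero[OF P M e]
  let ?dP = "koszul R P x n" and ?dM = "koszul R M x n"
  have ker: "y \<in> a_kernel P M e \<longleftrightarrow> y \<in> carrier P \<and> e y = \<zero>\<^bsub>M\<^esub>" for y
    by (auto simp: a_kernel_def kernel_def)
  fix f :: "nat set \<Rightarrow> _"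
  assume "\<And>S. f S \<in> carrier (M\<lparr>carrier := B\<rparr>)"
  then have fB: "f S \<in> e ` carrier P" for S using B by simp
  assume cyc: "koszul R (M\<lparr>carrier := B\<rparr>) x n f S = \<zero>\<^bsub>M\<lparr>carrier := B\<rparr>\<^esub>"
    if "S \<subseteq> {..<n}" "Suc (card S) = Suc j" for S
  have "\<forall>S. \<exists>y. y \<in> carrier P \<and> e y = f S" using fB by (metis image_iff)
  then obtain l where l: "\<And>S. l S \<in> carrier P" "\<And>S. e (l S) = f S" by metis
  have dl: "?dP l S \<in> carrier P" for S by (intro P.koszul_closed x l)
  have el: "e (?dP l S) = ?dM f S" for S
    using koszul_hom[OF P M e, of n x l] x l by simp
  \<comment> \<open>The boundary of \<open>l\<close> is known to lie in the kernel only in degree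
    \<open>j\<close>, where \<open>f\<close> has boundary zero; it is cut off elsewhere to give a
    chain with values in the kernel.\<close>
  define k where "k S = (if S \<subseteq> {..<n} \<and> card S = j then ?dP l S else \<zero>\<^bsub>P\<^esub>)" for S
  have k_ker: "k S \<in> carrier (P\<lparr>carrier := a_kernel P M e\<rparr>)" for S
    using cyc[of S] el[of S] dl[of S] eD(4) by (auto simp: k_def ker)
  have "koszul R (P\<lparr>carrier := a_kernel P M e\<rparr>) x n k S = \<zero>\<^bsub>P\<lparr>carrier := a_kernel P M e\<rparr>\<^esub>"
    if S: "S \<subseteq> {..<n}" "Suc (card S) = j" for S
  proof -
    have "finite S" using S finite_subset by auto
    have "?dP k S = ?dP (?dP l) S"
      using S \<open>finite S\<close> by (intro koszul_cong) (auto simp: k_def)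
    then show ?thesis using P.koszul_koszul[of n x l S] x l by simp
  qed
  then obtain g where g: "\<And>S. g S \<in> carrier (P\<lparr>carrier := a_kernel P M e\<rparr>)"
    and kg: "\<And>S. S \<subseteq> {..<n} \<Longrightarrow> card S = j \<Longrightarrow> k S = koszul R (P\<lparr>carrier := a_kernel P M e\<rparr>) x n g S"
    by (rule koszul_exactE[OF exZ k_ker]) auto
  have gP: "g S \<in> carrier P" "e (g S) = \<zero>\<^bsub>M\<^esub>" for S using g ker by auto
  let ?f = "\<lambda>S. l S \<oplus>\<^bsub>P\<^esub> \<ominus>\<^bsub>P\<^esub> g S"
  have "?dP ?f S = \<zero>\<^bsub>P\<^esub>" if "S \<subseteq> {..<n}" "Suc (card S) = Suc j" for S
    using kg[of S] that x l gP dl[of S]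
    by (simp add: k_def P.koszul_add P.koszul_minus P.r_neg P.koszul_closed)
  then obtain h where h: "\<And>S. h S \<in> carrier P"
    "\<And>S. S \<subseteq> {..<n} \<Longrightarrow> card S = Suc j \<Longrightarrow> ?f S = ?dP h S"
    by (rule koszul_exactE[OF ex, of ?f, rotated]) (use l gP in auto)
  have "f S = ?dM (\<lambda>T. e (h T)) S" if "S \<subseteq> {..<n}" "card S = Suc j" for S
  proof -
    have "l S = ?f S \<oplus>\<^bsub>P\<^esub> g S" using l gP by (simp add: P.a_assoc P.l_neg)
    then have "l S = ?dP h S \<oplus>\<^bsub>P\<^esub> g S" using h(2)[OF that] by simp
    then have "f S = e (?dP h S)"
      using l(2)[of S] gP[of S] eD P.koszul_closed[of n x h S] x h by simp
    then show ?thesis using koszul_hom[OF P M e, of n x h S] x h by simp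
  qed
  then show "\<exists>g. (\<forall>S. g S \<in> carrier (M\<lparr>carrier := B\<rparr>)) \<and> (\<forall>S \<subseteq> {..<n}. card S = Suc j \<longrightarrow>
      f S = koszul R (M\<lparr>carrier := B\<rparr>) x n g S)"
    using h B by (intro exI[of _ "\<lambda>T. e (h T)"]) auto
qed

text \<open>Dimension shifting: the image of \<open>d i\<close> has exact Koszul complex in all
  degrees at least \<open>n - i\<close>. For \<open>i = n\<close> this image is zero, and each step
  back along the resolution raises the degree by one.\<close>

lemma koszul_exact_resolution:
  assumes M: "Module.module R M" and res: "projective_resolution R M n P d e"
    and x: "\<And>v. v < N \<Longrightarrow> x v \<in> carrier R"
    and ex: "\<And>i j. koszul_exact R (P i) x N (Suc j)"
    and "j \<ge> n"
  shows "koszul_exact R M x N (Suc j)"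
proof -
  have P: "Module.module R (P i)" for i
    using res by (simp add: projective_resolution_def projective_module_def)
  have e: "e \<in> mod_hom R (P 0) M" "e ` carrier (P 0) = carrier M"
    and d: "\<And>i. d i \<in> mod_hom R (P (Suc i)) (P i)"
    and z: "\<And>i. i > n \<Longrightarrow> carrier (P i) = {\<zero>\<^bsub>P i\<^esub>}"
    and d0: "d 0 ` carrier (P 1) = a_kernel (P 0) M e"
    and dS: "\<And>i. d (Suc i) ` carrier (P (Suc (Suc i))) = a_kernel (P (Suc i)) (P i) (d i)"
    using res by (auto simp: projective_resolution_def)
  let ?Z = "\<lambda>i. d i ` carrier (P (Suc i))"
  have "koszul_exact R (P i\<lparr>carrier := ?Z i\<rparr>) x N j" if "i \<le> n" "j \<ge> n - i" for i j
    using that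
  proof (induction "n - i" arbitrary: i j)
    case 0
    interpret P: plain_module R "P i" by (rule plain_module.intro[OF P])
    have Z: "?Z i = {\<zero>\<^bsub>P i\<^esub>}"
      using 0 z[of "Suc i"] mod_hom_zero[OF P P d, of i] by simp
    show ?case
      unfolding Z
    proof (rule koszul_exactI)
      fix f :: "nat set \<Rightarrow> _"
      assume f: "\<And>S. f S \<in> carrier (P i\<lparr>carrier := {\<zero>\<^bsub>P i\<^esub>}\<rparr>)"
      show "\<exists>g. (\<forall>S. g S \<in> carrier (P i\<lparr>carrier := {\<zero>\<^bsub>P i\<^esub>}\<rparr>)) \<and>
        (\<forall>S\<subseteq>{..<N}. card S = j \<longrightarrow> f S = koszul R (P i\<lparr>carrier := {\<zero>\<^bsub>P i\<^esub>}\<rparr>) x N g S)"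
        using f x by (intro exI[of _ "\<lambda>_. \<zero>\<^bsub>P i\<^esub>"]) (auto simp: P.koszul_zero)
    qed
  next
    case (Suc m)
    then obtain j' where j: "j = Suc j'" by (cases j) auto
    have "koszul_exact R (P (Suc i)\<lparr>carrier := ?Z (Suc i)\<rparr>) x N j'"
      using Suc(1)[of "Suc i" j'] Suc(2-) j by simp
    then show ?case
      unfolding j dS by (intro koszul_exact_shift[OF P P d refl x ex])
  qed
  from this[of 0 j] \<open>j \<ge> n\<close> have "koszul_exact R (P 0\<lparr>carrier := a_kernel (P 0) M e\<rparr>) x N j"
    using d0 by simp
  from koszul_exact_shift[OF M P e x ex this] show ?thesis by simp
qed

section \<open>Polynomial rings, free modules and quotients as coefficients\<close>

lemma poly_ring_simps [simp]:
  "mult (poly_ring X) = (*)" "one (poly_ring X) = 1" "zero (poly_ring X) = 0"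
  "add (poly_ring X) = (+)"
  by (simp_all add: poly_ring_def)

lemma in_poly_ring: "p \<in> carrier (poly_ring X) \<longleftrightarrow> (\<forall>m \<in> Poly_Mapping.keys p. Poly_Mapping.keys m \<subseteq> X)"
  by (simp add: poly_ring_def)

lemma keys_add_nat: "Poly_Mapping.keys (m + m' :: 'x \<Rightarrow>\<^sub>0 nat) = Poly_Mapping.keys m \<union> Poly_Mapping.keys m'"
  by (auto simp: in_keys_iff lookup_add)

lemma poly_ring_closed [simp]:
  "0 \<in> carrier (poly_ring X)" "1 \<in> carrier (poly_ring X)"
  "p \<in> carrier (poly_ring X) \<Longrightarrow> q \<in> carrier (poly_ring X) \<Longrightarrow> p + q \<in> carrier (poly_ring X)"
  "p \<in> carrier (poly_ring X) \<Longrightarrow> q \<in> carrier (poly_ring X) \<Longrightarrow> p * q \<in> carrier (poly_ring X)"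
  "p \<in> carrier (poly_ring X) \<Longrightarrow> - p \<in> carrier (poly_ring X)"
  unfolding in_poly_ring
  subgoal by simp
  subgoal by simp
  subgoal using Poly_Mapping.keys_add[of p q] by blast
  subgoal using keys_mult[of p q] by (force simp: keys_add_nat)
  subgoal by (simp add: in_keys_iff)
  done

lemma poly_ring_cring: "cring (poly_ring X :: (('x \<Rightarrow>\<^sub>0 nat) \<Rightarrow>\<^sub>0 'k::field) ring)"
proof (intro cringI abelian_groupI comm_monoidI)
  fix p :: "('x \<Rightarrow>\<^sub>0 nat) \<Rightarrow>\<^sub>0 'k" assume "p \<in> carrier (poly_ring X)"
  then show "\<exists>q\<in>carrier (poly_ring X). q \<oplus>\<^bsub>poly_ring X\<^esub> p = \<zero>\<^bsub>poly_ring X\<^esub>"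
    by (intro bexI[of _ "- p"]) auto
qed (auto simp: algebra_simps)

lemma poly_ring_minus [simp]:
  assumes "p \<in> carrier (poly_ring X)" shows "\<ominus>\<^bsub>poly_ring X\<^esub> p = - p"
proof -
  interpret cring "poly_ring X :: (('a \<Rightarrow>\<^sub>0 nat) \<Rightarrow>\<^sub>0 'b) ring" by (rule poly_ring_cring)
  show ?thesis using assms by (intro minus_equality) auto
qed

definition self_module :: "'r ring \<Rightarrow> ('r, 'r) module" where
  "self_module R = \<lparr>carrier = carrier R, mult = mult R, one = one R, zero = zero R,
     add = add R, smult = mult R\<rparr>"

lemma self_module_simps [simp]:
  "carrier (self_module R) = carrier R" "zero (self_module R) = zero R"
  "add (self_module R) = add R" "smult (self_module R) = mult R"
  by (simp_all add: self_module_def)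

lemma self_module: 
  assumes "cring R" shows "Module.module R (self_module R)"
proof -
  interpret cring R by fact
  show ?thesis
  proof (intro moduleI abelian_groupI)
    fix x assume "x \<in> carrier (self_module R)"
    then show "\<exists>y\<in>carrier (self_module R). y \<oplus>\<^bsub>self_module R\<^esub> x = \<zero>\<^bsub>self_module R\<^esub>"
      by (intro bexI[of _ "\<ominus>\<^bsub>R\<^esub> x"]) (auto simp: l_neg)
  qed (auto simp: assms a_ac m_ac l_distr r_distr)
qed

lemma free_module_simps [simp]:
  "zero (free_module R X) = (\<lambda>x. \<zero>\<^bsub>R\<^esub>)"
  "add (free_module R X) = (\<lambda>f g x. f x \<oplus>\<^bsub>R\<^esub> g x)"
  "smult (free_module R X) = (\<lambda>a f x. a \<otimes>\<^bsub>R\<^esub> f x)"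
  by (simp_all add: free_module_def)

lemma in_free_module: "f \<in> carrier (free_module R X) \<longleftrightarrow>
  (\<forall>x. f x \<in> carrier R) \<and> finite {x. f x \<noteq> \<zero>\<^bsub>R\<^esub>} \<and> (\<forall>x. x \<notin> X \<longrightarrow> f x = \<zero>\<^bsub>R\<^esub>)"
  by (auto simp: free_module_def)

lemma free_module:
  assumes "cring R" shows "Module.module R (free_module R X)"
proof -
  interpret cring R by fact
  have add: "(\<lambda>x. f x \<oplus>\<^bsub>R\<^esub> g x) \<in> carrier (free_module R X)"
    if "f \<in> carrier (free_module R X)" "g \<in> carrier (free_module R X)" for f g
  proof -
    have "{x. f x \<oplus>\<^bsub>R\<^esub> g x \<noteq> \<zero>\<^bsub>R\<^esub>} \<subseteq> {x. f x \<noteq> \<zero>\<^bsub>R\<^esub>} \<union> {x. g x \<noteq> \<zero>\<^bsub>R\<^esub>}" by auto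
    then have "finite {x. f x \<oplus>\<^bsub>R\<^esub> g x \<noteq> \<zero>\<^bsub>R\<^esub>}"
      by (rule finite_subset) (use that in \<open>auto simp: in_free_module\<close>)
    then show ?thesis using that by (simp add: in_free_module)
  qed
  have sm: "(\<lambda>x. a \<otimes>\<^bsub>R\<^esub> f x) \<in> carrier (free_module R X)"
    if "f \<in> carrier (free_module R X)" "a \<in> carrier R" for f a
  proof -
    have "{x. a \<otimes>\<^bsub>R\<^esub> f x \<noteq> \<zero>\<^bsub>R\<^esub>} \<subseteq> {x. f x \<noteq> \<zero>\<^bsub>R\<^esub>}" using that by auto
    then have "finite {x. a \<otimes>\<^bsub>R\<^esub> f x \<noteq> \<zero>\<^bsub>R\<^esub>}"
      by (rule finite_subset) (use that in \<open>auto simp: in_free_module\<close>)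
    then show ?thesis using that by (simp add: in_free_module)
  qed
  show ?thesis
  proof (intro moduleI abelian_groupI)
    fix f assume f: "f \<in> carrier (free_module R X)"
    have "(\<lambda>x. \<ominus>\<^bsub>R\<^esub> f x) = (\<lambda>x. (\<ominus>\<^bsub>R\<^esub> \<one>\<^bsub>R\<^esub>) \<otimes>\<^bsub>R\<^esub> f x)"
      using f by (simp add: in_free_module l_minus)
    then have "(\<lambda>x. \<ominus>\<^bsub>R\<^esub> f x) \<in> carrier (free_module R X)" using sm[OF f, of "\<ominus>\<^bsub>R\<^esub> \<one>\<^bsub>R\<^esub>"] by simp
    then show "\<exists>g\<in>carrier (free_module R X). g \<oplus>\<^bsub>free_module R X\<^esub> f = \<zero>\<^bsub>free_module R X\<^esub>"
      using f by (intro bexI[of _ "\<lambda>x. \<ominus>\<^bsub>R\<^esub> f x"]) (auto simp: l_neg in_free_module)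
  qed (use add sm assms in \<open>auto simp: a_ac m_ac l_distr r_distr in_free_module\<close>)
qed

lemma koszul_free_module:
  "koszul R (free_module R X) x n f S y = koszul R (self_module R) x n (\<lambda>T. f T y) S"
  by (induction n) auto

text \<open>Exactness holds coordinate by coordinate. The chains found in the coordinates need not
  fit together with finite support, so they are set to zero outside the finite set \<open>Y\<close>
  of coordinates where some \<open>f S\<close> is nonzero.\<close>

lemma koszul_exact_free_module:
  assumes "cring R" and x: "\<And>v. v < n \<Longrightarrow> x v \<in> carrier R"
    and ex: "koszul_exact R (self_module R) x n j"
  shows "koszul_exact R (free_module R X) x n j"
proof (rule koszul_exactI)
  interpret S: plain_module R "self_module R"
    by (rule plain_module.intro[OF self_module[OF assms(1)]])
  fix f :: "nat set \<Rightarrow> 'b \<Rightarrow> 'a"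
  assume f: "\<And>S. f S \<in> carrier (free_module R X)"
    and cyc: "\<And>S. S \<subseteq> {..<n} \<Longrightarrow> Suc (card S) = j \<Longrightarrow>
      koszul R (free_module R X) x n f S = \<zero>\<^bsub>free_module R X\<^esub>"
  have "\<exists>g. (\<forall>S. g S \<in> carrier R) \<and> (\<forall>S\<subseteq>{..<n}. card S = j \<longrightarrow>
      f S y = koszul R (self_module R) x n g S)" for y
  proof -
    have "\<exists>g. (\<forall>S. g S \<in> carrier (self_module R)) \<and> (\<forall>S\<subseteq>{..<n}. card S = j \<longrightarrow>
      f S y = koszul R (self_module R) x n g S)"
    proof (rule koszul_exactE[OF ex, of "\<lambda>S. f S y"])
      show "f S y \<in> carrier (self_module R)" for S using f by (auto simp: in_free_module)
      show "koszul R (self_module R) x n (\<lambda>S. f S y) S = \<zero>\<^bsub>self_module R\<^esub>"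
        if "S \<subseteq> {..<n}" "Suc (card S) = j" for S
        using fun_cong[OF cyc[OF that], of y] by (simp add: koszul_free_module)
    qed blast
    then show ?thesis by simp
  qed
  then obtain g where g: "\<And>y S. g y S \<in> carrier R"
    "\<And>y S. S \<subseteq> {..<n} \<Longrightarrow> card S = j \<Longrightarrow> f S y = koszul R (self_module R) x n (g y) S"
    by metis
  define Y where "Y = (\<Union>S\<in>Pow {..<n}. {y. f S y \<noteq> \<zero>\<^bsub>R\<^esub>})"
  have Y: "finite Y" "Y \<subseteq> X" using f by (auto simp: Y_def in_free_module)
  define h where "h S y = (if y \<in> Y then g y S else \<zero>\<^bsub>R\<^esub>)" for S y
  have "h S \<in> carrier (free_module R X)" for S
  proof -
    have "{y. h S y \<noteq> \<zero>\<^bsub>R\<^esub>} \<subseteq> Y" by (auto simp: h_def)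
    then have "finite {y. h S y \<noteq> \<zero>\<^bsub>R\<^esub>}" by (rule finite_subset) (rule Y(1))
    then show ?thesis using Y(2) g(1) by (auto simp: in_free_module h_def)
  qed
  moreover have "f S = koszul R (free_module R X) x n h S" if "S \<subseteq> {..<n}" "card S = j" for S
  proof
    fix y
    show "f S y = koszul R (free_module R X) x n h S y"
    proof (cases "y \<in> Y")
      case True
      then show ?thesis using g(2)[OF that] by (simp add: koszul_free_module h_def)
    next
      case False
      then have "f S y = \<zero>\<^bsub>R\<^esub>" using that by (auto simp: Y_def)
      then show ?thesis using False S.koszul_zero[of n x S] x
        by (simp add: koszul_free_module h_def)
    qed
  qed
  ultimately show "\<exists>g. (\<forall>S. g S \<in> carrier (free_module R X)) \<and> (\<forall>S\<subseteq>{..<n}. card S = j \<longrightarrow>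
      f S = koszul R (free_module R X) x n g S)" by blast
qed

text \<open>A direct summand inherits exactness: a cycle is moved to the free module by
  \<open>i\<close>, bounded there, and moved back by \<open>p\<close>.\<close>

lemma koszul_exact_projective:
  fixes P :: "('r, 'm) module"
  assumes P: "projective_module R P" and x: "\<And>v. v < n \<Longrightarrow> x v \<in> carrier R"
    and ex: "koszul_exact R (self_module R) x n j"
  shows "koszul_exact R P x n j"
proof (rule koszul_exactI)
  from P obtain X :: "'m set" and i p where M: "Module.module R P"
    and i: "i \<in> mod_hom R P (free_module R X)" and p: "p \<in> mod_hom R (free_module R X) P"
    and pi: "\<And>y. y \<in> carrier P \<Longrightarrow> p (i y) = y"
    unfolding projective_module_def by blast
  interpret M: plain_module R P by (rule plain_module.intro[OF M])
  have R: "cring R" ..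
  note F = free_module[OF R, of X]
  fix f :: "nat set \<Rightarrow> _"
  assume f: "\<And>S. f S \<in> carrier P"
    and cyc: "\<And>S. S \<subseteq> {..<n} \<Longrightarrow> Suc (card S) = j \<Longrightarrow> koszul R P x n f S = \<zero>\<^bsub>P\<^esub>"
  obtain g where g: "\<And>S. g S \<in> carrier (free_module R X)"
    "\<And>S. S \<subseteq> {..<n} \<Longrightarrow> card S = j \<Longrightarrow> i (f S) = koszul R (free_module R X) x n g S"
  proof (rule koszul_exactE[OF koszul_exact_free_module[OF R x ex, of X], of "\<lambda>S. i (f S)"])
    show "i (f S) \<in> carrier (free_module R X)" for S using mod_homD(1)[OF i f] .
    show "koszul R (free_module R X) x n (\<lambda>S. i (f S)) S = \<zero>\<^bsub>free_module R X\<^esub>"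
      if "S \<subseteq> {..<n}" "Suc (card S) = j" for S
      using koszul_hom[OF M F i, of n x f S] x f cyc[OF that] mod_hom_zero[OF M F i] by simp
  qed auto
  have "f S = koszul R P x n (\<lambda>T. p (g T)) S" if "S \<subseteq> {..<n}" "card S = j" for S
    using g(2)[OF that] pi[OF f, of S] koszul_hom[OF F M p, of n x g S] x g(1) by simp
  then show "\<exists>g. (\<forall>S. g S \<in> carrier P) \<and> (\<forall>S\<subseteq>{..<n}. card S = j \<longrightarrow> f S = koszul R P x n g S)"
    using mod_homD(1)[OF p g(1)] by (intro exI[of _ "\<lambda>T. p (g T)"]) auto
qed

lemma quotient_module_simps [simp]:
  "carrier (quotient_module R I) = carrier (R Quot I)" "zero (quotient_module R I) = I"
  "add (quotient_module R I) = add (R Quot I)"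
  "smult (quotient_module R I) = (\<lambda>a. mult (R Quot I) (I +>\<^bsub>R\<^esub> a))"
  by (simp_all add: quotient_module_def FactRing_def)

lemma FactRing_zero: "\<zero>\<^bsub>R Quot I\<^esub> = I"
  by (simp add: FactRing_def)

lemma FactRing_carrier: "carrier (R Quot I) = (\<lambda>a. I +>\<^bsub>R\<^esub> a) ` carrier R"
  by (auto simp: FactRing_def A_RCOSETS_def')

lemma quotient_module:
  assumes "cring R" "ideal I R"
  shows "Module.module R (quotient_module R I)"
proof -
  interpret R: cring R by fact
  interpret I: ideal I R by fact
  interpret Q: cring "R Quot I" by (rule I.quotient_is_cring[OF assms(1)])
  interpret h: ring_hom_ring R "R Quot I" "\<lambda>a. I +>\<^bsub>R\<^esub> a" by (rule I.rcos_ring_hom_ring)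
  note z = FactRing_zero[of R I]
  show ?thesis
  proof (intro moduleI abelian_groupI)
    fix x assume "x \<in> carrier (quotient_module R I)"
    then show "\<exists>y\<in>carrier (quotient_module R I). y \<oplus>\<^bsub>quotient_module R I\<^esub> x = \<zero>\<^bsub>quotient_module R I\<^esub>"
      using z by (intro bexI[of _ "\<ominus>\<^bsub>R Quot I\<^esub> x"]) (auto simp: Q.l_neg)
  qed (use Q.zero_closed Q.l_zero z in \<open>auto simp: assms(1) Q.a_ac Q.m_ac Q.l_distr Q.r_distr\<close>)
qed

lemma quotient_hom:
  assumes "cring R" "ideal I R"
  shows "(\<lambda>a. I +>\<^bsub>R\<^esub> a) \<in> mod_hom R (self_module R) (quotient_module R I)"
    and "(\<lambda>a. I +>\<^bsub>R\<^esub> a) ` carrier R = carrier (quotient_module R I)"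
    and "a \<in> carrier R \<Longrightarrow> I +>\<^bsub>R\<^esub> a = I \<longleftrightarrow> a \<in> I"
proof -
  interpret R: cring R by fact
  interpret I: ideal I R by fact
  interpret h: ring_hom_ring R "R Quot I" "\<lambda>a. I +>\<^bsub>R\<^esub> a" by (rule I.rcos_ring_hom_ring)
  show "(\<lambda>a. I +>\<^bsub>R\<^esub> a) \<in> mod_hom R (self_module R) (quotient_module R I)"
    by (auto simp: mod_hom_def)
  show "(\<lambda>a. I +>\<^bsub>R\<^esub> a) ` carrier R = carrier (quotient_module R I)"
    by (simp add: FactRing_carrier)
  show "I +>\<^bsub>R\<^esub> a = I \<longleftrightarrow> a \<in> I" if "a \<in> carrier R"
    using that I.a_rcos_const I.rcos_const_imp_mem by blast
qed

lemma proj_dim_le_iff: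
  "proj_dim R (M :: ('r, 'm) module) \<le> enat n \<longleftrightarrow>
    (\<exists>m \<le> n. \<exists>(P :: nat \<Rightarrow> ('r, 'm + nat \<Rightarrow> 'r) module) d e. projective_resolution R M m P d e)"
proof
  let ?A = "{m. \<exists>(P :: nat \<Rightarrow> ('r, 'm + nat \<Rightarrow> 'r) module) d e. projective_resolution R M m P d e}"
  assume "proj_dim R M \<le> enat n"
  then have le: "Inf (enat ` ?A) \<le> enat n" by (simp add: proj_dim_def)
  have "?A \<noteq> {}"
  proof
    assume "?A = {}"
    then show False using le by (simp add: top_enat_def)
  qed
  then have "Inf (enat ` ?A) \<in> enat ` ?A" using wellorder_InfI[of _ "enat ` ?A"] by blast
  then obtain y where y: "Inf (enat ` ?A) = y" "y \<in> enat ` ?A" by blast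
  show "\<exists>m \<le> n. \<exists>(P :: nat \<Rightarrow> ('r, 'm + nat \<Rightarrow> 'r) module) d e. projective_resolution R M m P d e"
  proof -
    from y obtain m where m: "m \<in> ?A" "y = enat m" by blast
    then have "m \<le> n" using le y by simp
    with m(1) show ?thesis by blast
  qed
next
  assume "\<exists>m \<le> n. \<exists>(P :: nat \<Rightarrow> ('r, 'm + nat \<Rightarrow> 'r) module) d e. projective_resolution R M m P d e"
  then obtain m where m: "m \<le> n" "\<exists>(P :: nat \<Rightarrow> ('r, 'm + nat \<Rightarrow> 'r) module) d e. projective_resolution R M m P d e"
    by blast
  have "proj_dim R M \<le> enat m" unfolding proj_dim_def by (rule INF_lower) (use m in auto)
  then show "proj_dim R M \<le> enat n" using m(1) by (meson enat_ord_simps(1) order_trans)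
qed

text \<open>The form in which a bound on the projective dimension is contradicted later: it speaks
  of chains over \<open>R\<close> and congruences modulo \<open>I\<close>, so that coefficients of
  polynomials can be compared.\<close>

lemma koszul_boundary_of_proj_dim:
  assumes R: "cring R" and I: "ideal I R"
    and pd: "proj_dim R (quotient_module R I) \<le> enat n" "n < j"
    and x: "\<And>v. v < N \<Longrightarrow> x v \<in> carrier R"
    and ex: "\<And>j. koszul_exact R (self_module R) x N (Suc j)"
    and z: "\<And>S. z S \<in> carrier R"
    and cyc: "\<And>S. S \<subseteq> {..<N} \<Longrightarrow> Suc (card S) = j \<Longrightarrow> koszul R (self_module R) x N z S \<in> I"
  obtains w where "\<And>S. w S \<in> carrier R"
    and "\<And>S. S \<subseteq> {..<N} \<Longrightarrow> card S = j \<Longrightarrow>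
      z S \<oplus>\<^bsub>R\<^esub> \<ominus>\<^bsub>R\<^esub> koszul R (self_module R) x N w S \<in> I"
proof -
  interpret R: cring R by fact
  interpret I: ideal I R by fact
  let ?Q = "quotient_module R I" and ?K = "koszul R (self_module R) x N"
  note Q = quotient_module[OF R I] and S = self_module[OF R] and h = quotient_hom[OF R I]
  interpret S: plain_module R "self_module R" by (rule plain_module.intro[OF S])
  obtain m and P :: "nat \<Rightarrow> ('a, 'a set + nat \<Rightarrow> 'a) module" and d e
    where m: "m \<le> n" and res: "projective_resolution R ?Q m P d e"
    using pd(1) unfolding proj_dim_le_iff by blast
  have "koszul_exact R (P i) x N (Suc j)" for i j
  proof (rule koszul_exact_projective[OF _ x ex])
    show "projective_module R (P i)" using res by (simp add: projective_resolution_def)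
  qed
  from koszul_exact_resolution[OF Q res x this, of "j - 1"] m pd(2)
  have "koszul_exact R ?Q x N (Suc (j - 1))" by simp
  then have exQ: "koszul_exact R ?Q x N j" using pd(2) by simp
  let ?z = "\<lambda>S. I +>\<^bsub>R\<^esub> z S"
  have K: "?K f S \<in> carrier R" if "\<And>S. f S \<in> carrier R" for f S
    using S.koszul_closed[of N x f S] x that by simp
  have kh: "koszul R ?Q x N (\<lambda>S. I +>\<^bsub>R\<^esub> f S) T = I +>\<^bsub>R\<^esub> ?K f T" if "\<And>S. f S \<in> carrier R" for f T
    using koszul_hom[OF S Q h(1), of N x f T] x that by simp
  obtain g where g: "\<And>S. g S \<in> carrier ?Q"
    "\<And>S. S \<subseteq> {..<N} \<Longrightarrow> card S = j \<Longrightarrow> ?z S = koszul R ?Q x N g S"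
  proof (rule koszul_exactE[OF exQ, of ?z])
    show "?z S \<in> carrier ?Q" for S using h(2) z by blast
    show "koszul R ?Q x N ?z S = \<zero>\<^bsub>?Q\<^esub>" if "S \<subseteq> {..<N}" "Suc (card S) = j" for S
      using kh[of z S] z cyc[OF that] h(3)[of "?K z S"] K[of z S] by simp
  qed auto
  have "\<forall>S. \<exists>a. a \<in> carrier R \<and> g S = I +>\<^bsub>R\<^esub> a" using g(1) h(2) by blast
  then obtain w where w: "\<And>S. w S \<in> carrier R" "\<And>S. g S = I +>\<^bsub>R\<^esub> w S" by metis
  have "g = (\<lambda>S. I +>\<^bsub>R\<^esub> w S)" using w by auto
  then have eq: "I +>\<^bsub>R\<^esub> z S = I +>\<^bsub>R\<^esub> ?K w S" if "S \<subseteq> {..<N}" "card S = j" for S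
    using g(2)[OF that] kh[of w S] w by simp
  have "z S \<oplus>\<^bsub>R\<^esub> \<ominus>\<^bsub>R\<^esub> ?K w S \<in> I" if "S \<subseteq> {..<N}" "card S = j" for S
    using eq[OF that] R.quotient_eq_iff_same_a_r_cos[OF I z[of S] K[of w S]] w(1)
    by (simp add: R.minus_eq)
  then show ?thesis using w(1) that by blast
qed

section \<open>Exactness of the Koszul complex of a set of variables\<close>

lemma lookup_single_mult_add:
  fixes q :: "('x \<Rightarrow>\<^sub>0 nat) \<Rightarrow>\<^sub>0 'k::field"
  shows "Poly_Mapping.lookup (Poly_Mapping.single e a * q) (e + m) = a * Poly_Mapping.lookup q m"
  by (simp add: lookup_mult lookup_single when_mult)

lemma keys_poly_var_mult:
  fixes q :: "('x \<Rightarrow>\<^sub>0 nat) \<Rightarrow>\<^sub>0 'k::field"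
  assumes "m \<in> Poly_Mapping.keys (poly_var x * q)"
  obtains m' where "m' \<in> Poly_Mapping.keys q" "m = Poly_Mapping.single x 1 + m'"
  using assms keys_mult[of "poly_var x" q] unfolding poly_var_def by auto

lemma lookup_poly_var_mult:
  fixes q :: "('x \<Rightarrow>\<^sub>0 nat) \<Rightarrow>\<^sub>0 'k::field"
  shows "Poly_Mapping.lookup (poly_var x * q) (Poly_Mapping.single x 1 + m) = Poly_Mapping.lookup q m"
  by (simp add: poly_var_def lookup_single_mult_add)

lemma poly_var_closed [simp]: "poly_var x \<in> carrier (poly_ring X) \<longleftrightarrow> x \<in> X"
  by (simp add: poly_var_def in_poly_ring)

abbreviation var_koszul :: "'x set \<Rightarrow> (nat \<Rightarrow> 'x) \<Rightarrow> nat \<Rightarrow> (nat set \<Rightarrow> ('x \<Rightarrow>\<^sub>0 nat) \<Rightarrow>\<^sub>0 'k::field) \<Rightarrow>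
    nat set \<Rightarrow> ('x \<Rightarrow>\<^sub>0 nat) \<Rightarrow>\<^sub>0 'k" where
  "var_koszul X c n \<equiv> koszul (poly_ring X) (self_module (poly_ring X)) (\<lambda>v. poly_var (c v)) n"

lemma signed_poly_ring:
  assumes "c v \<in> X"
  shows "signed (poly_ring X) (\<lambda>v. poly_var (c v)) v S
    = (if even (card {u \<in> S. u < v}) then poly_var (c v) else - poly_var (c v) :: ('x \<Rightarrow>\<^sub>0 nat) \<Rightarrow>\<^sub>0 'k::field)"
  using assms by (simp add: signed_def)

lemma var_koszul_sum:
  assumes "c ` {..<n} \<subseteq> X"
  shows "var_koszul X c n f S = (\<Sum>v \<in> {..<n} - S.
    if even (card {u \<in> S. u < v}) then poly_var (c v) * f (insert v S)
    else - (poly_var (c v) * f (insert v S)))"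
  using assms
proof (induction n)
  case (Suc n)
  have "{..<Suc n} - S = (if n \<in> S then {..<n} - S else insert n ({..<n} - S))"
    by (auto simp: less_Suc_eq)
  with Suc show ?case by (simp add: signed_poly_ring lessThan_Suc)
qed simp

lemma keys_var_koszul:
  assumes "c ` {..<n} \<subseteq> X" "m \<in> Poly_Mapping.keys (var_koszul X c n f S)"
  shows "\<exists>v<n. c v \<in> Poly_Mapping.keys m"
proof -
  let ?t = "\<lambda>v. if even (card {u \<in> S. u < v}) then poly_var (c v) * f (insert v S)
    else - (poly_var (c v) * f (insert v S))"
  have "Poly_Mapping.lookup (\<Sum>v\<in>{..<n} - S. ?t v) m \<noteq> 0"
    using assms by (simp add: var_koszul_sum in_keys_iff)
  then have "(\<Sum>v\<in>{..<n} - S. Poly_Mapping.lookup (?t v) m) \<noteq> 0"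
    unfolding lookup_sum .
  then obtain v where v: "v \<in> {..<n} - S" "Poly_Mapping.lookup (?t v) m \<noteq> 0"
    by (meson sum.neutral)
  then have "m \<in> Poly_Mapping.keys (poly_var (c v) * f (insert v S))"
    by (auto simp: in_keys_iff split: if_splits)
  then have "c v \<in> Poly_Mapping.keys m" by (elim keys_poly_var_mult) (simp add: keys_add_nat)
  then show ?thesis using v by auto
qed

text \<open>The boundaries in degree 0 are the ideal generated by the variables: the terms divisible
  by the last variable are split off, and the remaining ones involve an earlier variable.\<close>

lemma var_koszul_surj:
  fixes p :: "('x \<Rightarrow>\<^sub>0 nat) \<Rightarrow>\<^sub>0 'k::field"
  assumes "c ` {..<n} \<subseteq> X" "p \<in> carrier (poly_ring X)"
    and "\<And>m. m \<in> Poly_Mapping.keys p \<Longrightarrow> \<exists>v<n. c v \<in> Poly_Mapping.keys m"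
  shows "\<exists>g. (\<forall>S. g S \<in> carrier (poly_ring X)) \<and> p = var_koszul X c n g {}"
  using assms
proof (induction n arbitrary: p)
  case 0
  then have "p = 0" by (intro poly_mapping_eqI) (auto simp: in_keys_iff)
  then show ?case by (intro exI[of _ "\<lambda>_. 0"]) simp
next
  case (Suc n)
  let ?e = "Poly_Mapping.single (c n) (1::nat)"
  have inj: "inj (\<lambda>m. ?e + m)" by (simp add: inj_def)
  \<comment> \<open>\<open>map_key\<close> along the injection \<open>m -> ?e + m\<close> reads the
    coefficients at multiples of the variable: this is division by the variable, with the other
    terms dropped.\<close>
  define q where "q = Poly_Mapping.map_key (\<lambda>m. ?e + m) p"
  have q: "Poly_Mapping.lookup q m = Poly_Mapping.lookup p (?e + m)" for m
    using inj by (simp add: q_def map_key.rep_eq)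
  have qR: "q \<in> carrier (poly_ring X)"
    unfolding in_poly_ring
  proof
    fix m assume "m \<in> Poly_Mapping.keys q"
    then have "?e + m \<in> Poly_Mapping.keys p" by (simp add: in_keys_iff q)
    then have "Poly_Mapping.keys (?e + m) \<subseteq> X" using Suc.prems(2) unfolding in_poly_ring by blast
    then show "Poly_Mapping.keys m \<subseteq> X" by (simp add: keys_add_nat)
  qed
  have cn: "c n \<in> X" using Suc.prems(1) by auto
  let ?p = "p - poly_var (c n) * q"
  have pR: "?p \<in> carrier (poly_ring X)"
    using Suc.prems(2) qR cn poly_ring_closed(3)[of p X "- (poly_var (c n) * q)"] by simp
  have "\<exists>v<n. c v \<in> Poly_Mapping.keys m" if "m \<in> Poly_Mapping.keys ?p" for m
  proof (cases "c n \<in> Poly_Mapping.keys m")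
    case True
    have "m = ?e + (m - ?e)"
      using True by (intro poly_mapping_eqI) (auto simp: lookup_add lookup_minus lookup_single when_def in_keys_iff)
    then have "Poly_Mapping.lookup ?p m = 0"
      using lookup_poly_var_mult[of "c n" q "m - ?e"] q[of "m - ?e"] by (simp add: lookup_minus)
    then show ?thesis using that by (simp add: in_keys_iff)
  next
    case False
    then have "m \<notin> Poly_Mapping.keys (poly_var (c n) * q)"
      by (auto elim!: keys_poly_var_mult simp: keys_add_nat)
    then have "m \<in> Poly_Mapping.keys p" using that by (simp add: in_keys_iff lookup_minus)
    then obtain v where "v < Suc n" "c v \<in> Poly_Mapping.keys m" using Suc.prems(3) by blast
    then show ?thesis using False by (auto simp: less_Suc_eq)
  qed
  then obtain g where g: "\<And>S. g S \<in> carrier (poly_ring X)" "?p = var_koszul X c n g {}"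
    using Suc.IH[of ?p] Suc.prems(1) pR by (auto simp: lessThan_Suc)
  let ?g = "\<lambda>T. if n \<in> T then q else g T"
  have "var_koszul X c n ?g {} = var_koszul X c n g {}" by (rule koszul_cong) auto
  then have eq: "var_koszul X c n ?g {} = ?p" using g(2) by simp
  have "p = var_koszul X c (Suc n) ?g {}"
    unfolding koszul.simps(2) eq by (simp add: signed_def)
  then show ?case using g(1) qR by (intro exI[of _ ?g]) auto
qed

lemma koszul_insert:
  assumes "k \<le> n"
  shows "koszul R M x k f (insert n S) = koszul R M x k (\<lambda>T. f (insert n T)) S"
  using assms
proof (induction k)
  case (Suc k)
  have "{u \<in> insert n S. u < k} = {u \<in> S. u < k}" using Suc.prems by auto
  then have "signed R x k (insert n S) = signed R x k S" by (simp add: signed_def)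
  then show ?case using Suc by (simp add: insert_commute)
qed simp

text \<open>The complex on \<open>Suc n\<close> variables is the mapping cone of the last variable
  on the complex of the others. The part \<open>?b\<close> of a cycle that contains the index
  \<open>n\<close> is a cycle of the smaller complex, hence the boundary of some
  \<open>\<beta>\<close>; subtracting the last variable times \<open>\<beta>\<close>, with signs,
  from the other part leaves a cycle, the boundary of some \<open>\<gamma>\<close>.\<close>

lemma var_koszul_exact:
  assumes "inj_on c {..<n}" "c ` {..<n} \<subseteq> X"
  shows "koszul_exact (poly_ring X) (self_module (poly_ring X :: (('x \<Rightarrow>\<^sub>0 nat) \<Rightarrow>\<^sub>0 'k::field) ring))
    (\<lambda>v. poly_var (c v)) n (Suc j)"
  using assms
proof (induction n arbitrary: j)
  case 0
  show ?case by (rule koszul_exactI) auto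
next
  case (Suc n)
  let ?R = "poly_ring X :: (('x \<Rightarrow>\<^sub>0 nat) \<Rightarrow>\<^sub>0 'k) ring"
  let ?x = "\<lambda>v. poly_var (c v) :: ('x \<Rightarrow>\<^sub>0 nat) \<Rightarrow>\<^sub>0 'k"
  let ?d = "var_koszul X c"
  interpret S: plain_module ?R "self_module ?R"
    by (intro plain_module.intro self_module poly_ring_cring)
  have cX: "c ` {..<n} \<subseteq> X" "c n \<in> X" and xR: "\<And>v. v < n \<Longrightarrow> ?x v \<in> carrier ?R" "?x n \<in> carrier ?R"
    and inj: "inj_on c {..<n}"
    using Suc.prems by (auto simp: lessThan_Suc)
  note IH = Suc.IH[OF inj cX(1)]
  show ?case
  proof (rule koszul_exactI)
    fix f :: "nat set \<Rightarrow> ('x \<Rightarrow>\<^sub>0 nat) \<Rightarrow>\<^sub>0 'k"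
    assume f': "\<And>S. f S \<in> carrier (self_module ?R)"
      and cyc': "\<And>S. S \<subseteq> {..<Suc n} \<Longrightarrow> Suc (card S) = Suc j \<Longrightarrow> ?d (Suc n) f S = \<zero>\<^bsub>self_module ?R\<^esub>"
    then have f: "\<And>S. f S \<in> carrier ?R"
      and cyc: "\<And>S. S \<subseteq> {..<Suc n} \<Longrightarrow> card S = j \<Longrightarrow> ?d (Suc n) f S = 0"
      by simp_all
    let ?b = "\<lambda>S. f (insert n S)"
    have fin: "finite S" "n \<notin> S" if "S \<subseteq> {..<n}" for S :: "nat set"
      using that finite_subset by auto
    have "\<exists>\<beta>. (\<forall>S. \<beta> S \<in> carrier ?R) \<and> (\<forall>S\<subseteq>{..<n}. card S = j \<longrightarrow> ?b S = ?d n \<beta> S)"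
    proof (cases j)
      \<comment> \<open>Degree 0 is beyond the induction hypothesis. Here the last variable times
        \<open>?b {}\<close> lies in the ideal of the earlier variables, and as it differs from all
        of them, so does \<open>?b {}\<close>.\<close>
      case 0
      have eq: "?d n f {} + ?x n * ?b {} = 0"
        using cyc[of "{}"] 0 by (simp add: signed_def)
      have "\<exists>v<n. c v \<in> Poly_Mapping.keys m" if "m \<in> Poly_Mapping.keys (?b {})" for m
      proof -
        let ?m = "Poly_Mapping.single (c n) 1 + m"
        have "Poly_Mapping.lookup (?d n f {}) ?m + Poly_Mapping.lookup (?b {}) m = 0"
          using arg_cong[OF eq, of "\<lambda>p. Poly_Mapping.lookup p ?m"] by (simp add: lookup_add lookup_poly_var_mult del: One_nat_def)
        then have "?m \<in> Poly_Mapping.keys (?d n f {})" using that by (auto simp: in_keys_iff)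
        then obtain v where v: "v < n" "c v \<in> Poly_Mapping.keys ?m"
          using keys_var_koszul[OF cX(1)] by blast
        then have "c v \<noteq> c n" using Suc.prems(1) by (auto dest: inj_onD)
        then show ?thesis using v by (auto simp: keys_add_nat)
      qed
      then obtain g where "\<And>S. g S \<in> carrier ?R" "?b {} = ?d n g {}"
        using var_koszul_surj[OF cX(1), of "?b {}"] f by blast
      moreover have "S = {}" if "S \<subseteq> {..<n}" "card S = j" for S :: "nat set"
        using that 0 fin[of S] by simp
      ultimately show ?thesis by (intro exI[of _ g]) auto
    next
      case (Suc j')
      have "\<exists>\<beta>. (\<forall>S. \<beta> S \<in> carrier (self_module ?R)) \<and>
        (\<forall>S\<subseteq>{..<n}. card S = Suc j' \<longrightarrow> ?b S = ?d n \<beta> S)"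
      proof (rule koszul_exactE[OF IH[of j'], of ?b])
        show "?b S \<in> carrier (self_module ?R)" for S using f by simp
        show "?d n ?b S = \<zero>\<^bsub>self_module ?R\<^esub>" if "S \<subseteq> {..<n}" "Suc (card S) = Suc j'" for S
        proof -
          have "insert n S \<subseteq> {..<Suc n}" using that(1) by auto
          then show ?thesis using cyc[of "insert n S"] that fin[of S] Suc by (simp add: koszul_insert)
        qed
      qed blast
      then show ?thesis using Suc by simp
    qed
    then obtain \<beta> where \<beta>: "\<And>S. \<beta> S \<in> carrier ?R"
      "\<And>S. S \<subseteq> {..<n} \<Longrightarrow> card S = j \<Longrightarrow> ?b S = ?d n \<beta> S" by blast
    \<comment> \<open>Written with \<open>insert n T - {n}\<close> in place of \<open>T\<close> to
      match \<open>koszul_smult_commute\<close> for the chain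
      \<open>\<lambda>U. \<beta> (U - {n})\<close>.\<close>
    let ?s = "\<lambda>T. if n \<in> T then 0 else signed ?R ?x n T * \<beta> (insert n T - {n})"
    have sR: "signed ?R ?x n T \<in> carrier ?R" for T using S.signed_closed xR by simp
    then have s: "?s T \<in> carrier ?R" for T using \<beta>(1) by simp
    have min: "\<ominus>\<^bsub>self_module ?R\<^esub> y = - y" if "y \<in> carrier ?R" for y
      using that S.M.minus_equality[of "- y" y] by simp
    have ds: "?d n ?s S = - (signed ?R ?x n S * ?b S)" if "S \<subseteq> {..<n}" "card S = j" for S
    proof -
      have "?d n ?s S = \<ominus>\<^bsub>self_module ?R\<^esub> (signed ?R ?x n S * ?d n (\<lambda>U. \<beta> (U - {n})) (insert n S))"
        using S.koszul_smult_commute[of n ?x "\<lambda>U. \<beta> (U - {n})" n S] fin[OF that(1)] xR \<beta>(1)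
        by (auto simp: le_eq_less_or_eq cong: if_cong)
      also have "?d n (\<lambda>U. \<beta> (U - {n})) (insert n S) = ?d n \<beta> S"
        unfolding koszul_insert[OF order_refl] using fin[OF that(1)] by (intro koszul_cong) auto
      finally show ?thesis
        using sR f min[of "signed ?R ?x n S * ?b S"] by (simp flip: \<beta>(2)[OF that])
    qed
    let ?h = "\<lambda>S. f S + - ?s S"
    have hR: "?h S \<in> carrier ?R" for S
      by (rule poly_ring_closed(3)[OF f poly_ring_closed(5)[OF s]])
    have "?d n ?h S = 0" if "S \<subseteq> {..<n}" "card S = j" for S
    proof -
      have "?d n (\<lambda>S. f S \<oplus>\<^bsub>self_module ?R\<^esub> (\<ominus>\<^bsub>self_module ?R\<^esub> ?s S)) S
        = ?d n f S \<oplus>\<^bsub>self_module ?R\<^esub> ?d n (\<lambda>S. \<ominus>\<^bsub>self_module ?R\<^esub> ?s S) S"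
        using xR f s by (intro S.koszul_add) (auto simp: min)
      also have "?d n (\<lambda>S. \<ominus>\<^bsub>self_module ?R\<^esub> ?s S) S = \<ominus>\<^bsub>self_module ?R\<^esub> ?d n ?s S"
        using xR s by (intro S.koszul_minus) auto
      also have "?d n ?s S = - (signed ?R ?x n S * ?b S)" by (rule ds[OF that])
      finally have "?d n (\<lambda>S. f S \<oplus>\<^bsub>self_module ?R\<^esub> (\<ominus>\<^bsub>self_module ?R\<^esub> ?s S)) S
        = ?d n f S + signed ?R ?x n S * ?b S"
        using sR f by (simp add: min)
      also have "\<dots> = ?d (Suc n) f S" using fin[OF that(1)] by simp
      also have "\<dots> = 0" by (rule cyc) (use that in auto)
      finally show ?thesis using s by (simp add: min)
    qed
    then have dh: "\<And>S. S \<subseteq> {..<n} \<Longrightarrow> Suc (card S) = Suc j \<Longrightarrow> ?d n ?h S = \<zero>\<^bsub>self_module ?R\<^esub>"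
      by simp
    have hR': "\<And>S. ?h S \<in> carrier (self_module ?R)" using hR by simp
    obtain \<gamma> where \<gamma>': "\<And>S. \<gamma> S \<in> carrier (self_module ?R)"
      and \<gamma>'': "\<And>S. S \<subseteq> {..<n} \<Longrightarrow> card S = Suc j \<Longrightarrow> ?h S = ?d n \<gamma> S"
      by (rule koszul_exactE[OF IH[of j] hR' dh]) auto
    then have \<gamma>: "\<And>S. \<gamma> S \<in> carrier ?R"
      "\<And>S. S \<subseteq> {..<n} \<Longrightarrow> card S = Suc j \<Longrightarrow> ?h S = ?d n \<gamma> S"
      by simp_all
    let ?g = "\<lambda>T. if n \<in> T then \<beta> (T - {n}) else \<gamma> T"
    have "f S = ?d (Suc n) ?g S" if S: "S \<subseteq> {..<Suc n}" "card S = Suc j" for S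
    proof (cases "n \<in> S")
      case True
      define S0 where "S0 = S - {n}"
      have S0: "S = insert n S0" "S0 \<subseteq> {..<n}" "card S0 = j"
        using True S by (auto simp: S0_def less_Suc_eq)
      have "?d n ?g (insert n S0) = ?d n \<beta> S0"
        unfolding koszul_insert[OF order_refl] using fin[OF S0(2)] by (intro koszul_cong) auto
      then show ?thesis using \<beta>(2)[OF S0(2,3)] S0(1) by simp
    next
      case False
      then have S': "S \<subseteq> {..<n}" using S by (auto simp: less_Suc_eq)
      have "?d n ?g S = ?d n \<gamma> S" using False by (intro koszul_cong) auto
      then show ?thesis using \<gamma>(2)[OF S' S(2)] False by (simp add: algebra_simps)
    qed
    then show "\<exists>g. (\<forall>S. g S \<in> carrier (self_module ?R)) \<and> (\<forall>S\<subseteq>{..<Suc n}. card S = Suc j \<longrightarrow>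
      f S = ?d (Suc n) g S)"
      using \<beta>(1) \<gamma>(1) by (intro exI[of _ ?g]) auto
  qed
qed

section \<open>Squarefree monomial ideals, described by the supports of monomials\<close>

definition sqfree_ideal :: "'x set \<Rightarrow> 'x set set \<Rightarrow> (('x \<Rightarrow>\<^sub>0 nat) \<Rightarrow>\<^sub>0 'k::field) set" where
  "sqfree_ideal X G = {p \<in> carrier (poly_ring X).
     \<forall>m \<in> Poly_Mapping.keys p. \<exists>E \<in> G. E \<subseteq> Poly_Mapping.keys m}"

lemma sqfree_ideal_zero: "0 \<in> sqfree_ideal X G"
  by (simp add: sqfree_ideal_def)

lemma sqfree_ideal_add:
  assumes "p \<in> sqfree_ideal X G" "q \<in> sqfree_ideal X G"
  shows "p + q \<in> sqfree_ideal X G"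
  using assms Poly_Mapping.keys_add[of p q] unfolding sqfree_ideal_def by auto

lemma sqfree_ideal_mult:
  assumes "p \<in> sqfree_ideal X G" "q \<in> carrier (poly_ring X)"
  shows "q * p \<in> sqfree_ideal X G"
proof -
  have "\<exists>E\<in>G. E \<subseteq> Poly_Mapping.keys m" if "m \<in> Poly_Mapping.keys (q * p)" for m
  proof -
    from keys_mult[of q p] that
    have "m \<in> {a + b | a b. a \<in> Poly_Mapping.keys q \<and> b \<in> Poly_Mapping.keys p}" by (rule subsetD)
    then obtain m1 m2 where m: "m = m1 + m2" "m2 \<in> Poly_Mapping.keys p" by auto
    then obtain E where "E \<in> G" "E \<subseteq> Poly_Mapping.keys m2"
      using assms(1) unfolding sqfree_ideal_def by blast
    then show ?thesis using m(1) by (auto simp: keys_add_nat)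
  qed
  then show ?thesis using assms by (auto simp: sqfree_ideal_def)
qed

lemma sqfree_ideal_minus:
  assumes "p \<in> sqfree_ideal X G" shows "- p \<in> sqfree_ideal X G"
  using assms unfolding sqfree_ideal_def by (auto simp: in_keys_iff)

lemma ideal_sqfree_ideal: "ideal (sqfree_ideal X G) (poly_ring X :: (('x \<Rightarrow>\<^sub>0 nat) \<Rightarrow>\<^sub>0 'k::field) ring)"
proof -
  interpret cring "poly_ring X :: (('x \<Rightarrow>\<^sub>0 nat) \<Rightarrow>\<^sub>0 'k) ring" by (rule poly_ring_cring)
  show ?thesis
  proof (rule idealI)
    show "ring (poly_ring X :: (('x \<Rightarrow>\<^sub>0 nat) \<Rightarrow>\<^sub>0 'k) ring)" ..
    show "subgroup (sqfree_ideal X G) (add_monoid (poly_ring X :: (('x \<Rightarrow>\<^sub>0 nat) \<Rightarrow>\<^sub>0 'k) ring))"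
    proof (rule add.subgroupI)
      show "\<ominus>\<^bsub>poly_ring X\<^esub> p \<in> sqfree_ideal X G" if "p \<in> sqfree_ideal X G" for p :: "('x \<Rightarrow>\<^sub>0 nat) \<Rightarrow>\<^sub>0 'k"
        using that sqfree_ideal_minus[OF that] by (auto simp: sqfree_ideal_def)
      show "p \<oplus>\<^bsub>poly_ring X\<^esub> q \<in> sqfree_ideal X G"
        if "p \<in> sqfree_ideal X G" "q \<in> sqfree_ideal X G" for p q :: "('x \<Rightarrow>\<^sub>0 nat) \<Rightarrow>\<^sub>0 'k"
        using sqfree_ideal_add that by simp
    qed (use sqfree_ideal_zero in \<open>auto simp: sqfree_ideal_def\<close>)
  qed (use sqfree_ideal_mult in \<open>auto simp: mult.commute\<close>)
qed

definition monom_of :: "'x set \<Rightarrow> 'x \<Rightarrow>\<^sub>0 nat" where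
  "monom_of E = (\<Sum>x\<in>E. Poly_Mapping.single x 1)"

lemma lookup_monom_of: "finite E \<Longrightarrow> Poly_Mapping.lookup (monom_of E) x = (if x \<in> E then 1 else 0)"
  by (simp add: monom_of_def lookup_sum lookup_single when_def)

lemma keys_monom_of: "finite E \<Longrightarrow> Poly_Mapping.keys (monom_of E) = E"
  by (auto simp: in_keys_iff lookup_monom_of split: if_splits)

lemma monom_of_dvd:
  assumes "E \<subseteq> Poly_Mapping.keys m" shows "m = monom_of E + (m - monom_of E)"
proof -
  have "finite E" using finite_subset[OF assms] by simp
  then show ?thesis using assms
    by (intro poly_mapping_eqI) (auto simp: lookup_add lookup_minus lookup_monom_of in_keys_iff)
qed

lemma prod_poly_var:
  "finite E \<Longrightarrow> (\<Prod>x\<in>E. poly_var x) = (Poly_Mapping.single (monom_of E) 1 :: ('x \<Rightarrow>\<^sub>0 nat) \<Rightarrow>\<^sub>0 'k::field)"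
  by (induction E rule: finite_induct) (simp_all add: monom_of_def poly_var_def mult_single)

text \<open>Polynomials all of whose monomials are multiples of generators form an ideal, which
  gives one inclusion; for the other, such a polynomial is the sum of its terms, each a multiple of
  a generator.\<close>

lemma genideal_monomials:
  assumes "\<And>E. E \<in> G \<Longrightarrow> finite E \<and> E \<subseteq> X"
  shows "Idl\<^bsub>poly_ring X\<^esub> ((\<lambda>E. \<Prod>x\<in>E. poly_var x) ` G) = (sqfree_ideal X G :: (('x \<Rightarrow>\<^sub>0 nat) \<Rightarrow>\<^sub>0 'k::field) set)"
proof -
  let ?R = "poly_ring X :: (('x \<Rightarrow>\<^sub>0 nat) \<Rightarrow>\<^sub>0 'k) ring"
  let ?S = "(\<lambda>E. \<Prod>x\<in>E. poly_var x) ` G :: (('x \<Rightarrow>\<^sub>0 nat) \<Rightarrow>\<^sub>0 'k) set"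
  interpret cring ?R by (rule poly_ring_cring)
  have gen: "(\<Prod>x\<in>E. poly_var x) \<in> (sqfree_ideal X G :: (('x \<Rightarrow>\<^sub>0 nat) \<Rightarrow>\<^sub>0 'k) set)" if "E \<in> G" for E
    using assms[OF that] that by (auto simp: prod_poly_var sqfree_ideal_def in_poly_ring keys_monom_of)
  then have S: "?S \<subseteq> carrier ?R" by (auto simp: sqfree_ideal_def)
  show ?thesis
  proof
    show "Idl\<^bsub>?R\<^esub> ?S \<subseteq> sqfree_ideal X G"
      using gen by (intro genideal_minimal ideal_sqfree_ideal) auto
    interpret I: ideal "Idl\<^bsub>?R\<^esub> ?S" ?R by (rule genideal_ideal[OF S])
    show "sqfree_ideal X G \<subseteq> Idl\<^bsub>?R\<^esub> ?S"
    proof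
      fix p :: "('x \<Rightarrow>\<^sub>0 nat) \<Rightarrow>\<^sub>0 'k" assume p: "p \<in> sqfree_ideal X G"
      have mono: "Poly_Mapping.single m a \<in> Idl\<^bsub>?R\<^esub> ?S" if m: "m \<in> Poly_Mapping.keys p" for m and a :: 'k
      proof -
        obtain E where E: "E \<in> G" "E \<subseteq> Poly_Mapping.keys m"
          using p m by (auto simp: sqfree_ideal_def)
        have mX: "Poly_Mapping.keys m \<subseteq> X" using p m by (auto simp: sqfree_ideal_def in_poly_ring)
        let ?r = "Poly_Mapping.single (m - monom_of E) a"
        have "Poly_Mapping.keys (m - monom_of E) \<subseteq> Poly_Mapping.keys m"
          by (auto simp: in_keys_iff lookup_minus)
        then have r: "?r \<in> carrier ?R" using mX by (auto simp: in_poly_ring)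
        have "(\<Prod>x\<in>E. poly_var x) \<in> Idl\<^bsub>?R\<^esub> ?S" using genideal_self[OF S] E(1) by blast
        from I.I_l_closed[OF this r]
        have "Poly_Mapping.single (m - monom_of E + monom_of E) a \<in> Idl\<^bsub>?R\<^esub> ?S"
          using assms[OF E(1)] by (simp add: prod_poly_var mult_single)
        then show ?thesis using monom_of_dvd[OF E(2)] by (metis add.commute)
      qed
      have "(\<Sum>m\<in>K. Poly_Mapping.single m (Poly_Mapping.lookup p m)) \<in> Idl\<^bsub>?R\<^esub> ?S"
        if "K \<subseteq> Poly_Mapping.keys p" "finite K" for K
        using that(2,1)
      proof (induction K rule: finite_induct)
        case (insert m K)
        then show ?case using I.a_closed[OF mono] by simp
      qed (use I.zero_closed in simp)
      moreover have "p = (\<Sum>m\<in>Poly_Mapping.keys p. Poly_Mapping.single m (Poly_Mapping.lookup p m))"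
        by (intro poly_mapping_eqI) (auto simp: lookup_sum lookup_single when_def in_keys_iff)
      ultimately show "p \<in> Idl\<^bsub>?R\<^esub> ?S" by (metis finite_keys order_refl)
    qed
  qed
qed

definition vertex_edges :: "'v set set \<Rightarrow> 'v \<Rightarrow> 'v set set" where
  "vertex_edges H v = {E \<in> H. v \<in> E}"

lemma hypergraph_ideal_sqfree:
  assumes "finite H"
  shows "(hypergraph_ideal V H :: (('v set \<Rightarrow>\<^sub>0 nat) \<Rightarrow>\<^sub>0 'k::field) set) = sqfree_ideal H (vertex_edges H ` V)"
proof -
  have "(vertex_monomial H ` V :: (('v set \<Rightarrow>\<^sub>0 nat) \<Rightarrow>\<^sub>0 'k) set) = (\<lambda>E. \<Prod>x\<in>E. poly_var x) ` vertex_edges H ` V"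
    by (auto simp: vertex_monomial_def vertex_edges_def image_image)
  then show ?thesis unfolding hypergraph_ideal_def
    using assms by (subst genideal_monomials[symmetric]) (auto simp: vertex_edges_def)
qed

section \<open>A lower bound for the projective dimension\<close>

definition select :: "nat \<Rightarrow> (nat \<Rightarrow> nat) \<Rightarrow> nat set" where
  "select k \<phi> = (\<lambda>j. 3 * j + \<phi> j) ` {..<k}"

lemma in_select:
  assumes "\<And>j. \<phi> j < 3"
  shows "i \<in> select k \<phi> \<longleftrightarrow> i < 3 * k \<and> i mod 3 = \<phi> (i div 3)"
proof
  assume "i \<in> select k \<phi>"
  then obtain j where "j < k" "i = 3 * j + \<phi> j" by (auto simp: select_def)
  with assms[of j] show "i < 3 * k \<and> i mod 3 = \<phi> (i div 3)" by auto
next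
  assume i: "i < 3 * k \<and> i mod 3 = \<phi> (i div 3)"
  then have "i = 3 * (i div 3) + \<phi> (i div 3)" by (metis mult_div_mod_eq)
  moreover have "i div 3 < k" using i by auto
  ultimately show "i \<in> select k \<phi>" unfolding select_def by blast
qed

lemma inj_on_select:
  fixes \<phi> :: "nat \<Rightarrow> nat"
  assumes "\<And>j. \<phi> j < 3"
  shows "inj_on (\<lambda>j. 3 * j + \<phi> j) A"
proof (rule inj_onI)
  fix i j assume "3 * i + \<phi> i = 3 * j + \<phi> j"
  then have "(3 * i + \<phi> i) div 3 = (3 * j + \<phi> j) div 3" by simp
  with assms[of i] assms[of j] show "i = j" by simp
qed

lemma card_select: "(\<And>j. \<phi> j < 3) \<Longrightarrow> card (select k \<phi>) = k"
  by (simp add: select_def card_image inj_on_select)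

text \<open>The supports of the terms of the Koszul cycle. They form a walk: from \<open>t\<close>
  to \<open>Suc t\<close> only the choice in block \<open>t\<close> changes, from the third index to
  the first.\<close>

definition zigzag :: "nat \<Rightarrow> nat \<Rightarrow> nat set" where
  "zigzag k t = select k (\<lambda>j. if j < t then 0 else 2)"

text \<open>The facets of the boundary of a cross-polytope whose \<open>k\<close> pairs of opposite
  vertices are \<open>3 * j\<close> and \<open>3 * j + 1\<close>.\<close>

definition cross :: "nat \<Rightarrow> nat set \<Rightarrow> nat set" where
  "cross k B = select k (\<lambda>j. if j \<in> B then 1 else 0)"

lemma in_zigzag: "i \<in> zigzag k t \<longleftrightarrow> i < 3 * k \<and> i mod 3 = (if i div 3 < t then 0 else 2)"
  unfolding zigzag_def by (rule in_select) auto

lemma in_cross: "i \<in> cross k B \<longleftrightarrow> i < 3 * k \<and> i mod 3 = (if i div 3 \<in> B then 1 else 0)"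
  unfolding cross_def by (rule in_select) auto

lemma card_cross: "card (cross k B) = k"
  unfolding cross_def by (rule card_select) auto

lemma finite_zigzag [simp]: "finite (zigzag k t)"
  by (simp add: zigzag_def select_def)

lemma finite_cross [simp]: "finite (cross k B)"
  by (simp add: cross_def select_def)

text \<open>A facet never takes the third index of a block and a zigzag never the second, so the
  Koszul cycle meets the cross-polytope in exactly one term.\<close>

lemma zigzag_eq_cross:
  assumes "zigzag k t = cross k B" "t \<le> k" "B \<subseteq> {..<k}"
  shows "t = k \<and> B = {}"
proof -
  have "t = k"
  proof (rule ccontr)
    assume "t \<noteq> k"
    moreover have "(3 * t + 2) mod 3 = 2" "(3 * t + 2) div 3 = t" by presburger+
    ultimately have "3 * t + 2 \<in> zigzag k t" unfolding in_zigzag using assms(2) by simp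
    moreover have "(3 * t + 2) mod 3 = 2" by presburger
    ultimately show False unfolding assms(1) in_cross by (auto split: if_splits)
  qed
  moreover have "j \<notin> B" for j
  proof
    assume j: "j \<in> B"
    moreover have "(3 * j + 1) mod 3 = 1" "(3 * j + 1) div 3 = j" by presburger+
    ultimately have "3 * j + 1 \<in> cross k B" unfolding in_cross using assms(3) by auto
    then show False unfolding assms(1)[symmetric] by (simp add: in_zigzag split: if_splits)
  qed
  ultimately show ?thesis by blast
qed

text \<open>Consecutive zigzags are contained in a common set with one more element, where the terms
  of their Koszul boundaries meet and cancel.\<close>

lemma zigzag_Suc:
  assumes "t < k"
  shows "insert (3 * t) (zigzag k t) = insert (3 * t + 2) (zigzag k (Suc t))"
proof -
  have "i \<in> insert (3 * t) (zigzag k t) \<longleftrightarrow> i \<in> insert (3 * t + 2) (zigzag k (Suc t))" for i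
  proof (cases "i div 3 = t")
    case True
    then have "i = 3 * t \<or> i = 3 * t + 1 \<or> i = 3 * t + 2" by presburger
    moreover have "(3 * t + 1) mod 3 = 1" "(3 * t + 2) mod 3 = 2" "(3 * t + 1) div 3 = t"
      "(3 * t + 2) div 3 = t" by presburger+
    ultimately show ?thesis using assms unfolding insert_iff in_zigzag by (elim disjE) simp_all
  next
    case False
    then have "i \<noteq> 3 * t" "i \<noteq> 3 * t + 2" "i div 3 < t \<longleftrightarrow> i div 3 < Suc t" by auto
    then show ?thesis by (simp add: in_zigzag)
  qed
  then show ?thesis by blast
qed

lemma sum_Pow_cancel:
  fixes h :: "'a set \<Rightarrow> 'b::comm_monoid_add"
  assumes "finite A" "a \<in> A" and "\<And>B. B \<subseteq> A \<Longrightarrow> a \<notin> B \<Longrightarrow> h B + h (insert a B) = 0"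
  shows "(\<Sum>B\<in>Pow A. h B) = 0"
proof -
  let ?A = "A - {a}"
  have A: "A = insert a ?A" using assms(2) by auto
  have "Pow A = Pow ?A \<union> insert a ` Pow ?A" by (subst A) (rule Pow_insert)
  moreover have "Pow ?A \<inter> insert a ` Pow ?A = {}" by auto
  moreover have "inj_on (insert a) (Pow ?A)" by (rule inj_onI) (auto simp: insert_ident)
  ultimately have "(\<Sum>B\<in>Pow A. h B) = (\<Sum>B\<in>Pow ?A. h B + h (insert a B))"
    using assms(1) by (simp add: sum.union_disjoint sum.reindex sum.distrib)
  also have "\<dots> = 0" by (rule sum.neutral) (use assms in auto)
  finally show ?thesis .
qed

lemma sqfree_ideal_sum:
  assumes "\<And>v. v \<in> A \<Longrightarrow> f v \<in> sqfree_ideal X G"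
  shows "sum f A \<in> sqfree_ideal X G"
  using assms by (induction A rule: infinite_finite_induct) (auto intro: sqfree_ideal_zero sqfree_ideal_add)

lemma zigzag_ridge:
  assumes \<rho>: "v \<in> \<rho>" "\<rho> - {v} = zigzag k t" and "t \<le> k" and v: "v = 3 * t \<and> t < k \<or> v + 1 = 3 * t"
  obtains s where "s < k" "v = 3 * s \<or> v = 3 * s + 2" "\<rho> = insert (3 * s) (zigzag k s)"
proof (cases "v = 3 * t \<and> t < k")
  case True
  then show ?thesis using that[of t] \<rho> by auto
next
  case False
  then obtain s where s: "t = Suc s" "v = 3 * s + 2" using v by (cases t) auto
  then have "\<rho> = insert (3 * s + 2) (zigzag k (Suc s))" using \<rho> by auto
  also have "\<dots> = insert (3 * s) (zigzag k s)" using zigzag_Suc[of s k] s \<open>t \<le> k\<close> by simp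
  finally show ?thesis using that[of s] s \<open>t \<le> k\<close> by simp
qed

lemma zigzag_ridge_unique:
  assumes "insert (3 * s) (zigzag k s) = insert (3 * s') (zigzag k s')" "s < k" "s' < k"
  shows "s = s'"
proof (rule ccontr)
  assume "s \<noteq> s'"
  have *: "(3 * i + 2) mod 3 = 2" "(3 * i + 2) div 3 = i" for i :: nat by presburger+
  have "3 * s' \<in> insert (3 * s) (zigzag k s)" "3 * s' + 2 \<in> insert (3 * s) (zigzag k s)"
    using assms zigzag_Suc[of s' k] by auto
  moreover have "3 * s' \<noteq> 3 * s" "3 * s' + 2 \<noteq> 3 * s" using \<open>s \<noteq> s'\<close> by presburger+
  ultimately have "3 * s' \<in> zigzag k s" "3 * s' + 2 \<in> zigzag k s" by blast+
  then show False using *[of s'] unfolding in_zigzag by (auto split: if_splits)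
qed

text \<open>The multidegree considered is that of \<open>Y\<close> times the product of all
  variables \<open>c v\<close>; a chain at \<open>S\<close> is read as a cochain at the complement
  of \<open>S\<close>. The assumption \<open>kill\<close> makes the sum of all zigzags a cocycle
  modulo \<open>I\<close>, \<open>free\<close> makes the cross-polytope a subcomplex of the sets
  outside \<open>I\<close>, and evaluation on it shows that the cocycle is not a coboundary. For
  \<open>k = 0\<close> the assumptions say that after inverting \<open>Y\<close> the ideal contains
  every \<open>c v\<close> but not 1.\<close>

lemma proj_dim_sqfree_ge:
  fixes c :: "nat \<Rightarrow> 'x"
  assumes inj: "inj_on c {..<N}" and cX: "c ` {..<N} \<subseteq> X" and Y: "finite Y" "Y \<subseteq> X" and kN: "3 * k \<le> N"
    and kill: "\<And>t v. t \<le> k \<Longrightarrow> v < N \<Longrightarrow> v \<notin> zigzag k t \<Longrightarrow> \<not> (v = 3 * t \<and> t < k) \<Longrightarrow> v + 1 \<noteq> 3 * t \<Longrightarrow>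
      \<exists>E \<in> G. E \<subseteq> Y \<union> c ` insert v (zigzag k t)"
    and free: "\<And>B E. B \<subseteq> {..<k} \<Longrightarrow> E \<in> G \<Longrightarrow> \<not> E \<subseteq> Y \<union> c ` cross k B"
  shows "proj_dim (poly_ring X) (quotient_module (poly_ring X)
    (sqfree_ideal X G :: (('x \<Rightarrow>\<^sub>0 nat) \<Rightarrow>\<^sub>0 'k::field) set)) \<ge> enat (N - k)"
proof (rule ccontr)
  let ?R = "poly_ring X :: (('x \<Rightarrow>\<^sub>0 nat) \<Rightarrow>\<^sub>0 'k) ring"
  let ?I = "sqfree_ideal X G :: (('x \<Rightarrow>\<^sub>0 nat) \<Rightarrow>\<^sub>0 'k) set"
  let ?\<sigma> = "{..<N}"
  assume "\<not> proj_dim ?R (quotient_module ?R ?I) \<ge> enat (N - k)"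
  then have lt: "proj_dim ?R (quotient_module ?R ?I) < enat (N - k)" by simp
  then obtain n where "proj_dim ?R (quotient_module ?R ?I) = enat n"
    by (cases "proj_dim ?R (quotient_module ?R ?I)") auto
  with lt have n: "proj_dim ?R (quotient_module ?R ?I) \<le> enat n" "n < N - k" by simp_all
  define M where "M \<rho> = monom_of Y + (\<Sum>i\<in>\<rho>. Poly_Mapping.single (c i) (1::nat))" for \<rho>
  have keys_sum: "Poly_Mapping.keys (\<Sum>i\<in>\<rho>. Poly_Mapping.single (c i) (1::nat)) = c ` \<rho>"
    if "finite \<rho>" for \<rho>
    using that by (induction \<rho> rule: finite_induct) (auto simp: keys_add_nat)
  have keysM: "Poly_Mapping.keys (M \<rho>) = Y \<union> c ` \<rho>" if "finite \<rho>" for \<rho>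
    using that Y(1) by (simp add: M_def keys_add_nat keys_sum keys_monom_of del: One_nat_def)
  have M_split: "M \<rho> = Poly_Mapping.single (c v) 1 + M (\<rho> - {v})" if "finite \<rho>" "v \<in> \<rho>" for \<rho> v
    using that by (simp add: M_def sum.remove[of \<rho> v] add_ac)
  define T where "T = zigzag k ` {..k}"
  \<comment> \<open>The coefficient at \<open>S\<close> carries the monomial of the complement of
    \<open>S\<close>, so all terms have the same multidegree. No signs are needed, since the Koszul
    signs of neighbouring zigzags are already opposite.\<close>
  define z where "z S = (if ?\<sigma> - S \<in> T then Poly_Mapping.single (M (?\<sigma> - S)) (1::'k) else 0)" for S
  have zR: "z S \<in> carrier ?R" for S
    using cX Y(2) by (auto simp: z_def in_poly_ring keysM)
  have cyc: "var_koszul X c N z S \<in> ?I" if S: "S \<subseteq> ?\<sigma>" for S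
  proof -
    define \<rho> where "\<rho> = ?\<sigma> - S"
    have fin: "finite \<rho>" by (simp add: \<rho>_def)
    let ?m = "Poly_Mapping.single (M \<rho>) (1::'k)"
    have term_eq: "poly_var (c v) * z (insert v S) = (if \<rho> - {v} \<in> T then ?m else 0)"
      if "v \<in> \<rho>" for v
    proof -
      have "?\<sigma> - insert v S = \<rho> - {v}" by (auto simp: \<rho>_def)
      then show ?thesis using M_split[OF fin that] by (simp add: z_def poly_var_def mult_single)
    qed
    let ?t = "\<lambda>v. if even (card {u \<in> S. u < v}) then if \<rho> - {v} \<in> T then ?m else 0
      else - (if \<rho> - {v} \<in> T then ?m else 0)"
    have "var_koszul X c N z S = (\<Sum>v\<in>\<rho>. if even (card {u \<in> S. u < v}) then poly_var (c v) * z (insert v S)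
      else - (poly_var (c v) * z (insert v S)))"
      unfolding var_koszul_sum[OF cX] \<rho>_def ..
    also have "\<dots> = sum ?t \<rho>" by (intro sum.cong refl) (simp add: term_eq)
    finally have dz: "var_koszul X c N z S = sum ?t \<rho>" .
    show ?thesis
    proof (cases "\<exists>E\<in>G. E \<subseteq> Y \<union> c ` \<rho>")
      case True
      then have m: "?m \<in> ?I"
        using cX Y(2) fin by (auto simp: sqfree_ideal_def in_poly_ring keysM \<rho>_def)
      have "?t v \<in> ?I" for v
        using m sqfree_ideal_minus[OF m] by (simp add: sqfree_ideal_zero)
      then show ?thesis unfolding dz by (intro sqfree_ideal_sum)
    next
      case False
      \<comment> \<open>No generator divides the monomial of \<open>\<rho>\<close>, so
        \<open>kill\<close> leaves only the common supersets of two consecutive zigzags.\<close>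
      have ridge: "\<exists>s<k. (v = 3 * s \<or> v = 3 * s + 2) \<and> \<rho> = insert (3 * s) (zigzag k s)"
        if v: "v \<in> \<rho>" "\<rho> - {v} \<in> T" for v
      proof -
        obtain t where t: "t \<le> k" "\<rho> - {v} = zigzag k t" using v(2) by (auto simp: T_def)
        then have "\<rho> = insert v (zigzag k t)" "v \<notin> zigzag k t" "v < N" using v(1) by (auto simp: \<rho>_def)
        then have "v = 3 * t \<and> t < k \<or> v + 1 = 3 * t" using kill[OF t(1)] False by blast
        from zigzag_ridge[OF v(1) t(2,1) this] show ?thesis by metis
      qed
      have "sum ?t \<rho> = 0"
      proof (cases "\<exists>v\<in>\<rho>. \<rho> - {v} \<in> T")
        case False
        then show ?thesis by (intro sum.neutral) auto
      next
        case True
        then obtain s where s: "s < k" "\<rho> = insert (3 * s) (zigzag k s)" using ridge by blast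
        then have s': "\<rho> = insert (3 * s + 2) (zigzag k (Suc s))" using zigzag_Suc by simp
        have nz: "3 * s \<notin> zigzag k s" "3 * s + 1 \<notin> \<rho>" "3 * s + 2 \<notin> zigzag k (Suc s)"
        proof -
          have "(3 * s + 1) mod 3 = 1" "(3 * s + 2) mod 3 = 2" "(3 * s + 2) div 3 = s" by presburger+
          then show "3 * s \<notin> zigzag k s" "3 * s + 1 \<notin> \<rho>" "3 * s + 2 \<notin> zigzag k (Suc s)"
            unfolding s(2) insert_iff in_zigzag by auto
        qed
        then have T: "\<rho> - {3 * s} \<in> T" "\<rho> - {3 * s + 2} \<in> T"
          using s s' by (auto simp: T_def)
        have mem: "3 * s \<in> \<rho>" "3 * s + 2 \<in> \<rho>" using s(2) s' by auto
        have "sum ?t \<rho> = sum ?t {3 * s, 3 * s + 2}"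
        proof (rule sum.mono_neutral_right[OF fin])
          show "{3 * s, 3 * s + 2} \<subseteq> \<rho>" using mem by simp
          show "\<forall>v\<in>\<rho> - {3 * s, 3 * s + 2}. ?t v = 0"
          proof
            fix v assume v: "v \<in> \<rho> - {3 * s, 3 * s + 2}"
            have "\<rho> - {v} \<notin> T"
            proof
              assume "\<rho> - {v} \<in> T"
              then obtain s'' where s'': "s'' < k" "v = 3 * s'' \<or> v = 3 * s'' + 2"
                "\<rho> = insert (3 * s'') (zigzag k s'')" using ridge v by blast
              then have "s'' = s" using zigzag_ridge_unique s by metis
              then show False using s''(2) v by blast
            qed
            then show "?t v = 0" by simp
          qed
        qed
        \<comment> \<open>The index \<open>3 * s + 1\<close> belongs to \<open>S\<close> and
          \<open>3 * s\<close> does not. The two surviving terms therefore have opposite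
          signs.\<close>
        also have "{u \<in> S. u < 3 * s + 2} = insert (3 * s + 1) {u \<in> S. u < 3 * s}"
        proof -
          have "3 * s + 1 < N" using s(1) kN by simp
          then have "3 * s + 1 \<in> S" "3 * s \<notin> S" using nz(2) mem(1) by (auto simp: \<rho>_def)
          then show ?thesis by (auto simp: less_Suc_eq numeral_2_eq_2)
        qed
        then have "card {u \<in> S. u < 3 * s + 2} = Suc (card {u \<in> S. u < 3 * s})"
          using finite_subset[OF S] by simp
        then have "sum ?t {3 * s, 3 * s + 2} = 0" using T by simp
        finally show ?thesis .
      qed
      then show ?thesis unfolding dz by (simp add: sqfree_ideal_zero)
    qed
  qed
  have xR: "poly_var (c v) \<in> carrier ?R" if "v < N" for v using cX that by auto
  obtain w where w: "\<And>S. S \<subseteq> ?\<sigma> \<Longrightarrow> card S = N - k \<Longrightarrow>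
      z S \<oplus>\<^bsub>?R\<^esub> \<ominus>\<^bsub>?R\<^esub> var_koszul X c N w S \<in> ?I" and wR: "\<And>S. w S \<in> carrier ?R"
    by (rule koszul_boundary_of_proj_dim[OF poly_ring_cring ideal_sqfree_ideal n xR var_koszul_exact[OF inj cX] zR cyc]) auto
  interpret S: plain_module ?R "self_module ?R"
    by (intro plain_module.intro self_module poly_ring_cring)
  have dwR: "var_koszul X c N w S \<in> carrier ?R" for S
    using S.koszul_closed[of N "\<lambda>v. poly_var (c v)" w S] xR wR by simp
  let ?S = "\<lambda>B. ?\<sigma> - cross k B"
  have cross_sub: "cross k B \<subseteq> ?\<sigma>" for B using kN by (auto simp: in_cross)
  have dbl: "?\<sigma> - ?S B = cross k B" for B using cross_sub[of B] by auto
  have coeff: "Poly_Mapping.lookup (z (?S B)) (M (cross k B))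
      = Poly_Mapping.lookup (var_koszul X c N w (?S B)) (M (cross k B))" if B: "B \<subseteq> {..<k}" for B
  proof -
    let ?p = "z (?S B) - var_koszul X c N w (?S B)"
    have "card (?S B) = N - k"
      using cross_sub[of B] by (simp add: card_Diff_subset card_cross)
    then have p: "?p \<in> ?I" using w[of "?S B"] dwR by simp
    have "M (cross k B) \<notin> Poly_Mapping.keys ?p"
    proof
      assume "M (cross k B) \<in> Poly_Mapping.keys ?p"
      then have "\<exists>E\<in>G. E \<subseteq> Poly_Mapping.keys (M (cross k B))"
        using p unfolding sqfree_ideal_def by blast
      then show False using free[OF B] by (auto simp: keysM)
    qed
    then show ?thesis by (simp add: in_keys_iff lookup_minus)
  qed
  have z_coeff: "Poly_Mapping.lookup (z (?S B)) (M (cross k B)) = (if B = {} then 1 else 0)"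
    if B: "B \<subseteq> {..<k}" for B
  proof -
    have "cross k {} = zigzag k k"
      by (auto simp: in_cross in_zigzag)
    then have "cross k B \<in> T \<longleftrightarrow> B = {}"
      using zigzag_eq_cross[OF _ _ B] by (auto simp: T_def)
    then show ?thesis by (simp add: z_def dbl)
  qed
  \<comment> \<open>The contribution of the ridge opposite to the vertex in block \<open>j\<close>
    to the boundary of \<open>w\<close> at the facet of \<open>B\<close>.\<close>
  define h where "h j B = (let v = 3 * j + (if j \<in> B then 1 else 0);
      a = Poly_Mapping.lookup (w (insert v (?S B))) (M (cross k B - {v}))
    in if even (card {u \<in> ?S B. u < v}) then a else - a)" for j B
  have dw_coeff: "Poly_Mapping.lookup (var_koszul X c N w (?S B)) (M (cross k B)) = (\<Sum>j<k. h j B)" for B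
  proof -
    let ?v = "\<lambda>j. 3 * j + (if j \<in> B then 1 else 0 :: nat)"
    let ?a = "\<lambda>v. Poly_Mapping.lookup (w (insert v (?S B))) (M (cross k B - {v}))"
    have l: "Poly_Mapping.lookup (poly_var (c v) * w (insert v (?S B))) (M (cross k B)) = ?a v"
      if "v \<in> cross k B" for v
      by (simp only: M_split[OF finite_cross that] lookup_poly_var_mult)
    have inj_v: "inj_on ?v {..<k}"
      by (rule inj_on_select) auto
    have "Poly_Mapping.lookup (var_koszul X c N w (?S B)) (M (cross k B)) =
      (\<Sum>v\<in>cross k B. if even (card {u \<in> ?S B. u < v}) then ?a v else - ?a v)"
      unfolding var_koszul_sum[OF cX] lookup_sum dbl by (intro sum.cong refl) (simp add: l)
    also have "\<dots> = (\<Sum>j<k. h j B)"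
      unfolding cross_def select_def by (subst sum.reindex[OF inj_v]) (simp add: h_def Let_def cross_def select_def o_def)
    finally show ?thesis .
  qed
  \<comment> \<open>The facets of \<open>B\<close> and \<open>insert j B\<close> share the ridge
    that omits block \<open>j\<close>. Passing from \<open>3 * j\<close> to \<open>3 * j + 1\<close>
    brings one more index of the complement below the vertex, so the signs differ and the plain sum
    over all facets annihilates every boundary.\<close>
  have h_cancel: "(\<Sum>B\<in>Pow {..<k}. h j B) = 0" if j: "j < k" for j
  proof (rule sum_Pow_cancel)
    fix B assume B: "B \<subseteq> {..<k}" "j \<notin> B"
    let ?C = "insert j B"
    have ne: "3 * j + 1 \<noteq> (3 * j :: nat)" by simp
    have mods: "(3 * j + 1) mod 3 = 1" "(3 * j + 1) div 3 = j" by presburger+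
    have mem: "3 * j \<in> cross k B" "3 * j + 1 \<in> cross k ?C" "3 * j + 1 \<notin> cross k B" "3 * j \<notin> cross k ?C"
      using j B mods unfolding in_cross by auto
    have other: "i \<in> cross k B \<longleftrightarrow> i \<in> cross k ?C" if "i \<noteq> 3 * j" "i \<noteq> 3 * j + 1" for i
    proof (cases "i div 3 = j")
      case True
      then have "i = 3 * j + 2" using that by presburger
      moreover have "(3 * j + 2) mod 3 = 2" by presburger
      ultimately show ?thesis unfolding in_cross by simp
    qed (simp add: in_cross)
    have eq: "cross k ?C - {3 * j + 1} = cross k B - {3 * j}"
    proof (rule Set.set_eqI)
      fix i show "i \<in> cross k ?C - {3 * j + 1} \<longleftrightarrow> i \<in> cross k B - {3 * j}"
        using mem other[of i] by (cases "i = 3 * j"; cases "i = 3 * j + 1") auto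
    qed
    have lt: "3 * j + 1 < N" using j kN by simp
    have ins: "insert (3 * j + 1) (?S ?C) = insert (3 * j) (?S B)"
    proof (rule Set.set_eqI)
      fix i show "i \<in> insert (3 * j + 1) (?S ?C) \<longleftrightarrow> i \<in> insert (3 * j) (?S B)"
        using mem other[of i] lt by (cases "i = 3 * j"; cases "i = 3 * j + 1") auto
    qed
    have "{u \<in> ?S ?C. u < 3 * j + 1} = insert (3 * j) {u \<in> ?S B. u < 3 * j}"
      using mem other lt by (auto simp: less_Suc_eq)
    then have "card {u \<in> ?S ?C. u < 3 * j + 1} = Suc (card {u \<in> ?S B. u < 3 * j})" by simp
    then show "h j B + h j ?C = 0"
      using B(2) by (simp add: h_def Let_def eq[simplified] ins[simplified])
  qed (use j in auto)
  \<comment> \<open>On the left the cocycle is evaluated, with value 1 from \<open>B = {}\<close>;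
    on the right a coboundary, with value 0.\<close>
  have "(\<Sum>B\<in>Pow {..<k}. if B = {} then 1 else 0 :: 'k) = (\<Sum>B\<in>Pow {..<k}. \<Sum>j<k. h j B)"
    using coeff z_coeff dw_coeff by (intro sum.cong) auto
  also have "\<dots> = (\<Sum>j<k. \<Sum>B\<in>Pow {..<k}. h j B)" by (rule sum.swap)
  also have "\<dots> = 0" using h_cancel by simp
  finally show False by simp
qed

section \<open>Upper bounds for the projective dimension\<close>

text \<open>Places an ideal inside the functions on \<open>'m + nat\<close>, so that the ideal and
  all its syzygy modules share the type that \<open>proj_dim\<close> prescribes for
  resolutions.\<close>

definition emb :: "'r::zero \<Rightarrow> ('m + nat) \<Rightarrow> 'r" where
  "emb p = (\<lambda>x. if x = Inr 0 then p else 0)"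

definition smul :: "'r::times \<Rightarrow> ('x \<Rightarrow> 'r) \<Rightarrow> 'x \<Rightarrow> 'r" where
  "smul r f = (\<lambda>x. r * f x)"

definition comb :: "nat \<Rightarrow> (nat \<Rightarrow> 'x \<Rightarrow> 'r) \<Rightarrow> ('m + nat \<Rightarrow> 'r) \<Rightarrow> 'x \<Rightarrow> 'r::comm_ring_1" where
  "comb b g a = (\<Sum>j<b. smul (a (Inr j)) (g j))"

lemma smul_simps [simp]:
  "smul 0 f = (0 :: 'x \<Rightarrow> 'r::comm_ring_1)" "smul r 0 = (0 :: 'x \<Rightarrow> 'r)" "smul 1 f = (f :: 'x \<Rightarrow> 'r)"
  by (auto simp: smul_def fun_eq_iff)

lemma smul_algebra:
  fixes f g :: "'x \<Rightarrow> 'r::comm_ring_1"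
  shows "smul r (f + g) = smul r f + smul r g" "smul (r + s) f = smul r f + smul s f"
    "smul r (smul s f) = smul (r * s) f" "smul (- r) f = - smul r f" "smul r (- f) = - smul r f"
  by (auto simp: smul_def fun_eq_iff algebra_simps)

lemma sum_fun: "(\<Sum>j\<in>A. h j) x = (\<Sum>j\<in>A. h j x :: 'r::comm_ring_1)"
  by (induction A rule: infinite_finite_induct) auto

lemma comb_apply: "comb b g a x = (\<Sum>j<b. a (Inr j) * g j x)"
  by (simp add: comb_def sum_fun smul_def)

lemma comb_add: "comb b g (a + a') = comb b g a + comb b g a'"
  by (simp add: comb_def smul_algebra sum.distrib)

lemma comb_smul: "comb b g (smul r a) = smul r (comb b g a)"
  by (rule ext) (simp add: comb_apply smul_def sum_distrib_left mult_ac)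

lemma comb_minus: "comb b g (- a) = - comb b g a"
  by (simp add: comb_def smul_algebra sum_negf)

lemma comb_zero [simp]: "comb b g 0 = 0"
  by (simp add: comb_def)

lemma comb_0: "comb 0 g a = 0"
  by (simp add: fun_eq_iff comb_apply)

lemma comb_Suc: "comb (Suc b) g a = comb b g a + smul (a (Inr b)) (g b)"
  by (simp add: fun_eq_iff comb_apply smul_def)

lemma comb_cong:
  "(\<And>j. j < b \<Longrightarrow> g j = g' j) \<Longrightarrow> (\<And>j. j < b \<Longrightarrow> a (Inr j) = a' (Inr j)) \<Longrightarrow> comb b g a = comb b g' a'"
  by (simp add: comb_def)

lemma comb_append:
  "comb (b + c) (\<lambda>j. if j < b then g j else h (j - b)) a
    = comb b g a + comb c h (\<lambda>x. case x of Inl _ \<Rightarrow> 0 | Inr j \<Rightarrow> a (Inr (b + j)))"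
proof -
  have "{..<b + c} = {..<b} \<union> (+) b ` {..<c}"
  proof (intro equalityI subsetI)
    fix x assume "x \<in> {..<b + c}"
    then have "x < b \<or> x = b + (x - b) \<and> x - b < c" by auto
    then show "x \<in> {..<b} \<union> (+) b ` {..<c}" by blast
  qed auto
  moreover have "{..<b} \<inter> (+) b ` {..<c} = {}" by auto
  ultimately show ?thesis
    by (simp add: comb_def sum.union_disjoint sum.reindex)
qed

text \<open>Rings whose record operations are those of the type class, restricted to a closed
  carrier: finite sums and ring arithmetic of the type become available. \<open>basis_type\<close>
  fixes the type variable \<open>'m\<close>.\<close>

locale class_ring =
  fixes R :: "'r::comm_ring_1 ring" and basis_type :: "'m itself"
  assumes ring_ops [simp]: "mult R = (*)" "one R = 1" "zero R = 0" "add R = (+)"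
    and ring_closed [simp]: "0 \<in> carrier R" "1 \<in> carrier R"
      "p \<in> carrier R \<Longrightarrow> q \<in> carrier R \<Longrightarrow> p + q \<in> carrier R"
      "p \<in> carrier R \<Longrightarrow> q \<in> carrier R \<Longrightarrow> p * q \<in> carrier R"
      "p \<in> carrier R \<Longrightarrow> - p \<in> carrier R"
begin

lemma class_ring_cring: "cring R"
proof (intro cringI abelian_groupI comm_monoidI)
  fix p assume "p \<in> carrier R"
  then show "\<exists>q\<in>carrier R. q \<oplus>\<^bsub>R\<^esub> p = \<zero>\<^bsub>R\<^esub>"
    by (intro bexI[of _ "- p"]) auto
qed (auto simp: algebra_simps)

definition free :: "nat \<Rightarrow> ('m + nat \<Rightarrow> 'r) set" where
  "free b = carrier (free_module R (Inr ` {..<b}))"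

lemma in_free: "f \<in> free b \<longleftrightarrow> (\<forall>x. f x \<in> carrier R) \<and> (\<forall>x. x \<notin> Inr ` {..<b} \<longrightarrow> f x = 0)"
proof -
  have "finite {x. f x \<noteq> 0}" if "\<forall>x. x \<notin> Inr ` {..<b} \<longrightarrow> f x = 0"
    by (rule finite_subset[of _ "Inr ` {..<b}"]) (use that in auto)
  then show ?thesis by (auto simp: free_def in_free_module)
qed

definition submod :: "('x \<Rightarrow> 'r) set \<Rightarrow> bool" where
  "submod Z \<longleftrightarrow> 0 \<in> Z \<and> (\<forall>f\<in>Z. \<forall>g\<in>Z. f + g \<in> Z) \<and> (\<forall>r\<in>carrier R. \<forall>f\<in>Z. smul r f \<in> Z)"

definition linear_on :: "('x \<Rightarrow> 'r) set \<Rightarrow> (('x \<Rightarrow> 'r) \<Rightarrow> ('y \<Rightarrow> 'r)) \<Rightarrow> bool" where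
  "linear_on Z \<alpha> \<longleftrightarrow> (\<forall>f\<in>Z. \<forall>g\<in>Z. \<alpha> (f + g) = \<alpha> f + \<alpha> g) \<and> (\<forall>r\<in>carrier R. \<forall>f\<in>Z. \<alpha> (smul r f) = smul r (\<alpha> f))"

lemma submodD:
  assumes "submod Z"
  shows "0 \<in> Z" "f \<in> Z \<Longrightarrow> g \<in> Z \<Longrightarrow> f + g \<in> Z" "r \<in> carrier R \<Longrightarrow> f \<in> Z \<Longrightarrow> smul r f \<in> Z"
    "f \<in> Z \<Longrightarrow> - f \<in> Z" "f \<in> Z \<Longrightarrow> g \<in> Z \<Longrightarrow> f - g \<in> Z"
proof -
  show *: "0 \<in> Z" "f \<in> Z \<Longrightarrow> g \<in> Z \<Longrightarrow> f + g \<in> Z" "r \<in> carrier R \<Longrightarrow> f \<in> Z \<Longrightarrow> smul r f \<in> Z" for f g r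
    using assms by (auto simp: submod_def)
  show m: "- f \<in> Z" if "f \<in> Z" for f using *(3)[of "- 1" f] that by (simp add: smul_algebra)
  show "f - g \<in> Z" if "f \<in> Z" "g \<in> Z" using *(2)[OF that(1) m[OF that(2)]] by simp
qed

lemma linear_onD:
  assumes "linear_on Z \<alpha>"
  shows "f \<in> Z \<Longrightarrow> g \<in> Z \<Longrightarrow> \<alpha> (f + g) = \<alpha> f + \<alpha> g"
    "r \<in> carrier R \<Longrightarrow> f \<in> Z \<Longrightarrow> \<alpha> (smul r f) = smul r (\<alpha> f)"
  using assms by (auto simp: linear_on_def)

lemma linear_on_zero: "linear_on Z \<alpha> \<Longrightarrow> submod Z \<Longrightarrow> \<alpha> 0 = 0"
  using linear_onD(2)[of Z \<alpha> 0 0] submodD(1)[of Z] by simp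

lemma linear_on_minus: "linear_on Z \<alpha> \<Longrightarrow> f \<in> Z \<Longrightarrow> \<alpha> (- f) = - \<alpha> f"
  using linear_onD(2)[of Z \<alpha> "- 1" f] by (simp add: smul_algebra)

lemma submod_free: "submod (free b)"
  by (auto simp: submod_def in_free smul_def)

lemma comb_in_submod:
  assumes "submod Z" "\<And>j. j < b \<Longrightarrow> g j \<in> Z" "\<And>j. j < b \<Longrightarrow> a (Inr j) \<in> carrier R"
  shows "comb b g a \<in> Z"
  using assms(2,3)
  by (induction b) (auto simp: submodD[OF assms(1)] comb_0 comb_Suc)

lemma linear_on_comb:
  assumes "submod Z" "linear_on Z \<alpha>" "\<And>j. j < b \<Longrightarrow> g j \<in> Z" "\<And>j. j < b \<Longrightarrow> a (Inr j) \<in> carrier R"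
  shows "\<alpha> (comb b g a) = comb b (\<lambda>j. \<alpha> (g j)) a"
  using assms(3,4)
proof (induction b)
  case 0
  show ?case unfolding comb_0 by (rule linear_on_zero[OF assms(2,1)])
next
  case (Suc b)
  have "comb b g a \<in> Z" using Suc.prems by (intro comb_in_submod[OF assms(1)]) auto
  moreover have g: "g b \<in> Z" and a: "a (Inr b) \<in> carrier R" using Suc.prems by auto
  ultimately have "\<alpha> (comb b g a + smul (a (Inr b)) (g b)) = \<alpha> (comb b g a) + smul (a (Inr b)) (\<alpha> (g b))"
    using linear_onD(1)[OF assms(2) _ submodD(3)[OF assms(1) a g]] linear_onD(2)[OF assms(2) a g] by metis
  moreover have "\<alpha> (comb b g a) = comb b (\<lambda>j. \<alpha> (g j)) a" using Suc by auto
  ultimately show ?case unfolding comb_Suc by metis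
qed

lemma free_comb:
  assumes "j < b"
  obtains a where "a \<in> free b" "comb b g a = g j"
proof
  let ?a = "\<lambda>x. if x = Inr j then 1 else 0"
  show "?a \<in> free b" using assms by (auto simp: in_free)
  show "comb b g ?a = g j"
    using assms by (intro ext) (simp add: comb_apply if_distrib[of "\<lambda>x. x * _"] cong: if_cong)
qed

definition syz :: "nat \<Rightarrow> (nat \<Rightarrow> 'x \<Rightarrow> 'r) \<Rightarrow> ('m + nat \<Rightarrow> 'r) set" where
  "syz b g = {a \<in> free b. comb b g a = 0}"

lemma submod_syz: "submod (syz b g)"
  using submod_free by (auto simp: submod_def syz_def comb_add comb_smul)

text \<open>\<open>res_length n Z\<close> says that \<open>Z\<close> has a resolution by \<open>n\<close> finitely generated free modules;
  the projective dimension of \<open>Z\<close> is then less than \<open>n\<close>.\<close>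

primrec res_length :: "nat \<Rightarrow> ('m + nat \<Rightarrow> 'r) set \<Rightarrow> bool" where
  "res_length 0 Z \<longleftrightarrow> Z = {0}"
| "res_length (Suc n) Z \<longleftrightarrow> (\<exists>b g. Z = comb b g ` (free b :: ('m + nat \<Rightarrow> 'r) set) \<and> res_length n (syz b g))"

lemma res_length_submod: "res_length n Z \<Longrightarrow> submod Z"
proof (cases n)
  case 0
  then show "res_length n Z \<Longrightarrow> submod Z" by (auto simp: submod_def)
next
  case (Suc n')
  assume "res_length n Z"
  then obtain b g where Z: "Z = comb b g ` (free b :: ('m + nat \<Rightarrow> 'r) set)" using Suc by auto
  note F = submodD[OF submod_free[of b]]
  show "submod Z"
    unfolding submod_def Z
  proof (intro conjI ballI; (elim imageE)?)
    show "0 \<in> comb b g ` free b" using F(1) by (intro image_eqI[of _ _ 0]) auto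
    fix f h a a' assume "f = comb b g a" "h = comb b g a'" "a \<in> free b" "a' \<in> (free b :: ('m + nat \<Rightarrow> 'r) set)"
    then show "f + h \<in> comb b g ` free b"
      using F(2) by (intro image_eqI[of _ _ "a + a'"]) (auto simp: comb_add)
  next
    fix r f and a :: "'m + nat \<Rightarrow> 'r" assume "r \<in> carrier R" "f = comb b g a" "a \<in> free b"
    then show "smul r f \<in> comb b g ` free b"
      using F(3) by (intro image_eqI[of _ _ "smul r a"]) (auto simp: comb_smul)
  qed
qed

lemma free_0: "free 0 = {0}"
  by (auto simp: in_free fun_eq_iff)

text \<open>A resolution is lengthened by a free module of rank 0 at its far end.\<close>

lemma res_length_Suc: "res_length n Z \<Longrightarrow> res_length (Suc n) Z"
proof (induction n arbitrary: Z)
  case 0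
  let ?g = "\<lambda>_. 0 :: 'm + nat \<Rightarrow> 'r"
  have "comb 0 ?g ` free 0 = {0}" unfolding free_0 by (simp only: image_insert image_empty comb_0)
  moreover have "syz 0 ?g = {0}" unfolding syz_def free_0 by (simp only: comb_0) blast
  ultimately show ?case using 0 unfolding res_length.simps by metis
next
  case (Suc n)
  then obtain b g where "Z = comb b g ` (free b :: ('m + nat \<Rightarrow> 'r) set)" "res_length n (syz b g)" by auto
  with Suc.IH show ?case by (auto simp del: res_length.simps(2) simp: res_length.simps(2)[of "Suc n"])
qed

lemma res_length_mono: "n \<le> n' \<Longrightarrow> res_length n Z \<Longrightarrow> res_length n' Z"
  by (induction n' rule: dec_induct) (simp_all del: res_length.simps add: res_length_Suc)

text \<open>With \<open>tail\<close>, the identification of the free module of rank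
  \<open>b + c\<close> with the direct sum of those of ranks \<open>b\<close> and \<open>c\<close>.
  In particular \<open>glue b 0 a 0\<close> truncates \<open>a\<close> to its first \<open>b\<close>
  coordinates.\<close>

definition glue :: "nat \<Rightarrow> nat \<Rightarrow> ('m + nat \<Rightarrow> 'r) \<Rightarrow> ('m + nat \<Rightarrow> 'r) \<Rightarrow> 'm + nat \<Rightarrow> 'r" where
  "glue b c a a' = (\<lambda>x. case x of Inl _ \<Rightarrow> 0 | Inr j \<Rightarrow>
     if j < b then a (Inr j) else if j < b + c then a' (Inr (j - b)) else 0)"

definition tail :: "nat \<Rightarrow> ('m + nat \<Rightarrow> 'r) \<Rightarrow> 'm + nat \<Rightarrow> 'r" where
  "tail b a = (\<lambda>x. case x of Inl _ \<Rightarrow> 0 | Inr j \<Rightarrow> a (Inr (b + j)))"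

lemma glue_free: "a \<in> free b \<Longrightarrow> a' \<in> free c \<Longrightarrow> glue b c a a' \<in> free (b + c)"
  unfolding in_free glue_def by (auto split: sum.split)

lemma tail_free:
  assumes "a \<in> free (b + c)" shows "tail b a \<in> free c"
proof -
  have "a (Inr (b + j)) = 0" if "\<not> j < c" for j
  proof -
    have "Inr (b + j) \<notin> (Inr ` {..<b + c} :: ('m + nat) set)" using that by auto
    then show ?thesis using assms unfolding in_free by blast
  qed
  then show ?thesis using assms unfolding in_free tail_def by (auto split: sum.split)
qed

lemma tail_glue: "a' \<in> free c \<Longrightarrow> tail b (glue b c a a') = a'"
  unfolding in_free glue_def tail_def by (rule ext) (auto split: sum.split)

lemma tail_linear: "linear_on Z (tail b)"
  by (auto simp: linear_on_def tail_def smul_def fun_eq_iff split: sum.split)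

abbreviation append_gens :: "nat \<Rightarrow> (nat \<Rightarrow> 'z) \<Rightarrow> (nat \<Rightarrow> 'z) \<Rightarrow> nat \<Rightarrow> 'z" where
  "append_gens b g h \<equiv> \<lambda>j. if j < b then g j else h (j - b)"

lemma comb_append_tail: "comb (b + c) (append_gens b g h) a = comb b g a + comb c h (tail b a)"
  by (simp add: comb_append tail_def)

lemma comb_glue: "a' \<in> free c \<Longrightarrow> comb (b + c) (append_gens b g h) (glue b c a a') = comb b g a + comb c h a'"
  unfolding comb_append_tail tail_glue by (simp add: glue_def cong: comb_cong)

lemma tail_zero_free: "a \<in> free (b + c) \<Longrightarrow> tail b a = 0 \<Longrightarrow> a \<in> free b"
proof -
  assume a: "a \<in> free (b + c)" and t: "tail b a = 0"
  have "a x = 0" if "x \<notin> Inr ` {..<b}" for x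
  proof (cases x)
    case (Inl y)
    then show ?thesis using a by (auto simp: in_free)
  next
    case (Inr j)
    then have "b \<le> j" using that by auto
    then show ?thesis using fun_cong[OF t, of "Inr (j - b)"] Inr by (simp add: tail_def)
  qed
  then show ?thesis using a by (simp add: in_free)
qed

lemma free_mono: "b \<le> c \<Longrightarrow> free b \<subseteq> free c"
proof
  fix a :: "'m + nat \<Rightarrow> 'r"
  assume "b \<le> c" and a: "a \<in> free b"
  then have "x \<notin> Inr ` {..<b}" if "x \<notin> Inr ` {..<c}" for x :: "'m + nat" using that by auto
  then show "a \<in> free c" using a unfolding in_free by simp
qed

lemma tail_free_zero: "a \<in> free b \<Longrightarrow> tail b a = 0"
  unfolding in_free tail_def by (rule ext) (auto split: sum.split)

text \<open>For an exact sequence \<open>0 -> A -> B -> C -> 0\<close>, the images of generators of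
  \<open>A\<close> and lifts of generators of \<open>C\<close> generate \<open>B\<close>, and the
  three syzygy modules again form such a sequence, to which the induction hypothesis
  applies.\<close>

lemma horseshoe:
  assumes "res_length n A" "res_length n C" and B: "submod B"
    and \<alpha>: "linear_on A \<alpha>" "\<alpha> ` A \<subseteq> B" "\<And>f. f \<in> A \<Longrightarrow> \<alpha> f = 0 \<Longrightarrow> f = 0"
    and \<beta>: "linear_on B \<beta>" "\<beta> ` B = C"
    and ker: "\<And>f. f \<in> B \<Longrightarrow> \<beta> f = 0 \<longleftrightarrow> f \<in> \<alpha> ` A"
  shows "res_length n B"
  using assms
proof (induction n arbitrary: A B C \<alpha> \<beta>)
  case 0
  have A: "A = {0}" and C: "C = {0}" using 0(1,2) by simp_all
  have "\<alpha> 0 = 0" using linear_on_zero[OF 0(4)] res_length_submod[OF 0(1)] .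
  have "f = 0" if f: "f \<in> B" for f
  proof -
    have "\<beta> f = 0" using 0(8) f C by blast
    then obtain a where "a \<in> A" "f = \<alpha> a" using 0(9)[OF f] by blast
    then have "f = \<alpha> 0" using A by (metis singletonD)
    then show ?thesis using \<open>\<alpha> 0 = 0\<close> by (rule trans)
  qed
  then show ?case using submodD(1)[OF 0(3)] by auto
next
  case (Suc n A B C \<alpha> \<beta>)
  note sA = res_length_submod[OF Suc.prems(1)] and B = Suc.prems(3) and \<alpha> = Suc.prems(4-6)
    and \<beta> = Suc.prems(7,8) and ker = Suc.prems(9)
  note sB = submodD[OF B]
  obtain b g where A: "A = comb b g ` free b" and rA: "res_length n (syz b g)"
    using Suc.prems(1) by auto
  obtain c h where C: "C = comb c h ` free c" and rC: "res_length n (syz c h)"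
    using Suc.prems(2) by auto
  have g: "g j \<in> A" if "j < b" for j by (rule free_comb[OF that, of g]) (metis A imageI)
  have "h j \<in> \<beta> ` B" if "j < c" for j by (rule free_comb[OF that, of h]) (metis C \<beta>(2) imageI)
  then have "\<forall>j. \<exists>l. j < c \<longrightarrow> l \<in> B \<and> \<beta> l = h j" by (metis imageE)
  then obtain l where l: "\<And>j. j < c \<Longrightarrow> l j \<in> B" "\<And>j. j < c \<Longrightarrow> \<beta> (l j) = h j" by metis
  have ag: "comb b (\<lambda>j. \<alpha> (g j)) a = \<alpha> (comb b g a)" if "a \<in> free b" for a
    by (rule linear_on_comb[OF sA \<alpha>(1), symmetric]) (use that g in \<open>auto simp: in_free\<close>)
  have lB: "comb c l a \<in> B" if "a \<in> free c" for a
    using that by (intro comb_in_submod B l) (auto simp: in_free)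
  have bl: "\<beta> (comb c l a) = comb c h a" if "a \<in> free c" for a
  proof -
    have "\<beta> (comb c l a) = comb c (\<lambda>j. \<beta> (l j)) a"
      by (rule linear_on_comb[OF B \<beta>(1) l(1)]) (use that in \<open>auto simp: in_free\<close>)
    then show ?thesis using l(2) by (simp cong: comb_cong)
  qed
  let ?G = "append_gens b (\<lambda>j. \<alpha> (g j)) l"
  note append = comb_append_tail[of b c "\<lambda>j. \<alpha> (g j)" l]
    and glue = comb_glue[of _ c b "\<lambda>j. \<alpha> (g j)" l]
  have split: "comb (b + c) ?G a = \<alpha> (comb b g (glue b 0 a 0)) + comb c l (tail b a)"
    if "a \<in> free (b + c)" for a
  proof -
    have "glue b 0 a 0 \<in> free b"
      using that submodD(1)[OF submod_free] unfolding in_free glue_def by (auto split: sum.split)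
    from ag[OF this] show ?thesis
      unfolding append by (simp add: glue_def cong: comb_cong)
  qed
  have gf: "glue b 0 a 0 \<in> free b" if "a \<in> free (b + c)" for a
    using that unfolding in_free glue_def by (auto split: sum.split)
  have "B = comb (b + c) ?G ` free (b + c)"
  proof
    show "comb (b + c) ?G ` free (b + c) \<subseteq> B"
    proof
      fix f assume "f \<in> comb (b + c) ?G ` free (b + c)"
      then obtain a where a: "a \<in> free (b + c)" "f = comb (b + c) ?G a" by auto
      then show "f \<in> B"
        unfolding a(2) split[OF a(1)] using \<alpha>(2) A gf[OF a(1)] by (intro sB(2) lB tail_free[OF a(1)]) auto
    qed
    show "B \<subseteq> comb (b + c) ?G ` free (b + c)"
    proof
      fix f assume f: "f \<in> B"
      then have "\<beta> f \<in> comb c h ` free c" using \<beta>(2) C by blast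
      then obtain a' where a': "a' \<in> free c" "\<beta> f = comb c h a'" by blast
      have "\<beta> (f - comb c l a') = \<beta> f - \<beta> (comb c l a')"
        using linear_onD(1)[OF \<beta>(1) f sB(4)[OF lB[OF a'(1)]]] linear_on_minus[OF \<beta>(1) lB[OF a'(1)]]
        by (simp only: diff_conv_add_uminus)
      then have "\<beta> (f - comb c l a') = 0" by (simp only: a'(2) bl[OF a'(1)] diff_self)
      then have "f - comb c l a' \<in> \<alpha> ` A" using ker sB(5)[OF f lB[OF a'(1)]] by blast
      then obtain a where a: "a \<in> free b" "f - comb c l a' = \<alpha> (comb b g a)"
        unfolding A by blast
      have "f = comb (b + c) ?G (glue b c a a')"
        unfolding glue[OF a'(1)] ag[OF a(1)] a(2)[symmetric] by simp
      then show "f \<in> comb (b + c) ?G ` free (b + c)" using glue_free[OF a(1) a'(1)] by blast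
    qed
  qed
  moreover have "res_length n (syz (b + c) ?G)"
  proof (rule Suc.IH[OF rA rC submod_syz])
    have A0: "comb b g a = 0" if "a \<in> free b" "comb (b + c) ?G a = 0" for a
    proof -
      have "\<alpha> (comb b g a) = 0" using that ag[OF that(1)] by (simp add: append tail_free_zero)
      then show ?thesis using \<alpha>(3) A that(1) by blast
    qed
    show "linear_on (syz b g) id" by (simp add: linear_on_def)
    have "\<alpha> 0 = 0" by (rule linear_on_zero[OF \<alpha>(1) sA])
    then show "id ` syz b g \<subseteq> syz (b + c) ?G"
      using ag free_mono[of b "b + c"] by (auto simp: syz_def append tail_free_zero)
    show "linear_on (syz (b + c) ?G) (tail b)" by (rule tail_linear)
    show "tail b a = 0 \<longleftrightarrow> a \<in> id ` syz b g" if a: "a \<in> syz (b + c) ?G" for a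
      using a A0 tail_zero_free[of a b c] tail_free_zero by (auto simp: syz_def)
    show "tail b ` syz (b + c) ?G = syz c h"
    proof
      show "tail b ` syz (b + c) ?G \<subseteq> syz c h"
      proof
        fix a' assume "a' \<in> tail b ` syz (b + c) ?G"
        then obtain a where a: "a \<in> free (b + c)" "comb (b + c) ?G a = 0" "a' = tail b a"
          by (auto simp: syz_def)
        let ?y = "comb b g (glue b 0 a 0)"
        have y: "\<alpha> ?y \<in> \<alpha> ` A" using A gf[OF a(1)] by blast
        then have y0: "\<beta> (\<alpha> ?y) = 0" "\<alpha> ?y \<in> B" using ker \<alpha>(2) by blast+
        have "\<alpha> ?y + comb c l a' = 0" using split[OF a(1)] a by simp
        then have "\<beta> (\<alpha> ?y + comb c l a') = 0" by (simp only: linear_on_zero[OF \<beta>(1) B])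
        moreover have a': "a' \<in> free c" using tail_free[OF a(1)] a(3) by simp
        ultimately have "comb c h a' = 0"
          by (simp only: linear_onD(1)[OF \<beta>(1) y0(2) lB[OF a']] y0(1) bl[OF a'] add_0)
        then show "a' \<in> syz c h" using tail_free[OF a(1)] a(3) by (simp add: syz_def)
      qed
      \<comment> \<open>A relation in \<open>C\<close>, applied to the lifts, gives an element of
        the image of \<open>A\<close>; the negatives of its coordinates in the generators of
        \<open>A\<close> complete the relation to one in \<open>B\<close>.\<close>
      show "syz c h \<subseteq> tail b ` syz (b + c) ?G"
      proof
        fix a' assume "a' \<in> syz c h"
        then have a': "a' \<in> free c" "comb c h a' = 0" by (auto simp: syz_def)
        then have "\<beta> (comb c l a') = 0" using bl by simp
        then have "comb c l a' \<in> \<alpha> ` A" using ker lB[OF a'(1)] by blast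
        then obtain a where a: "a \<in> free b" "comb c l a' = \<alpha> (comb b g a)"
          unfolding A by blast
        have ma: "- a \<in> free b" using submodD(4)[OF submod_free a(1)] .
        have "\<alpha> (comb b g (- a)) = - \<alpha> (comb b g a)"
          unfolding comb_minus by (rule linear_on_minus[OF \<alpha>(1)]) (use A a(1) in blast)
        then have "comb (b + c) ?G (glue b c (- a) a') = 0"
          unfolding glue[OF a'(1)] ag[OF ma] using a(2) by simp
        then have "glue b c (- a) a' \<in> syz (b + c) ?G"
          using glue_free[OF ma a'(1)] by (simp add: syz_def)
        then have "tail b (glue b c (- a) a') \<in> tail b ` syz (b + c) ?G" by (rule imageI)
        then show "a' \<in> tail b ` syz (b + c) ?G" by (simp only: tail_glue[OF a'(1)])
      qed
    qed
  qed simp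
  ultimately show ?case by auto
qed

lemma emb_simps:
  "emb (p + q) = emb p + (emb q :: 'm + nat \<Rightarrow> 'r)" "emb (r * p) = smul r (emb p :: 'm + nat \<Rightarrow> 'r)"
  "emb (- p) = - (emb p :: 'm + nat \<Rightarrow> 'r)" "emb p = (emb q :: 'm + nat \<Rightarrow> 'r) \<longleftrightarrow> p = q"
  "(emb 0 :: 'm + nat \<Rightarrow> 'r) = 0" "(emb p :: 'm + nat \<Rightarrow> 'r) = 0 \<longleftrightarrow> p = 0"
  by (auto simp: emb_def smul_def fun_eq_iff)

text \<open>The mapping cone of multiplication by \<open>m\<close> from \<open>R/(I : m)\<close> to \<open>R/I\<close>.\<close>

lemma res_length_cone:
  assumes I: "res_length (Suc n) (emb ` I :: ('m + nat \<Rightarrow> 'r) set)"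
    and col: "res_length n (emb ` {r \<in> carrier R. r * m \<in> I} :: ('m + nat \<Rightarrow> 'r) set)"
  shows "res_length (Suc n) (emb ` {p + r * m | p r. p \<in> I \<and> r \<in> carrier R} :: ('m + nat \<Rightarrow> 'r) set)"
proof -
  let ?emb = "emb :: 'r \<Rightarrow> 'm + nat \<Rightarrow> 'r"
  let ?free = "free :: nat \<Rightarrow> ('m + nat \<Rightarrow> 'r) set"
  obtain b g where g: "?emb ` I = comb b g ` ?free b" and syz: "res_length n (syz b g)"
    using I unfolding res_length.simps by blast
  let ?h = "\<lambda>_::nat. ?emb m :: 'm + nat \<Rightarrow> 'r"
  let ?G = "append_gens b g ?h"
  note append = comb_append_tail[of b 1 g ?h] and glue = comb_glue[where b = b and c = 1 and g = g and h = ?h]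
  note append' = append[folded Suc_eq_plus1]
  let ?f = "\<lambda>r x. if x = Inr 0 then r else 0 :: 'r"
  have f1: "?f r \<in> ?free 1" if "r \<in> carrier R" for r using that by (auto simp: in_free)
  have ch: "comb 1 ?h a = smul (a (Inr 0)) (?emb m)" for a :: "'m + nat \<Rightarrow> 'r"
    by (simp add: comb_def)
  have chf: "comb 1 ?h (?f r :: 'm + nat \<Rightarrow> 'r) = ?emb (r * m)" for r
    unfolding ch by (simp add: emb_simps)
  have "?emb ` {p + r * m | p r. p \<in> I \<and> r \<in> carrier R} = comb (b + 1) ?G ` ?free (b + 1)"
  proof
    show "?emb ` {p + r * m | p r. p \<in> I \<and> r \<in> carrier R} \<subseteq> comb (b + 1) ?G ` ?free (b + 1)"
    proof
      fix f :: "'m + nat \<Rightarrow> 'r" assume "f \<in> ?emb ` {p + r * m | p r. p \<in> I \<and> r \<in> carrier R}"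
      then obtain p r where pr: "f = ?emb p + ?emb (r * m)" "p \<in> I" "r \<in> carrier R" by (auto simp: emb_simps)
      then obtain a where a: "a \<in> ?free b" "?emb p = comb b g a" using g by (metis imageE imageI)
      have "f = comb (b + 1) ?G (glue b 1 a (?f r))"
        unfolding glue[OF f1[OF pr(3)]] chf using pr a by simp
      then show "f \<in> comb (b + 1) ?G ` ?free (b + 1)" using glue_free[OF a(1) f1[OF pr(3)]] by blast
    qed
    show "comb (b + 1) ?G ` ?free (b + 1) \<subseteq> ?emb ` {p + r * m | p r. p \<in> I \<and> r \<in> carrier R}"
    proof
      fix f assume "f \<in> comb (b + 1) ?G ` ?free (b + 1)"
      then obtain a where a: "a \<in> ?free (b + 1)" "f = comb (b + 1) ?G a" by auto
      have gf: "glue b 0 a 0 \<in> ?free b" using a(1) unfolding in_free glue_def by (auto split: sum.split)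
      have "comb b g a = comb b g (glue b 0 a 0)" by (simp add: glue_def cong: comb_cong)
      then have "comb b g a \<in> ?emb ` I" using g gf by blast
      then obtain p where p: "p \<in> I" "comb b g a = ?emb p" by blast
      have "f = ?emb (p + a (Inr b) * m)"
        unfolding a(2) append ch p(2) by (simp add: tail_def emb_simps)
      moreover have "a (Inr b) \<in> carrier R" using a(1) by (auto simp: in_free)
      ultimately show "f \<in> ?emb ` {p + r * m | p r. p \<in> I \<and> r \<in> carrier R}" using p(1) by blast
    qed
  qed
  \<comment> \<open>The coefficient of \<open>m\<close> in a syzygy of the enlarged generating
    system ranges over the colon ideal, and the syzygies in which it vanishes are the old ones:
    again a short exact sequence.\<close>
  moreover have "res_length n (syz (b + 1) ?G)"
  proof (rule horseshoe[OF syz col submod_syz])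
    show "linear_on (syz b g) id" by (simp add: linear_on_def)
    show "id ` syz b g \<subseteq> syz (b + 1) ?G"
      using free_mono[of b "b + 1"] by (auto simp: syz_def append' tail_free_zero)
    show "linear_on (syz (b + 1) ?G) (tail b)" by (rule tail_linear)
    show "tail b a = 0 \<longleftrightarrow> a \<in> id ` syz b g" if a: "a \<in> syz (b + 1) ?G" for a
      using a tail_zero_free[of a b 1] tail_free_zero[of a b] by (auto simp: syz_def append')
    show "tail b ` syz (b + 1) ?G = ?emb ` {r \<in> carrier R. r * m \<in> I}"
    proof
      show "tail b ` syz (b + 1) ?G \<subseteq> ?emb ` {r \<in> carrier R. r * m \<in> I}"
      proof
        fix a' assume "a' \<in> tail b ` syz (b + 1) ?G"
        then obtain a where a: "a \<in> free (b + 1)" "comb (b + 1) ?G a = 0" "a' = tail b a"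
          by (auto simp: syz_def)
        let ?r = "a (Inr b)"
        have gf: "glue b 0 (- a) 0 \<in> ?free b"
          using submodD(4)[OF submod_free a(1)] unfolding in_free glue_def by (auto split: sum.split)
        have "comb b g (glue b 0 (- a) 0) = comb b g (- a)" by (simp add: glue_def cong: comb_cong)
        then have "- comb b g a \<in> ?emb ` I" using g gf by (metis comb_minus imageI)
        moreover have "- comb b g a = ?emb (?r * m)"
          using a(2) unfolding append ch by (simp add: tail_def emb_simps add_eq_0_iff)
        ultimately have "?emb (?r * m) \<in> ?emb ` I" by metis
        then have "?r * m \<in> I" by (metis emb_simps(4) imageE)
        have "?r \<in> carrier R" using a(1) by (auto simp: in_free)
        have "a' x = ?emb ?r x" for x
        proof (cases "x = Inr 0")
          case False
          then have "x \<notin> Inr ` {..<1}" by auto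
          then have "a' x = 0" using tail_free[OF a(1)] a(3) unfolding in_free by blast
          then show ?thesis using False by (simp add: emb_def)
        qed (simp add: a(3) tail_def emb_def)
        then have "a' = ?emb ?r" by blast
        then show "a' \<in> ?emb ` {r \<in> carrier R. r * m \<in> I}"
          using \<open>?r * m \<in> I\<close> \<open>?r \<in> carrier R\<close> by blast
      qed
      show "?emb ` {r \<in> carrier R. r * m \<in> I} \<subseteq> tail b ` syz (b + 1) ?G"
      proof
        fix a' :: "'m + nat \<Rightarrow> 'r" assume "a' \<in> ?emb ` {r \<in> carrier R. r * m \<in> I}"
        then obtain r where r: "r \<in> carrier R" "r * m \<in> I" "a' = ?emb r" by blast
        then obtain a where a: "a \<in> ?free b" "?emb (r * m) = comb b g a" using g by (metis imageE imageI)
        have ma: "- a \<in> free b" using submodD(4)[OF submod_free a(1)] .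
        have a': "a' = ?f r" "a' \<in> free 1" using r f1 by (auto simp: emb_def)
        have "comb (b + 1) ?G (glue b 1 (- a) a') = 0"
          unfolding glue[OF a'(2)] unfolding a'(1) chf using a(2) by (simp add: comb_minus)
        then have "glue b 1 (- a) a' \<in> syz (b + 1) ?G"
          using glue_free[OF ma a'(2)] by (simp add: syz_def)
        then have "tail b (glue b 1 (- a) a') \<in> tail b ` syz (b + 1) ?G" by (rule imageI)
        then show "a' \<in> tail b ` syz (b + 1) ?G" by (simp only: tail_glue[OF a'(2)])
      qed
    qed
  qed simp_all
  ultimately show ?thesis by auto
qed

end

section \<open>From finite free resolutions to the projective dimension\<close>

context class_ring
begin

lemma res_length_sequence:
  assumes "res_length n Z"
  shows "\<exists>b G. Z = comb (b 0) (G 0) ` free (b 0) \<and>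
    (\<forall>i. syz (b i) (G i) = comb (b (Suc i)) (G (Suc i)) ` free (b (Suc i))) \<and> (\<forall>i\<ge>n. b i = 0)"
  using assms
proof (induction n arbitrary: Z)
  case 0
  let ?g = "\<lambda>_. 0 :: 'm + nat \<Rightarrow> 'r"
  have "comb 0 ?g ` free 0 = {0}" unfolding free_0 by (simp only: image_insert image_empty comb_0)
  moreover have "syz 0 ?g = {0}" unfolding syz_def free_0 by (simp only: comb_0) blast
  ultimately show ?case
    using 0 by (intro exI[of _ "\<lambda>_. 0"] exI[of _ "\<lambda>_. ?g"]) (simp only: res_length.simps simp_thms)
next
  case (Suc n)
  then obtain b0 g0 where Z: "Z = comb b0 g0 ` free b0" "res_length n (syz b0 g0)"
    unfolding res_length.simps by blast
  from Suc.IH[OF Z(2)] obtain b G where bG: "syz b0 g0 = comb (b 0) (G 0) ` free (b 0)"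
    "\<And>i. syz (b i) (G i) = comb (b (Suc i)) (G (Suc i)) ` free (b (Suc i))" "\<And>i. i \<ge> n \<Longrightarrow> b i = 0"
    by blast
  let ?b = "case_nat b0 b" and ?G = "case_nat g0 G"
  have "syz (?b i) (?G i) = comb (?b (Suc i)) (?G (Suc i)) ` free (?b (Suc i))" for i
    using bG(1,2) by (cases i) simp_all
  moreover have "?b i = 0" if "i \<ge> Suc n" for i using bG(3) that by (cases i) auto
  ultimately show ?case using Z(1) by (intro exI[of _ ?b] exI[of _ ?G]) simp
qed

text \<open>\<open>projective_module\<close> takes the basis of the ambient free module from the
  element type of the module, here functions on \<open>'y\<close>. The basis \<open>Y\<close> is
  therefore replaced by its unit vectors \<open>\<delta> y\<close>.\<close>

lemma projective_free_module: "projective_module R (free_module R (Y :: 'y set))"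
proof -
  let ?M = "free_module R Y"
  define \<delta> :: "'y \<Rightarrow> 'y \<Rightarrow> 'r" where "\<delta> y = (\<lambda>x. if x = y then 1 else 0)" for y
  have inj: "inj \<delta>" by (rule injI) (metis \<delta>_def zero_neq_one)
  let ?i = "\<lambda>f u. if u \<in> range \<delta> then f (the_inv \<delta> u) else 0 :: 'r" and ?p = "\<lambda>F y. F (\<delta> y)"
  have "?i f \<in> carrier (free_module R (\<delta> ` Y))" if f: "f \<in> carrier ?M" for f
  proof -
    have "{u. ?i f u \<noteq> 0} \<subseteq> \<delta> ` {y. f y \<noteq> 0}" using inj by (auto simp: the_inv_f_f)
    then have "finite {u. ?i f u \<noteq> 0}" by (rule finite_subset) (use f in \<open>auto simp: in_free_module\<close>)
    then show ?thesis using f inj by (auto simp: in_free_module the_inv_f_f)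
  qed
  then have i: "?i \<in> mod_hom R ?M (free_module R (\<delta> ` Y))" by (auto simp: mod_hom_def)
  have "?p F \<in> carrier ?M" if F: "F \<in> carrier (free_module R (\<delta> ` Y))" for F
  proof -
    have "finite (\<delta> -` {u. F u \<noteq> 0})"
      by (rule finite_vimageI[OF _ inj]) (use F in \<open>simp add: in_free_module\<close>)
    then have "finite {y. ?p F y \<noteq> 0}" by (simp add: vimage_def)
    moreover have "\<delta> y \<notin> \<delta> ` Y" if "y \<notin> Y" for y using inj that by (auto dest: injD)
    ultimately show ?thesis using F by (auto simp: in_free_module)
  qed
  then have p: "?p \<in> mod_hom R (free_module R (\<delta> ` Y)) ?M" by (auto simp: mod_hom_def)
  have "?p (?i f) = f" for f using inj by (auto simp: fun_eq_iff the_inv_f_f)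
  with i p free_module[OF class_ring_cring] show ?thesis
    unfolding projective_module_def by blast
qed

lemma comb_hom:
  assumes "comb c h ` free c \<subseteq> free b"
  shows "comb c h \<in> mod_hom R (free_module R (Inr ` {..<c} :: ('m + nat) set)) (free_module R (Inr ` {..<b} :: ('m + nat) set))"
proof -
  have "comb c h f \<in> free b" if "f \<in> free c" for f using assms that by blast
  moreover have "comb c h (\<lambda>x. f x + f' x) = (\<lambda>x. comb c h f x + comb c h f' x)"
    for f f' :: "'m + nat \<Rightarrow> 'r"
    by (simp add: fun_eq_iff comb_apply algebra_simps sum.distrib)
  moreover have "comb c h (\<lambda>x. a * f x) = (\<lambda>x. a * comb c h f x)"
    for a and f :: "'m + nat \<Rightarrow> 'r"
    by (simp add: fun_eq_iff comb_apply sum_distrib_left mult_ac)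
  ultimately show ?thesis
    unfolding mod_hom_def free_def by simp
qed

end

lemma proj_dim_le_res_length:
  fixes R :: "'r::comm_ring_1 ring"
  assumes "class_ring R" "ideal I R"
    and res: "class_ring.res_length R n (emb ` I :: ('r set + nat \<Rightarrow> 'r) set)"
  shows "proj_dim R (quotient_module R I) \<le> enat n"
proof -
  interpret class_ring R "TYPE('r set)" by fact
  interpret I: ideal I R by fact
  let ?emb = "emb :: 'r \<Rightarrow> 'r set + nat \<Rightarrow> 'r"
  note R = class_ring_cring and F = free_module[OF class_ring_cring]
  note Q = quotient_module[OF R assms(2)] and h = quotient_hom[OF R assms(2)]
  obtain b G where I: "?emb ` I = comb (b 0) (G 0) ` free (b 0)"
    and syz: "\<And>i. syz (b i) (G i) = comb (b (Suc i)) (G (Suc i)) ` free (b (Suc i))"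
    and b0: "\<And>i. i \<ge> n \<Longrightarrow> b i = 0"
    using res_length_sequence[OF res] by (elim exE conjE) (simp only:)
  \<comment> \<open>Index 0 is the free module of rank 1 mapping onto \<open>R/I\<close>; the
    \<open>n\<close> modules that resolve \<open>I\<close> follow at the indices 1 to
    \<open>n\<close>. As \<open>res_length\<close> counts modules, the length is \<open>n\<close> in
    both readings.\<close>
  define c where "c = case_nat 1 b"
  define P :: "nat \<Rightarrow> ('r, 'r set + nat \<Rightarrow> 'r) module" where "P i = free_module R (Inr ` {..<c i})" for i
  define d :: "nat \<Rightarrow> ('r set + nat \<Rightarrow> 'r) \<Rightarrow> 'r set + nat \<Rightarrow> 'r" where "d i = comb (b i) (G i)" for i
  define e where "e f = I +>\<^bsub>R\<^esub> f (Inr 0)" for f :: "'r set + nat \<Rightarrow> 'r"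
  have carrier_P: "carrier (P i) = free (c i)" for i by (simp add: P_def free_def)
  have zero_P: "\<zero>\<^bsub>P i\<^esub> = 0" for i by (simp add: P_def zero_fun_def)
  have emb_free: "?emb p \<in> free 1" if "p \<in> carrier R" for p using that by (auto simp: in_free emb_def)
  have free_1: "f = ?emb (f (Inr 0))" "f (Inr 0) \<in> carrier R" if "f \<in> free 1" for f
  proof -
    show "f = ?emb (f (Inr 0))"
    proof
      fix x show "f x = ?emb (f (Inr 0)) x"
        using that by (cases "x = Inr 0") (auto simp: in_free emb_def)
    qed
    show "f (Inr 0) \<in> carrier R" using that by (simp add: in_free)
  qed
  have IR: "I \<subseteq> carrier R" using I.Icarr by blast
  have img: "comb (b i) (G i) ` free (b i) \<subseteq> free (c i)" for i
  proof (cases i)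
    case 0
    have "?emb ` I \<subseteq> free 1" using emb_free IR by blast
    then show ?thesis unfolding 0 c_def nat.case I .
  next
    case (Suc j)
    then show ?thesis using syz[of j] by (auto simp: c_def syz_def)
  qed
  have "projective_resolution R (quotient_module R I) n P d e"
    unfolding projective_resolution_def
  proof (intro conjI allI impI)
    show "projective_module R (P i)" for i unfolding P_def by (rule projective_free_module)
    show "carrier (P i) = {\<zero>\<^bsub>P i\<^esub>}" if "i > n" for i
    proof -
      have "c i = 0" using that b0 by (cases i) (auto simp: c_def)
      then show ?thesis unfolding carrier_P zero_P using free_0 by simp
    qed
    show "e \<in> mod_hom R (P 0) (quotient_module R I)"
    proof -
      have "e f \<in> carrier (quotient_module R I)" if "f \<in> carrier (P 0)" for f
        using that free_1(2)[of f] h(2) unfolding carrier_P e_def by (auto simp: c_def)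
      moreover have "e (f \<oplus>\<^bsub>P 0\<^esub> g) = e f \<oplus>\<^bsub>quotient_module R I\<^esub> e g"
        if "f \<in> carrier (P 0)" "g \<in> carrier (P 0)" for f g
        using that free_1(2)[of f] free_1(2)[of g] mod_homD(2)[OF h(1)]
        unfolding carrier_P e_def by (auto simp: c_def P_def)
      moreover have "e (a \<odot>\<^bsub>P 0\<^esub> f) = a \<odot>\<^bsub>quotient_module R I\<^esub> e f"
        if "a \<in> carrier R" "f \<in> carrier (P 0)" for a f
        using that free_1(2)[of f] mod_homD(3)[OF h(1)]
        unfolding carrier_P e_def by (auto simp: c_def P_def)
      ultimately show ?thesis by (auto simp: mod_hom_def)
    qed
    show "d i \<in> mod_hom R (P (Suc i)) (P i)" for i
      using comb_hom[OF img[of i]] by (simp add: P_def d_def c_def)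
    show "e ` carrier (P 0) = carrier (quotient_module R I)"
    proof
      show "e ` carrier (P 0) \<subseteq> carrier (quotient_module R I)"
        using \<open>e \<in> mod_hom R (P 0) (quotient_module R I)\<close> by (auto simp: mod_hom_def)
      show "carrier (quotient_module R I) \<subseteq> e ` carrier (P 0)"
      proof
        fix C assume "C \<in> carrier (quotient_module R I)"
        then obtain a where "a \<in> carrier R" "C = I +>\<^bsub>R\<^esub> a" using h(2) by blast
        then show "C \<in> e ` carrier (P 0)"
          unfolding carrier_P by (intro image_eqI[of _ _ "?emb a"]) (auto simp: e_def emb_def in_free c_def)
      qed
    qed
    show "d 0 ` carrier (P 1) = a_kernel (P 0) (quotient_module R I) e"
    proof -
      have "a_kernel (P 0) (quotient_module R I) e = ?emb ` I"
      proof -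
        have "f \<in> a_kernel (P 0) (quotient_module R I) e \<longleftrightarrow> f \<in> ?emb ` I" for f
        proof
          assume "f \<in> a_kernel (P 0) (quotient_module R I) e"
          then have f: "f \<in> free 1" "e f = I"
            by (auto simp: a_kernel_def kernel_def carrier_P c_def FactRing_zero)
          then have "f (Inr 0) \<in> I" using h(3)[OF free_1(2)[OF f(1)]] by (simp add: e_def)
          then show "f \<in> ?emb ` I" using free_1(1)[OF f(1)] by blast
        next
          assume "f \<in> ?emb ` I"
          then obtain p where p: "p \<in> I" "f = ?emb p" by blast
          then have "e f = I" using h(3)[of p] IR by (auto simp: e_def emb_def)
          then show "f \<in> a_kernel (P 0) (quotient_module R I) e"
            using p emb_free[of p] IR by (auto simp: a_kernel_def kernel_def carrier_P c_def FactRing_zero)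
        qed
        then show ?thesis by blast
      qed
      then show ?thesis using I by (simp add: d_def carrier_P c_def)
    qed
    show "d (Suc i) ` carrier (P (Suc (Suc i))) = a_kernel (P (Suc i)) (P i) (d i)" for i
    proof -
      have "a_kernel (P (Suc i)) (P i) (d i) = syz (b i) (G i)"
        unfolding a_kernel_def kernel_def syz_def by (simp add: carrier_P zero_P c_def d_def)
      then show ?thesis using syz[of i] by (simp add: d_def carrier_P c_def)
    qed
  qed
  then show ?thesis unfolding proj_dim_le_iff by blast
qed

section \<open>Resolution bounds for squarefree monomial ideals\<close>

lemma class_ring_poly_ring: "class_ring (poly_ring X :: (('x \<Rightarrow>\<^sub>0 nat) \<Rightarrow>\<^sub>0 'k::field) ring)"
  by unfold_locales auto

lemma sqfree_ideal_mono:
  assumes "\<And>E. E \<in> G \<Longrightarrow> \<exists>E'\<in>G'. E' \<subseteq> E"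
  shows "sqfree_ideal X G \<subseteq> sqfree_ideal X G'"
proof
  fix p assume p: "p \<in> sqfree_ideal X G"
  have "\<exists>E'\<in>G'. E' \<subseteq> Poly_Mapping.keys m" if "m \<in> Poly_Mapping.keys p" for m
  proof -
    obtain E where "E \<in> G" "E \<subseteq> Poly_Mapping.keys m" using p \<open>m \<in> _\<close> unfolding sqfree_ideal_def by blast
    then show ?thesis using assms by (meson order_trans)
  qed
  then show "p \<in> sqfree_ideal X G'" using p by (simp add: sqfree_ideal_def)
qed

lemma keys_monom_mult:
  "Poly_Mapping.keys (p * Poly_Mapping.single e (1::'k::field)) = (\<lambda>m. e + m) ` Poly_Mapping.keys (p :: ('x \<Rightarrow>\<^sub>0 nat) \<Rightarrow>\<^sub>0 'k)"
proof
  show "Poly_Mapping.keys (p * Poly_Mapping.single e 1) \<subseteq> (\<lambda>m. e + m) ` Poly_Mapping.keys p"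
    using keys_mult[of p "Poly_Mapping.single e 1"] by (auto simp: add.commute)
  show "(\<lambda>m. e + m) ` Poly_Mapping.keys p \<subseteq> Poly_Mapping.keys (p * Poly_Mapping.single e 1)"
    using lookup_single_mult_add[of e 1 p] by (auto simp: in_keys_iff mult.commute)
qed

text \<open>The support of a product of monomials is the union of the supports, and \<open>E\<close>
  lies in the union of \<open>D\<close> and \<open>K\<close> exactly if \<open>E - D\<close> lies in
  \<open>K\<close>.\<close>

lemma sqfree_ideal_colon:
  assumes "finite D" "D \<subseteq> X"
  shows "{r \<in> carrier (poly_ring X). r * Poly_Mapping.single (monom_of D) 1 \<in> sqfree_ideal X G}
    = (sqfree_ideal X ((\<lambda>E. E - D) ` G) :: (('x \<Rightarrow>\<^sub>0 nat) \<Rightarrow>\<^sub>0 'k::field) set)"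
proof -
  have "Poly_Mapping.single (monom_of D) (1::'k) \<in> carrier (poly_ring X)"
    using assms by (simp add: in_poly_ring keys_monom_of)
  moreover have "E \<subseteq> D \<union> K \<longleftrightarrow> E - D \<subseteq> K" for E K :: "'x set" by auto
  ultimately show ?thesis
    using assms by (auto simp: sqfree_ideal_def keys_monom_mult keys_add_nat keys_monom_of)
qed

text \<open>Division with remainder by the monomial of \<open>D\<close>: the quotient collects the
  terms divisible by it, and the terms of the remainder can only be multiples of generators in
  \<open>G\<close>.\<close>

lemma sqfree_ideal_insert:
  assumes "finite D" "D \<subseteq> X"
  shows "{p + r * Poly_Mapping.single (monom_of D) 1 | p r. p \<in> sqfree_ideal X G \<and> r \<in> carrier (poly_ring X)}
    = (sqfree_ideal X (insert D G) :: (('x \<Rightarrow>\<^sub>0 nat) \<Rightarrow>\<^sub>0 'k::field) set)"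
proof
  let ?d = "Poly_Mapping.single (monom_of D) (1::'k)"
  have d: "?d \<in> carrier (poly_ring X)" using assms by (simp add: in_poly_ring keys_monom_of)
  show "{p + r * ?d | p r. p \<in> sqfree_ideal X G \<and> r \<in> carrier (poly_ring X)} \<subseteq> sqfree_ideal X (insert D G)"
  proof clarify
    fix p r :: "('x \<Rightarrow>\<^sub>0 nat) \<Rightarrow>\<^sub>0 'k"
    assume p: "p \<in> sqfree_ideal X G" and r: "r \<in> carrier (poly_ring X)"
    have "p \<in> sqfree_ideal X (insert D G)" using p sqfree_ideal_mono[of G "insert D G" X] by blast
    moreover have "r * ?d \<in> sqfree_ideal X (insert D G)"
      using r d assms by (auto simp: sqfree_ideal_def keys_monom_mult keys_add_nat keys_monom_of)
    ultimately show "p + r * ?d \<in> sqfree_ideal X (insert D G)" by (rule sqfree_ideal_add)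
  qed
  show "sqfree_ideal X (insert D G) \<subseteq> {p + r * ?d | p r. p \<in> sqfree_ideal X G \<and> r \<in> carrier (poly_ring X)}"
  proof
    fix p :: "('x \<Rightarrow>\<^sub>0 nat) \<Rightarrow>\<^sub>0 'k" assume p: "p \<in> sqfree_ideal X (insert D G)"
    then have pR: "p \<in> carrier (poly_ring X)" by (simp add: sqfree_ideal_def)
    define r where "r = Poly_Mapping.map_key (\<lambda>m. monom_of D + m) p"
    have inj: "inj (\<lambda>m. monom_of D + m)" by (simp add: inj_def)
    have r: "Poly_Mapping.lookup r m = Poly_Mapping.lookup p (monom_of D + m)" for m
      using inj by (simp add: r_def map_key.rep_eq)
    have rR: "r \<in> carrier (poly_ring X)"
      unfolding in_poly_ring
    proof
      fix m assume "m \<in> Poly_Mapping.keys r"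
      then have "monom_of D + m \<in> Poly_Mapping.keys p" by (simp add: in_keys_iff r)
      then have "Poly_Mapping.keys (monom_of D + m) \<subseteq> X" using pR unfolding in_poly_ring by blast
      then show "Poly_Mapping.keys m \<subseteq> X" by (simp add: keys_add_nat)
    qed
    let ?q = "p - r * ?d"
    have q0: "Poly_Mapping.lookup ?q (monom_of D + m) = 0" for m
      using lookup_single_mult_add[of "monom_of D" 1 r m] by (simp add: lookup_minus r mult.commute)
    have "\<exists>E\<in>G. E \<subseteq> Poly_Mapping.keys m" if m: "m \<in> Poly_Mapping.keys ?q" for m
    proof -
      have nD: "\<not> D \<subseteq> Poly_Mapping.keys m"
      proof
        assume "D \<subseteq> Poly_Mapping.keys m"
        then show False using monom_of_dvd q0 m by (metis in_keys_iff)
      qed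
      then have "m \<notin> Poly_Mapping.keys (r * ?d)"
        using assms by (auto simp: keys_monom_mult keys_add_nat keys_monom_of)
      then have "m \<in> Poly_Mapping.keys p" using m by (simp add: in_keys_iff lookup_minus)
      then show ?thesis using p nD by (auto simp: sqfree_ideal_def)
    qed
    moreover have "?q \<in> carrier (poly_ring X)"
      using poly_ring_closed(3)[OF pR poly_ring_closed(5)[OF poly_ring_closed(4)[OF rR d]]] by simp
    ultimately have "?q \<in> sqfree_ideal X G" by (simp add: sqfree_ideal_def)
    moreover have "p = ?q + r * ?d" by simp
    ultimately show "p \<in> {p + r * ?d | p r. p \<in> sqfree_ideal X G \<and> r \<in> carrier (poly_ring X)}"
      using rR by blast
  qed
qed

text \<open>A certificate that \<open>R/I\<close> has projective dimension at most \<open>n\<close>,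
  by finite free modules; in this form it passes through mapping cones.\<close>

definition res_bound :: "'k::field itself \<Rightarrow> 'x set \<Rightarrow> nat \<Rightarrow> 'x set set \<Rightarrow> bool" where
  "res_bound _ X n G \<longleftrightarrow> class_ring.res_length (poly_ring X :: (('x \<Rightarrow>\<^sub>0 nat) \<Rightarrow>\<^sub>0 'k) ring) n
    (emb ` sqfree_ideal X G :: ((('x \<Rightarrow>\<^sub>0 nat) \<Rightarrow>\<^sub>0 'k) set + nat \<Rightarrow> ('x \<Rightarrow>\<^sub>0 nat) \<Rightarrow>\<^sub>0 'k) set)"

lemma res_bound_empty:
  fixes k :: "'b::field itself" and X :: "'a set"
  shows "res_bound k X 0 {}"
proof -
  interpret class_ring "poly_ring X :: (('a \<Rightarrow>\<^sub>0 nat) \<Rightarrow>\<^sub>0 'b) ring" "TYPE((('a \<Rightarrow>\<^sub>0 nat) \<Rightarrow>\<^sub>0 'b) set)"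
    by (rule class_ring_poly_ring)
  have "sqfree_ideal X {} = {0 :: ('a \<Rightarrow>\<^sub>0 nat) \<Rightarrow>\<^sub>0 'b}"
    by (auto simp: sqfree_ideal_def intro: poly_mapping_eqI simp: in_keys_iff)
  then show ?thesis unfolding res_bound_def res_length.simps
    by (simp only: image_insert image_empty emb_simps)
qed

lemma res_bound_mono: "res_bound k X n G \<Longrightarrow> n \<le> n' \<Longrightarrow> res_bound k X n' G"
  unfolding res_bound_def by (rule class_ring.res_length_mono[OF class_ring_poly_ring])

text \<open>Serves to drop generators that are multiples of others.\<close>

lemma res_bound_cong:
  fixes k :: "'b::field itself" and X :: "'a set"
  assumes "res_bound k X n G" "\<And>E. E \<in> G \<Longrightarrow> \<exists>E'\<in>G'. E' \<subseteq> E" "\<And>E. E \<in> G' \<Longrightarrow> \<exists>E'\<in>G. E' \<subseteq> E"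
  shows "res_bound k X n G'"
proof -
  have "sqfree_ideal X G = (sqfree_ideal X G' :: (('a \<Rightarrow>\<^sub>0 nat) \<Rightarrow>\<^sub>0 'b) set)"
    by (intro equalityI sqfree_ideal_mono assms(2,3))
  then show ?thesis using assms(1) by (simp add: res_bound_def)
qed

lemma res_bound_cone:
  fixes k :: "'k::field itself"
  assumes "res_bound k X (Suc n) G" "res_bound k X n ((\<lambda>E. E - D) ` G)" "finite D" "D \<subseteq> X"
  shows "res_bound k X (Suc n) (insert D G)"
  using class_ring.res_length_cone[OF class_ring_poly_ring, of X n "sqfree_ideal X G" "Poly_Mapping.single (monom_of D) (1::'k)"]
    assms unfolding res_bound_def sqfree_ideal_colon[OF assms(3,4)] sqfree_ideal_insert[OF assms(3,4)]
  by blast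

lemma proj_dim_le_res_bound:
  assumes "res_bound TYPE('k::field) X n G"
  shows "proj_dim (poly_ring X) (quotient_module (poly_ring X)
    (sqfree_ideal X G :: (('x \<Rightarrow>\<^sub>0 nat) \<Rightarrow>\<^sub>0 'k) set)) \<le> enat n"
  using assms unfolding res_bound_def
  by (rule proj_dim_le_res_length[OF class_ring_poly_ring ideal_sqfree_ideal])

section \<open>Invariance under relabelling\<close>

text \<open>A resolution over \<open>R\<close> becomes one over \<open>S\<close> by letting scalars
  act through \<open>\<psi>\<close>. The maps stay the same; only the augmentation is composed with
  the semilinear isomorphism \<open>\<theta>\<close>. Since the element types agree, so do the types
  of the resolving modules.\<close>

lemma proj_dim_transport:
  fixes R S :: "'r ring" and M N :: "('r, 'm) module"
  assumes S: "cring S" and R: "cring R" and N: "Module.module S N"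
    and \<phi>: "\<phi> \<in> ring_hom R S" and \<psi>: "\<psi> \<in> ring_hom S R"
    and \<psi>\<phi>: "\<And>a. a \<in> carrier R \<Longrightarrow> \<psi> (\<phi> a) = a" and \<phi>\<psi>: "\<And>b. b \<in> carrier S \<Longrightarrow> \<phi> (\<psi> b) = b"
    and \<theta>: "\<theta> ` carrier M = carrier N"
      "\<And>x y. x \<in> carrier M \<Longrightarrow> y \<in> carrier M \<Longrightarrow> \<theta> (x \<oplus>\<^bsub>M\<^esub> y) = \<theta> x \<oplus>\<^bsub>N\<^esub> \<theta> y"
      "\<And>a x. a \<in> carrier R \<Longrightarrow> x \<in> carrier M \<Longrightarrow> \<theta> (a \<odot>\<^bsub>M\<^esub> x) = \<phi> a \<odot>\<^bsub>N\<^esub> \<theta> x"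
      "\<And>x. x \<in> carrier M \<Longrightarrow> \<theta> x = \<zero>\<^bsub>N\<^esub> \<longleftrightarrow> x = \<zero>\<^bsub>M\<^esub>"
  shows "proj_dim S N \<le> proj_dim R M"
proof (cases "proj_dim R M")
  case (enat n)
  interpret R: cring R by fact
  interpret S: cring S by fact
  interpret \<phi>: ring_hom_ring R S \<phi> by (intro ring_hom_ringI2 R.ring_axioms S.ring_axioms \<phi>)
  interpret \<psi>: ring_hom_ring S R \<psi> by (intro ring_hom_ringI2 R.ring_axioms S.ring_axioms \<psi>)
  obtain m and P :: "nat \<Rightarrow> ('r, 'm + nat \<Rightarrow> 'r) module" and d e
    where m: "m \<le> n" and res: "projective_resolution R M m P d e"
    using enat proj_dim_le_iff[of R M n] by auto
  define Q where "Q i = P i\<lparr>smult := \<lambda>b. smult (P i) (\<psi> b)\<rparr>" for i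
  have Q [simp]: "carrier (Q i) = carrier (P i)" "zero (Q i) = zero (P i)" "add (Q i) = add (P i)"
    "smult (Q i) = (\<lambda>b. smult (P i) (\<psi> b))" for i
    by (simp_all add: Q_def)
  have ker: "a_kernel (Q i) N' f = a_kernel (P i) N' f" for i f and N' :: "('r, 'n) module"
    by (simp add: a_kernel_def kernel_def)
  have kerQ: "a_kernel (P i) (Q j) f = a_kernel (P i) (P j) f" for i j f
    by (simp add: a_kernel_def kernel_def)
  have "projective_module S (Q i)" for i
  proof -
    have "projective_module R (P i)" using res by (simp add: projective_resolution_def)
    then obtain X :: "('m + nat \<Rightarrow> 'r) set" and j p where P: "Module.module R (P i)"
      and j: "j \<in> mod_hom R (P i) (free_module R X)" and p: "p \<in> mod_hom R (free_module R X) (P i)"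
      and pj: "\<And>x. x \<in> carrier (P i) \<Longrightarrow> p (j x) = x"
      unfolding projective_module_def by blast
    interpret P: Module.module R "P i" by fact
    have mod: "Module.module S (Q i)"
    proof (intro moduleI S abelian_groupI)
      fix x assume "x \<in> carrier (Q i)"
      then show "\<exists>y\<in>carrier (Q i). y \<oplus>\<^bsub>Q i\<^esub> x = \<zero>\<^bsub>Q i\<^esub>"
        by (intro bexI[of _ "\<ominus>\<^bsub>P i\<^esub> x"]) (auto simp: P.M.l_neg)
    qed (auto simp: P.M.a_ac P.smult_l_distr P.smult_r_distr P.smult_assoc1)
    have fin: "finite {x. h (f x) \<noteq> z'}" if "finite {x. f x \<noteq> z}" "h z = z'" for f :: "('m + nat \<Rightarrow> 'r) \<Rightarrow> 'r" and h z z'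
      by (rule finite_subset[OF _ that(1)]) (use that(2) in auto)
    \<comment> \<open>The free module keeps its basis \<open>X\<close>; coordinates are translated
      by \<open>\<phi>\<close> and \<open>\<psi>\<close>.\<close>
    let ?j = "\<lambda>x u. \<phi> (j x u)" and ?p = "\<lambda>F. p (\<lambda>u. \<psi> (F u))"
    have "?j x \<in> carrier (free_module S X)" if "x \<in> carrier (P i)" for x
      using mod_homD(1)[OF j that] fin[of "j x" "\<zero>\<^bsub>R\<^esub>" \<phi> "\<zero>\<^bsub>S\<^esub>"] by (auto simp: in_free_module)
    moreover have jx: "j x u \<in> carrier R" if "x \<in> carrier (P i)" for x u
      using mod_homD(1)[OF j that] by (auto simp: in_free_module)
    ultimately have j': "?j \<in> mod_hom S (Q i) (free_module S X)"
      using mod_homD(2,3)[OF j] by (auto simp: mod_hom_def \<phi>\<psi>)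
    have \<psi>F: "(\<lambda>u. \<psi> (F u)) \<in> carrier (free_module R X)" "\<And>u. F u \<in> carrier S"
      if "F \<in> carrier (free_module S X)" for F
      using that fin[of F "\<zero>\<^bsub>S\<^esub>" \<psi> "\<zero>\<^bsub>R\<^esub>"] by (auto simp: in_free_module)
    have p': "?p \<in> mod_hom S (free_module S X) (Q i)"
      unfolding mod_hom_def
    proof (intro CollectI conjI ballI Pi_I)
      fix F assume F: "F \<in> carrier (free_module S X)"
      show "?p F \<in> carrier (Q i)" using mod_homD(1)[OF p \<psi>F(1)[OF F]] by simp
      fix G assume G: "G \<in> carrier (free_module S X)"
      show "?p (F \<oplus>\<^bsub>free_module S X\<^esub> G) = ?p F \<oplus>\<^bsub>Q i\<^esub> ?p G"
        using mod_homD(2)[OF p \<psi>F(1)[OF F] \<psi>F(1)[OF G]] \<psi>F(2)[OF F] \<psi>F(2)[OF G] by simp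
    next
      fix b F assume b: "b \<in> carrier S" and F: "F \<in> carrier (free_module S X)"
      show "?p (b \<odot>\<^bsub>free_module S X\<^esub> F) = b \<odot>\<^bsub>Q i\<^esub> ?p F"
        using mod_homD(3)[OF p \<psi>.hom_closed[OF b] \<psi>F(1)[OF F]] \<psi>F(2)[OF F] b by simp
    qed
    have "?p (?j x) = x" if "x \<in> carrier (P i)" for x
      using jx[OF that] pj[OF that] by (simp add: \<psi>\<phi>)
    with mod j' p' show ?thesis unfolding projective_module_def by auto
  qed
  moreover have e: "(\<lambda>x. \<theta> (e x)) \<in> mod_hom S (Q 0) N"
  proof -
    have e: "e \<in> mod_hom R (P 0) M" using res by (simp add: projective_resolution_def)
    show ?thesis unfolding mod_hom_def
      using mod_homD[OF e] \<theta> \<phi>\<psi> by (auto simp: mod_hom_def)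
  qed
  moreover have "d i \<in> mod_hom S (Q (Suc i)) (Q i)" for i
  proof -
    have "d i \<in> mod_hom R (P (Suc i)) (P i)" using res by (simp add: projective_resolution_def)
    then show ?thesis by (auto simp: mod_hom_def)
  qed
  moreover have "(\<lambda>x. \<theta> (e x)) ` carrier (Q 0) = carrier N"
  proof -
    have "e ` carrier (P 0) = carrier M" using res by (simp add: projective_resolution_def)
    then show ?thesis using \<theta>(1) by (simp flip: image_image)
  qed
  moreover have "a_kernel (Q 0) N (\<lambda>x. \<theta> (e x)) = a_kernel (P 0) M e"
  proof -
    have "e x \<in> carrier M" if "x \<in> carrier (P 0)" for x
      using res that unfolding projective_resolution_def by blast
    then show ?thesis using \<theta>(4) by (auto simp: a_kernel_def kernel_def)
  qed
  ultimately have "projective_resolution S N m Q d (\<lambda>x. \<theta> (e x))"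
    using res unfolding projective_resolution_def by (simp add: ker kerQ)
  then show ?thesis unfolding enat using m proj_dim_le_iff[of S N n] by blast
qed simp

lemma poly_mapping_sum_single:
  "p = (\<Sum>m\<in>Poly_Mapping.keys p. Poly_Mapping.single m (Poly_Mapping.lookup p m))"
  by (intro poly_mapping_eqI) (auto simp: lookup_sum lookup_single when_def in_keys_iff)

text \<open>A permutation of the whole type together with its inverse: \<open>map_key\<close> needs
  injective maps, and exchanging the two parameters yields every fact for the inverse as
  well.\<close>

locale relabelling =
  fixes \<sigma> \<sigma>' :: "'x \<Rightarrow> 'x"
  assumes \<sigma>'\<sigma> [simp]: "\<sigma>' (\<sigma> x) = x" and \<sigma>\<sigma>' [simp]: "\<sigma> (\<sigma>' x) = x"
begin

lemma inj_relabel: "inj \<sigma>" "inj \<sigma>'"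
  by (metis injI \<sigma>'\<sigma>, metis injI \<sigma>\<sigma>')

definition relabel_monom :: "('x \<Rightarrow>\<^sub>0 nat) \<Rightarrow> 'x \<Rightarrow>\<^sub>0 nat" where
  "relabel_monom m = Poly_Mapping.map_key \<sigma>' m"

lemma lookup_relabel_monom: "Poly_Mapping.lookup (relabel_monom m) x = Poly_Mapping.lookup m (\<sigma>' x)"
  using inj_relabel(2) by (simp add: relabel_monom_def map_key.rep_eq)

lemma keys_relabel_monom: "Poly_Mapping.keys (relabel_monom m) = \<sigma> ` Poly_Mapping.keys m"
proof (intro equalityI subsetI)
  fix x assume "x \<in> Poly_Mapping.keys (relabel_monom m)"
  then show "x \<in> \<sigma> ` Poly_Mapping.keys m"
    by (intro image_eqI[of _ _ "\<sigma>' x"]) (simp_all add: in_keys_iff lookup_relabel_monom)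
qed (auto simp: in_keys_iff lookup_relabel_monom)

lemma relabel_monom_add: "relabel_monom (m + m') = relabel_monom m + relabel_monom m'"
  by (intro poly_mapping_eqI) (simp add: lookup_relabel_monom lookup_add)

lemma relabel_monom_zero: "relabel_monom 0 = 0"
  by (intro poly_mapping_eqI) (simp add: lookup_relabel_monom)

end

sublocale relabelling \<subseteq> inverse: relabelling \<sigma>' \<sigma>
  by unfold_locales simp_all

context relabelling
begin

lemma relabel_monom_inverse [simp]: "inverse.relabel_monom (relabel_monom m) = m"
  by (intro poly_mapping_eqI) (simp add: lookup_relabel_monom inverse.lookup_relabel_monom)

lemma relabel_monom_inverse' [simp]: "relabel_monom (inverse.relabel_monom m) = m"
  by (intro poly_mapping_eqI) (simp add: lookup_relabel_monom inverse.lookup_relabel_monom)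

lemma inj_relabel_monom: "inj inverse.relabel_monom"
  by (metis injI relabel_monom_inverse')

definition relabel :: "(('x \<Rightarrow>\<^sub>0 nat) \<Rightarrow>\<^sub>0 'k::field) \<Rightarrow> ('x \<Rightarrow>\<^sub>0 nat) \<Rightarrow>\<^sub>0 'k" where
  "relabel p = Poly_Mapping.map_key inverse.relabel_monom p"

lemma lookup_relabel: "Poly_Mapping.lookup (relabel p) m = Poly_Mapping.lookup p (inverse.relabel_monom m)"
  using inj_relabel_monom by (simp add: relabel_def map_key.rep_eq)

lemma keys_relabel: "Poly_Mapping.keys (relabel p) = relabel_monom ` Poly_Mapping.keys p"
proof (intro equalityI subsetI)
  fix m assume "m \<in> Poly_Mapping.keys (relabel p)"
  then show "m \<in> relabel_monom ` Poly_Mapping.keys p"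
    by (intro image_eqI[of _ _ "inverse.relabel_monom m"]) (simp_all add: in_keys_iff lookup_relabel)
qed (auto simp: in_keys_iff lookup_relabel)

lemma relabel_add: "relabel (p + q) = relabel p + relabel q"
  by (intro poly_mapping_eqI) (simp add: lookup_relabel lookup_add)

lemma relabel_sum: "relabel (sum f A) = (\<Sum>a\<in>A. relabel (f a))"
  by (intro poly_mapping_eqI) (simp add: lookup_relabel lookup_sum)

lemma relabel_single: "relabel (Poly_Mapping.single m a) = Poly_Mapping.single (relabel_monom m) a"
  by (intro poly_mapping_eqI) (auto simp: lookup_relabel lookup_single when_def)

lemma relabel_mult: "relabel (p * q) = relabel p * relabel q"
proof -
  let ?s = "\<lambda>p m. Poly_Mapping.single m (Poly_Mapping.lookup p m)"
  have "relabel (p * q) = relabel ((\<Sum>m\<in>Poly_Mapping.keys p. ?s p m) * (\<Sum>m\<in>Poly_Mapping.keys q. ?s q m))"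
    by (simp flip: poly_mapping_sum_single)
  also have "\<dots> = relabel (\<Sum>m\<in>Poly_Mapping.keys p. ?s p m) * relabel (\<Sum>m\<in>Poly_Mapping.keys q. ?s q m)"
    by (simp add: sum_product relabel_sum relabel_single mult_single relabel_monom_add)
  finally show ?thesis by (simp flip: poly_mapping_sum_single)
qed

end

context relabelling
begin

lemma relabel_inverse: "inverse.relabel (relabel p) = p"
  by (intro poly_mapping_eqI) (simp add: lookup_relabel inverse.lookup_relabel)

lemma relabel_closed: "p \<in> carrier (poly_ring X) \<Longrightarrow> relabel p \<in> carrier (poly_ring (\<sigma> ` X))"
  by (auto simp: in_poly_ring keys_relabel keys_relabel_monom)

lemma relabel_hom: "relabel \<in> ring_hom (poly_ring X) (poly_ring (\<sigma> ` X))"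
proof -
  have "relabel 1 = 1"
    using relabel_single[of 0 1] by (simp add: relabel_monom_zero)
  then show ?thesis
    by (auto simp: ring_hom_def relabel_closed relabel_add relabel_mult)
qed

lemma relabel_sqfree:
  assumes "p \<in> sqfree_ideal X G" shows "relabel p \<in> sqfree_ideal (\<sigma> ` X) ((`) \<sigma> ` G)"
proof -
  have "\<exists>E\<in>(`) \<sigma> ` G. E \<subseteq> Poly_Mapping.keys (relabel_monom m)" if m: "m \<in> Poly_Mapping.keys p" for m
  proof -
    obtain E where "E \<in> G" "E \<subseteq> Poly_Mapping.keys m" using assms m unfolding sqfree_ideal_def by blast
    then show ?thesis unfolding keys_relabel_monom by (intro bexI[of _ "\<sigma> ` E"]) auto
  qed
  then show ?thesis using assms relabel_closed[of p X] by (simp add: sqfree_ideal_def keys_relabel)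
qed

end

context relabelling
begin

lemma image_inverse [simp]: "\<sigma>' ` \<sigma> ` A = A" "\<sigma> ` \<sigma>' ` A = A"
  by (simp_all add: image_image)

lemma relabel_image_sqfree:
  "relabel ` (sqfree_ideal X G :: (('x \<Rightarrow>\<^sub>0 nat) \<Rightarrow>\<^sub>0 'a::field) set) = sqfree_ideal (\<sigma> ` X) ((`) \<sigma> ` G)"
  (is "?L = ?R")
proof
  show "?L \<subseteq> ?R" using relabel_sqfree by blast
  show "?R \<subseteq> ?L"
  proof
    fix p :: "('x \<Rightarrow>\<^sub>0 nat) \<Rightarrow>\<^sub>0 'a" assume "p \<in> sqfree_ideal (\<sigma> ` X) ((`) \<sigma> ` G)"
    from inverse.relabel_sqfree[OF this] have "inverse.relabel p \<in> sqfree_ideal X G" by (simp add: image_image)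
    then show "p \<in> relabel ` sqfree_ideal X G"
      by (intro image_eqI[of _ _ "inverse.relabel p"]) (simp_all add: inverse.relabel_inverse)
  qed
qed

lemma proj_dim_relabel:
  "proj_dim (poly_ring (\<sigma> ` X)) (quotient_module (poly_ring (\<sigma> ` X))
      (sqfree_ideal (\<sigma> ` X) ((`) \<sigma> ` G) :: (('x \<Rightarrow>\<^sub>0 nat) \<Rightarrow>\<^sub>0 'k::field) set))
    \<le> proj_dim (poly_ring X) (quotient_module (poly_ring X) (sqfree_ideal X G :: (('x \<Rightarrow>\<^sub>0 nat) \<Rightarrow>\<^sub>0 'k) set))"
proof -
  let ?R = "poly_ring X :: (('x \<Rightarrow>\<^sub>0 nat) \<Rightarrow>\<^sub>0 'k) ring" and ?S = "poly_ring (\<sigma> ` X) :: (('x \<Rightarrow>\<^sub>0 nat) \<Rightarrow>\<^sub>0 'k) ring"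
  let ?I = "sqfree_ideal X G :: (('x \<Rightarrow>\<^sub>0 nat) \<Rightarrow>\<^sub>0 'k) set"
  let ?J = "sqfree_ideal (\<sigma> ` X) ((`) \<sigma> ` G) :: (('x \<Rightarrow>\<^sub>0 nat) \<Rightarrow>\<^sub>0 'k) set"
  let ?\<theta> = "\<lambda>C. relabel ` C"
  note R = poly_ring_cring and I = ideal_sqfree_ideal
  interpret I: ideal ?I ?R by (rule I)
  interpret J: ideal ?J ?S by (rule I)
  note hI = quotient_hom[OF R I.ideal_axioms] and hJ = quotient_hom[OF R J.ideal_axioms]
  have coset: "?\<theta> (?I +>\<^bsub>?R\<^esub> a) = ?J +>\<^bsub>?S\<^esub> relabel a" for a
    unfolding relabel_image_sqfree[symmetric] by (auto simp: a_r_coset_def' relabel_add image_iff)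
  show ?thesis
  proof (rule proj_dim_transport[OF R R quotient_module[OF R I] relabel_hom])
    have "inverse.relabel \<in> ring_hom (poly_ring (\<sigma> ` X)) (poly_ring (\<sigma>' ` \<sigma> ` X))"
      by (rule inverse.relabel_hom)
    then show "inverse.relabel \<in> ring_hom ?S ?R" by (simp only: image_inverse)
    show "inverse.relabel (relabel a) = a" for a :: "('x \<Rightarrow>\<^sub>0 nat) \<Rightarrow>\<^sub>0 'k"
      by (rule relabel_inverse)
    show "relabel (inverse.relabel a) = a" for a :: "('x \<Rightarrow>\<^sub>0 nat) \<Rightarrow>\<^sub>0 'k"
      by (rule inverse.relabel_inverse)
    have img: "relabel ` carrier ?R = carrier ?S"
    proof
      show "relabel ` carrier ?R \<subseteq> carrier ?S" using relabel_closed by blast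
      show "carrier ?S \<subseteq> relabel ` carrier ?R"
      proof
        fix p assume p: "p \<in> carrier ?S"
        then have "inverse.relabel p \<in> carrier ?R" using inverse.relabel_closed[OF p] by simp
        then show "p \<in> relabel ` carrier ?R"
          by (intro image_eqI[of _ _ "inverse.relabel p"]) (simp_all add: inverse.relabel_inverse)
      qed
    qed
    show "?\<theta> ` carrier (quotient_module ?R ?I) = carrier (quotient_module ?S ?J)"
      unfolding hI(2)[symmetric] hJ(2)[symmetric] img[symmetric] image_image coset ..
    fix C assume "C \<in> carrier (quotient_module ?R ?I)"
    then obtain a where a: "a \<in> carrier ?R" "C = ?I +>\<^bsub>?R\<^esub> a" using hI(2) by blast
    have a': "relabel a \<in> carrier ?S" using relabel_closed a(1) by blast
    show "?\<theta> C = \<zero>\<^bsub>quotient_module ?S ?J\<^esub> \<longleftrightarrow> C = \<zero>\<^bsub>quotient_module ?R ?I\<^esub>"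
    proof -
      have "relabel a \<in> ?J \<longleftrightarrow> a \<in> ?I"
      proof -
        have "inj (relabel :: _ \<Rightarrow> ('x \<Rightarrow>\<^sub>0 nat) \<Rightarrow>\<^sub>0 'k)"
          by (rule inj_on_inverseI[of _ inverse.relabel]) (rule relabel_inverse)
        from inj_image_mem_iff[OF this, of a ?I] show ?thesis by (simp only: relabel_image_sqfree)
      qed
      then show ?thesis using hI(3)[OF a(1)] hJ(3)[OF a'] a(2) coset by simp
    qed
    {
      fix D assume "D \<in> carrier (quotient_module ?R ?I)"
      then obtain b where b: "b \<in> carrier ?R" "D = ?I +>\<^bsub>?R\<^esub> b" using hI(2) by blast
      have b': "relabel b \<in> carrier ?S" using relabel_closed b(1) by blast
      have "C \<oplus>\<^bsub>quotient_module ?R ?I\<^esub> D = ?I +>\<^bsub>?R\<^esub> (a + b)"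
        using mod_homD(2)[OF hI(1), of a b] a b by simp
      then have "?\<theta> (C \<oplus>\<^bsub>quotient_module ?R ?I\<^esub> D) = ?J +>\<^bsub>?S\<^esub> (relabel a + relabel b)"
        by (simp only: coset relabel_add)
      also have "\<dots> = ?\<theta> C \<oplus>\<^bsub>quotient_module ?S ?J\<^esub> ?\<theta> D"
        unfolding a(2) b(2) coset using mod_homD(2)[OF hJ(1), of "relabel a" "relabel b"] a' b' by simp
      finally show "?\<theta> (C \<oplus>\<^bsub>quotient_module ?R ?I\<^esub> D) = ?\<theta> C \<oplus>\<^bsub>quotient_module ?S ?J\<^esub> ?\<theta> D" .
    }
    fix r assume r: "r \<in> carrier ?R"
    have r': "relabel r \<in> carrier ?S" using relabel_closed r by blast
    have "r \<odot>\<^bsub>quotient_module ?R ?I\<^esub> C = ?I +>\<^bsub>?R\<^esub> (r * a)"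
      using mod_homD(3)[OF hI(1), of r a] a r by simp
    then have "?\<theta> (r \<odot>\<^bsub>quotient_module ?R ?I\<^esub> C) = ?J +>\<^bsub>?S\<^esub> (relabel r * relabel a)"
      by (simp only: coset relabel_mult)
    also have "\<dots> = relabel r \<odot>\<^bsub>quotient_module ?S ?J\<^esub> ?\<theta> C"
      unfolding a(2) coset using mod_homD(3)[OF hJ(1), of "relabel r" "relabel a"] a' r' by simp
    finally show "?\<theta> (r \<odot>\<^bsub>quotient_module ?R ?I\<^esub> C) = relabel r \<odot>\<^bsub>quotient_module ?S ?J\<^esub> ?\<theta> C" .
  qed
qed

end

text \<open>The complements of \<open>A\<close> and \<open>B\<close> in their union have the same
  size, so the bijection extends to the union, and everything else is fixed.\<close>

lemma ex_relabelling:
  assumes "finite A" "bij_betw g A B"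
  obtains \<sigma> \<sigma>' where "relabelling \<sigma> \<sigma>'" "\<And>x. x \<in> A \<Longrightarrow> \<sigma> x = g x"
proof -
  have fin: "finite B" and card: "card A = card B"
    using assms bij_betw_finite bij_betw_same_card by blast+
  let ?U = "A \<union> B"
  have "card (?U - A) = card (?U - B)"
    using assms(1) fin card by (simp add: card_Diff_subset)
  then obtain h where h: "bij_betw h (?U - A) (?U - B)"
    using finite_same_card_bij[of "?U - A" "?U - B"] assms(1) fin by auto
  let ?s = "\<lambda>x. if x \<in> A then g x else if x \<in> ?U - A then h x else x"
  have "bij_betw ?s A B" using assms(2) by (simp cong: bij_betw_cong)
  moreover have "bij_betw ?s (?U - A) (?U - B)" by (rule bij_betw_cong[THEN iffD1, OF _ h]) auto
  ultimately have "bij_betw ?s (A \<union> (?U - A)) (B \<union> (?U - B))" by (rule bij_betw_combine) auto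
  moreover have "A \<union> (?U - A) = ?U" "B \<union> (?U - B) = ?U" by auto
  ultimately have "bij_betw ?s ?U ?U" by metis
  moreover have "bij_betw ?s (- ?U) (- ?U)"
  proof -
    have "bij_betw (\<lambda>x. x) (- ?U) (- ?U)" by (simp add: bij_betw_def)
    then show ?thesis by (rule bij_betw_cong[THEN iffD1, rotated]) auto
  qed
  ultimately have "bij_betw ?s (?U \<union> - ?U) (?U \<union> - ?U)" by (rule bij_betw_combine) auto
  then have "bij ?s" unfolding Compl_partition .
  then have bij: "bij ?s" .
  have "relabelling ?s (inv_into UNIV ?s)"
  proof (rule relabelling.intro)
    from bij show "inv_into UNIV ?s (?s x) = x" for x by (rule inv_f_f[OF bij_is_inj])
    from bij show "?s (inv_into UNIV ?s x) = x" for x by (rule surj_f_inv_f[OF bij_is_surj])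
  qed
  then show ?thesis by (rule that) simp
qed

text \<open>The variables are edges, that is, sets of vertices. The action of \<open>f\<close> on
  the finite set \<open>H\<close> is injective and extends to a permutation of all sets of vertices,
  which relabels the variables.\<close>

lemma pd_relabel_le:
  fixes f :: "'v \<Rightarrow> 'v"
  assumes "finite H" "H \<subseteq> Pow V" "inj_on f V"
  shows "pd TYPE('k::field) (f ` V) ((`) f ` H) \<le> pd TYPE('k) V H"
proof -
  have "inj_on ((`) f) H"
    using assms(2,3) by (intro inj_onI) (metis PowD inj_on_image_eq_iff subsetD)
  then obtain \<sigma> \<sigma>' where "relabelling \<sigma> \<sigma>'" and \<sigma>: "\<And>E. E \<in> H \<Longrightarrow> \<sigma> E = f ` E"
    using ex_relabelling[OF assms(1) inj_on_imp_bij_betw] by blast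
  interpret relabelling \<sigma> \<sigma>' by fact
  have "\<sigma> ` H = (`) f ` H" using \<sigma> by auto
  moreover have "(`) \<sigma> ` vertex_edges H ` V = vertex_edges ((`) f ` H) ` f ` V"
  proof -
    have "\<sigma> ` vertex_edges H v = vertex_edges ((`) f ` H) (f v)" if "v \<in> V" for v
    proof -
      have "f v \<in> f ` E \<longleftrightarrow> v \<in> E" if "E \<in> H" for E
        using assms(2,3) \<open>v \<in> V\<close> that by (meson PowD inj_on_image_mem_iff subsetD)
      then show ?thesis using \<sigma> by (auto simp: vertex_edges_def)
    qed
    then show ?thesis by (simp add: image_image cong: image_cong)
  qed
  ultimately show ?thesis
    using proj_dim_relabel[of H "vertex_edges H ` V"] assms(1)
    by (simp add: pd_def hypergraph_ideal_sqfree)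
qed

lemma pd_relabel:
  fixes f :: "'v \<Rightarrow> 'v"
  assumes "finite H" "H \<subseteq> Pow V" "inj_on f V"
  shows "pd TYPE('k::field) (f ` V) ((`) f ` H) = pd TYPE('k) V H"
proof (rule antisym[OF pd_relabel_le[OF assms]])
  let ?g = "the_inv_into V f"
  have "?g ` f ` V = V" using assms(3) by (auto simp: the_inv_into_f_f image_image)
  moreover have "?g ` f ` E = E" if "E \<in> H" for E
    using assms(2,3) that by (force simp: the_inv_into_f_f image_image cong: image_cong)
  then have "(`) ?g ` (`) f ` H = H" by (simp add: image_image)
  moreover have "(`) f ` H \<subseteq> Pow (f ` V)" using assms(2) by blast
  ultimately show "pd TYPE('k) V H \<le> pd TYPE('k) (f ` V) ((`) f ` H)"
    using pd_relabel_le[of "(`) f ` H" "f ` V" ?g, where 'k = 'k] assms by (simp add: inj_on_the_inv_into)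
qed

section \<open>Strings and cycles\<close>

text \<open>A variable that divides none of the other generators is a nonzerodivisor modulo them, so
  the colon ideal is the ideal itself.\<close>

lemma res_bound_var:
  assumes "res_bound k X n G" "v \<in> X" "\<And>E. E \<in> G \<Longrightarrow> v \<in> E \<Longrightarrow> E = {v}"
  shows "res_bound k X (Suc n) (insert {v} G)"
proof (cases "{v} \<in> G")
  case True
  then show ?thesis using res_bound_mono[OF assms(1)] by (simp add: insert_absorb)
next
  case False
  then have "E - {v} = E" if "E \<in> G" for E using assms(3)[OF that] that by blast
  then have "(\<lambda>E. E - {v}) ` G = G" by simp
  then show ?thesis using assms res_bound_mono[OF assms(1)] by (intro res_bound_cone) auto
qed

text \<open>Here \<open>l\<close> counts the edges of a path on \<open>l + 1\<close> variables; the
  value is two thirds of \<open>l\<close>, rounded up.\<close>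

definition path_pd :: "nat \<Rightarrow> nat" where
  "path_pd l = l - l div 3"

lemma path_pd_eq: "path_pd l = (2 * l + 2) div 3"
  unfolding path_pd_def by presburger

lemma path_pd_mono: "l \<le> l' \<Longrightarrow> path_pd l \<le> path_pd l'"
  unfolding path_pd_eq by (intro div_le_mono) simp

definition pair :: "(nat \<Rightarrow> 'x) \<Rightarrow> nat \<Rightarrow> 'x set" where
  "pair u i = {u i, u (Suc i)}"

lemma inj_on_eqD: "inj_on u A \<Longrightarrow> i \<in> A \<Longrightarrow> j \<in> A \<Longrightarrow> u i = u j \<longleftrightarrow> i = j"
  by (auto dest: inj_onD)

text \<open>The last edge is added last. If the edge next to it is absent, the colon ideal has a
  path with two edges fewer. Otherwise that edge shrinks to the variable \<open>u i\<close>, the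
  edge before becomes redundant, and three edges are gone for a cost of two. The set
  \<open>B\<close> allows for gaps, which arise because generators are added in arbitrary order;
  \<open>G\<close> carries along what was built before in disjoint variables.\<close>

lemma res_bound_path:
  assumes "res_bound k X n G" "inj_on u {a..a + l}" "u ` {a..a + l} \<subseteq> X"
    and "\<And>E i. E \<in> G \<Longrightarrow> a \<le> i \<Longrightarrow> i < a + l \<Longrightarrow> E \<inter> pair u i = {}"
    and "B \<subseteq> {a..<a + l}"
  shows "res_bound k X (n + path_pd l) (G \<union> pair u ` B)"
  using assms
proof (induction l arbitrary: n G B rule: less_induct)
  case (less l)
  show ?case
  proof (cases l)
    case 0
    then show ?thesis using less.prems by (simp add: path_pd_def)
  next
    case (Suc l0)
    let ?j = "a + l0"
    note inj = inj_on_eqD[OF less.prems(2)]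
    have sub: "inj_on u {a..a + l'}" "u ` {a..a + l'} \<subseteq> X" if "l' < l" for l'
      using that less.prems(2,3) by (auto intro: inj_on_subset)
    have disj: "E \<inter> pair u i = {}" if "E \<in> G" "a \<le> i" "i < a + l'" "l' < l" for E i l'
      using that less.prems(4)[of E i] by simp
    show ?thesis
    proof (cases "?j \<in> B")
      case False
      then have "B \<subseteq> {a..<a + l0}" using less.prems(5) Suc by (auto simp: less_Suc_eq)
      with Suc have "res_bound k X (n + path_pd l0) (G \<union> pair u ` B)"
        by (intro less.IH[OF _ less.prems(1) sub disj]) auto
      then show ?thesis using path_pd_mono[of l0 l] Suc by (auto intro: res_bound_mono)
    next
      case True
      define B' where "B' = B - {?j}"
      have B': "B' \<subseteq> {a..<a + l0}" using less.prems(5) Suc by (auto simp: less_Suc_eq B'_def)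
      have "path_pd l \<ge> 1" unfolding path_pd_eq Suc by simp
      then obtain N where N: "n + path_pd l = Suc N" by (cases "n + path_pd l") auto
      have "res_bound k X (n + path_pd l0) (G \<union> pair u ` B')"
        using Suc B' by (intro less.IH[OF _ less.prems(1) sub disj]) auto
      then have 1: "res_bound k X (Suc N) (G \<union> pair u ` B')"
        using path_pd_mono[of l0 l] Suc N by (auto intro: res_bound_mono)
      have G: "E - pair u ?j = E" if "E \<in> G" for E using less.prems(4)[OF that, of ?j] Suc by auto
      have far: "pair u i - pair u ?j = pair u i" if "i \<in> B'" "Suc i \<noteq> ?j" for i
      proof -
        have "i < ?j" "a \<le> i" using that B' by auto
        then have "u i \<noteq> u ?j" "u (Suc i) \<noteq> u ?j" "u i \<noteq> u (Suc ?j)" "u (Suc i) \<noteq> u (Suc ?j)"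
          using that Suc by (simp_all add: inj)
        then show ?thesis by (auto simp: pair_def)
      qed
      have "res_bound k X N ((\<lambda>E. E - pair u ?j) ` (G \<union> pair u ` B'))"
      proof (cases "\<exists>i\<in>B'. Suc i = ?j")
        case False
        then have "B' \<subseteq> {a..<a + (l0 - 1)}" using B' by force
        then have "res_bound k X (n + path_pd (l0 - 1)) (G \<union> pair u ` B')"
          using Suc by (intro less.IH[OF _ less.prems(1) sub disj]) auto
        moreover have "path_pd (l0 - 1) + 1 \<le> path_pd l" unfolding path_pd_eq Suc by (cases l0) auto
        ultimately have "res_bound k X N (G \<union> pair u ` B')" using N by (auto intro: res_bound_mono)
        moreover have "E - pair u ?j = E" if "E \<in> G \<union> pair u ` B'" for E
          using that G far False by (elim UnE imageE) simp_all
        then have "(\<lambda>E. E - pair u ?j) ` (G \<union> pair u ` B') = G \<union> pair u ` B'"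
          by simp
        ultimately show ?thesis by simp
      next
        case True
        then obtain i where i: "i \<in> B'" "Suc i = ?j" by blast
        then have ai: "a \<le> i" "l0 \<ge> 1" "i = a + l0 - 1" using B' by auto
        have "u i \<notin> pair u ?j" using i ai Suc by (auto simp: pair_def inj)
        then have pi: "pair u i - pair u ?j = {u i}" using i by (auto simp: pair_def)
        have v: "u i \<notin> E" if "E \<in> G" for E
          using less.prems(4)[OF that, of i] ai Suc by (auto simp: pair_def)
        then have G': "res_bound k X (Suc n) (insert {u i} G)"
          using less.prems(1,3) ai Suc by (intro res_bound_var) auto
        have "res_bound k X (Suc n + path_pd (l0 - 2))
          (insert {u i} G \<union> pair u ` (B' \<inter> {a..<a + (l0 - 2)}))"
        proof (rule less.IH[OF _ G' sub])
          show "E \<inter> pair u i' = {}" if "E \<in> insert {u i} G" "a \<le> i'" "i' < a + (l0 - 2)" for E i'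
          proof (cases "E = {u i}")
            case True
            then show ?thesis using that ai Suc by (auto simp: pair_def inj)
          qed (use that disj[of E i' "l0 - 2"] Suc in auto)
        qed (use Suc in auto)
        moreover have "Suc (path_pd (l0 - 2)) + 1 \<le> path_pd l"
        \<comment> \<open>For \<open>l0 = 1\<close> the subtraction \<open>l0 - 2\<close> is
          truncated; no edge precedes \<open>i\<close>, and both sides equal 2.\<close>
        proof (cases "l0 = 1")
          case True
          then show ?thesis unfolding path_pd_eq Suc by simp
        next
          case False
          then obtain m where m: "l0 = m + 2" using ai(2) nat_le_iff_add[of 2 l0] by auto
          show ?thesis unfolding path_pd_eq Suc m by simp
        qed
        ultimately have "res_bound k X N (insert {u i} G \<union> pair u ` (B' \<inter> {a..<a + (l0 - 2)}))"
          using N by (auto intro: res_bound_mono)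
        then show ?thesis
        proof (rule res_bound_cong)
          fix E assume E: "E \<in> insert {u i} G \<union> pair u ` (B' \<inter> {a..<a + (l0 - 2)})"
          have "E \<in> (\<lambda>E. E - pair u ?j) ` (G \<union> pair u ` B')"
          proof -
            consider "E = {u i}" | "E \<in> G" | i' where "E = pair u i'" "i' \<in> B'" "i' < a + (l0 - 2)"
              using E by auto
            then show ?thesis
            proof cases
              case 1
              then show ?thesis using i(1) pi by (intro image_eqI[of _ _ "pair u i"]) auto
            next
              case 2
              then show ?thesis using G by (intro image_eqI[of _ _ E]) auto
            next
              case 3
              then show ?thesis using far[of i'] ai by (intro image_eqI[of _ _ "pair u i'"]) auto
            qed
          qed
          then show "\<exists>E'\<in>(\<lambda>E. E - pair u ?j) ` (G \<union> pair u ` B'). E' \<subseteq> E" by blast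
        next
          fix E assume "E \<in> (\<lambda>E. E - pair u ?j) ` (G \<union> pair u ` B')"
          then consider D where "D \<in> G" "E = D - pair u ?j" | i' where "i' \<in> B'" "E = pair u i' - pair u ?j"
            by auto
          then show "\<exists>E'\<in>insert {u i} G \<union> pair u ` (B' \<inter> {a..<a + (l0 - 2)}). E' \<subseteq> E"
          proof cases
            case 1
            then show ?thesis using G by auto
          next
            case 2
            then have i': "a \<le> i'" "i' < a + l0" using B' by auto
            consider "i' = i" | "Suc i' = i" | "i' < a + (l0 - 2)" using i' ai by linarith
            then show ?thesis
            proof cases
              case 1
              then show ?thesis using 2 pi by auto
            next
              case b: 2
              then have "E = pair u i'" using 2 far[of i'] i by auto
              then show ?thesis using b by (auto simp: pair_def)
            next
              case 3
              then have "Suc i' \<noteq> ?j" using i ai by linarith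
              then have "E = pair u i'" using 2 far[of i'] by simp
              then show ?thesis using 2 3 i' by auto
            qed
          qed
        qed
      qed
      then have "res_bound k X (Suc N) (insert (pair u ?j) (G \<union> pair u ` B'))"
        using 1 less.prems(3) Suc by (intro res_bound_cone) (auto simp: pair_def)
      moreover have "insert (pair u ?j) (G \<union> pair u ` B') = G \<union> pair u ` B"
        using True by (auto simp: B'_def)
      ultimately show ?thesis using N by simp
    qed
  qed
qed

text \<open>Deleting the first (\<open>P\<close>) or last (\<open>Q\<close>) vertex of a path turns the edge at that end into a
  single variable, which makes the next edge redundant.\<close>

lemma res_bound_path_trim:
  assumes G: "res_bound k X n G" and u: "inj_on u {a..a + l}" "u ` {a..a + l} \<subseteq> X"
    and disj: "\<And>E i. E \<in> G \<Longrightarrow> i \<in> {a..a + l} \<Longrightarrow> u i \<notin> E"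
    and B: "B \<subseteq> {a..<a + l}" and Z: "\<And>i. i \<in> {a..a + l} \<Longrightarrow> u i \<in> Z \<longleftrightarrow> P \<and> i = a \<or> Q \<and> i = a + l"
    and l: "\<not> (P \<and> Q \<and> l \<le> 1)"
    and p: "p = of_bool (P \<and> a \<in> B)" and q: "q = of_bool (Q \<and> (\<exists>i\<in>B. Suc i = a + l))"
  shows "res_bound k X (n + p + q + path_pd (l - (if P then Suc p else 0) - (if Q then Suc q else 0)))
    (G \<union> (\<lambda>i. pair u i - Z) ` B)"
proof -
  let ?s = "if P then Suc p else 0" and ?e = "if Q then Suc q else 0"
  let ?l = "l - ?s - ?e"
  note inj = inj_on_eqD[OF u(1)]
  \<comment> \<open>The variables left over from the shortened end edges. For \<open>l = 2\<close>
    with both ends shortened they coincide, and the bound counts this variable twice.\<close>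
  define V where "V = (if p = 1 then {{u (Suc a)}} else {}) \<union> (if q = 1 then {{u (a + l - 1)}} else {})"
  have p1: "p = 0 \<or> p = 1" "q = 0 \<or> q = 1" by (simp_all add: p q)
  have pq: "p = 1 \<longleftrightarrow> P \<and> a \<in> B" "q = 1 \<longleftrightarrow> Q \<and> (\<exists>i\<in>B. Suc i = a + l)" by (simp_all add: p q)
  have l1: "l \<ge> 1" if "p = 1 \<or> q = 1"
  proof -
    have "B \<noteq> {}" using that pq by auto
    then show ?thesis using B by (cases l) auto
  qed
  have G1: "res_bound k X (n + p) (G \<union> (if p = 1 then {{u (Suc a)}} else {}))"
  proof (cases "p = 1")
    case True
    then have "res_bound k X (Suc n) (insert {u (Suc a)} G)"
      using G u(2) l1 disj[of _ "Suc a"] by (intro res_bound_var) (auto simp: image_subset_iff)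
    then show ?thesis using True by simp
  qed (use p1 G in auto)
  have V: "res_bound k X (n + p + q) (G \<union> V)"
  proof (cases "q = 1")
    case True
    have "a + l - 1 \<in> {a..a + l}" using l1 True by auto
    then have "res_bound k X (Suc (n + p)) (insert {u (a + l - 1)} (G \<union> (if p = 1 then {{u (Suc a)}} else {})))"
      using G1 u(2) disj[of _ "a + l - 1"] by (intro res_bound_var) (auto split: if_splits)
    then show ?thesis using True by (simp add: V_def)
  qed (use p1 G1 in \<open>auto simp: V_def\<close>)
  have "res_bound k X (n + p + q + path_pd ?l) ((G \<union> V) \<union> pair u ` (B \<inter> {a + ?s..<a + ?s + ?l}))"
  proof (cases "?l = 0")
    case True
    then show ?thesis using V by (simp add: path_pd_def)
  next
    case False
    then have "?s + ?l \<le> l" by linarith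
    then have sub: "{a + ?s..a + ?s + ?l} \<subseteq> {a..a + l}"
      by (intro atLeastatMost_subset_iff[THEN iffD2]) linarith
    show ?thesis
    proof (rule res_bound_path[OF V])
      show "inj_on u {a + ?s..a + ?s + ?l}" by (rule inj_on_subset[OF u(1) sub])
      show "u ` {a + ?s..a + ?s + ?l} \<subseteq> X" by (rule order_trans[OF image_mono[OF sub] u(2)])
      show "E \<inter> pair u i = {}" if "E \<in> G \<union> V" "a + ?s \<le> i" "i < a + ?s + ?l" for E i
      proof -
        have i: "i \<in> {a..a + l}" "Suc i \<in> {a..a + l}" using that(2,3) by (auto split: if_splits)
        show ?thesis
        proof (cases "E \<in> G")
          case True
          then show ?thesis using disj i by (auto simp: pair_def)
        next
          case False
          then have "p = 1 \<and> E = {u (Suc a)} \<or> q = 1 \<and> E = {u (a + l - 1)}"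
            using that(1) by (auto simp: V_def split: if_splits)
          then show ?thesis
            using that(2,3) i l1 pq by (auto simp: pair_def inj split: if_splits)
        qed
      qed
    qed auto
  qed
  then show ?thesis
  proof (rule res_bound_cong)
    have keep: "pair u i - Z = pair u i" if "i \<in> B" "\<not> (P \<and> i = a)" "\<not> (Q \<and> Suc i = a + l)" for i
      using that B Z[of i] Z[of "Suc i"] by (auto simp: pair_def)
    have first: "pair u a - Z = {u (Suc a)}" if "p = 1"
      using that l l1 Z[of a] Z[of "Suc a"] pq by (auto simp: pair_def)
    have last: "pair u i - Z = {u i}" "i = a + l - 1" if "q = 1" "i \<in> B" "Suc i = a + l" for i
      using that l l1 Z[of i] Z[of "Suc i"] pq B by (auto simp: pair_def)
    {
      fix E assume "E \<in> (G \<union> V) \<union> pair u ` (B \<inter> {a + ?s..<a + ?s + ?l})"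
      then consider "E \<in> G" | "p = 1" "E = {u (Suc a)}" | "q = 1" "E = {u (a + l - 1)}"
        | i where "i \<in> B" "E = pair u i"
        by (auto simp: V_def split: if_splits)
      then show "\<exists>E'\<in>G \<union> (\<lambda>i. pair u i - Z) ` B. E' \<subseteq> E"
      proof cases
        case 2
        then show ?thesis using first pq(1) by (intro bexI[of _ "pair u a - Z"]) auto
      next
        case 3
        then obtain i where "i \<in> B" "Suc i = a + l" using pq by (auto split: if_splits)
        then show ?thesis using last[of i] 3 by (intro bexI[of _ "pair u i - Z"]) auto
      qed auto
    next
      fix E assume "E \<in> G \<union> (\<lambda>i. pair u i - Z) ` B"
      then consider "E \<in> G" | i where "i \<in> B" "E = pair u i - Z" by auto
      then show "\<exists>E'\<in>(G \<union> V) \<union> pair u ` (B \<inter> {a + ?s..<a + ?s + ?l}). E' \<subseteq> E"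
      proof cases
        case 2
        have i: "a \<le> i" "i < a + l" using 2 B by auto
        consider "P" "i = a" | "Q" "Suc i = a + l" | "\<not> (P \<and> i = a)" "\<not> (Q \<and> Suc i = a + l)" by blast
        then show ?thesis
        proof cases
          case 1
          then have "p = 1" using 2 pq by simp
          then show ?thesis using 1 2 first by (auto simp: V_def)
        next
          case b: 2
          then have "q = 1" using 2 pq by auto
          then show ?thesis using last[OF _ 2(1) b(2)] 2 by (auto simp: V_def)
        next
          case 3
          then have E: "E = pair u i" using keep 2 by simp
          \<comment> \<open>An edge adjacent to a shortened one contains the variable left there and
            is redundant; every other edge lies in the remaining segment.\<close>
          have "p = 1 \<and> i = Suc a \<or> q = 1 \<and> Suc i = a + l - 1 \<or> i \<in> {a + ?s..<a + ?s + ?l}"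
            using 3 i p1 unfolding atLeastLessThan_iff 
            by (cases P; cases Q; (simp; fail | auto; fail | (simp, linarith) | (simp, presburger) | (auto, linarith+) | smt (verit)))
          then consider "p = 1" "i = Suc a" | "q = 1" "Suc i = a + l - 1" | "i \<in> {a + ?s..<a + ?s + ?l}"
            by blast
          then show ?thesis
          proof cases
            case 1
            then show ?thesis using E by (auto simp: V_def pair_def)
          next
            case b: 2
            then show ?thesis using E by (auto simp: V_def pair_def)
          next
            case 3
            then show ?thesis using E 2 by auto
          qed
        qed
      qed auto
    }
  qed
qed

text \<open>All generators indexed by \<open>A\<close> contain \<open>W\<close>, so division by one
  of them removes \<open>W\<close> from the others and leaves the colon ideals of the bare
  \<open>f j\<close>. These are bounded for every \<open>B\<close>, as no order on \<open>A\<close>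
  is prescribed.\<close>

lemma res_bound_build:
  assumes "finite A" "res_bound k X (Suc N) (f ` U)"
    and "\<And>i B. i \<in> A \<Longrightarrow> B \<subseteq> U \<union> A - {i} \<Longrightarrow> res_bound k X N ((\<lambda>j. f j - f i) ` B)"
    and f: "\<And>j. j \<in> U \<union> A \<Longrightarrow> f j \<inter> W = {} \<and> finite (f j) \<and> f j \<subseteq> X" and W: "finite W" "W \<subseteq> X"
    and "U \<inter> A = {}"
  shows "res_bound k X (Suc N) ((\<lambda>j. f j \<union> (if j \<in> A then W else {})) ` (U \<union> A))"
proof -
  let ?F = "\<lambda>j. f j \<union> (if j \<in> A then W else {})"
  have "res_bound k X (Suc N) (?F ` (U \<union> A'))" if "finite A'" "A' \<subseteq> A" for A'
    using that
  proof (induction A' rule: finite_induct)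
    case empty
    have "?F ` U = f ` U" using assms(7) by (intro image_cong) auto
    then show ?case using assms(2) by simp
  next
    case (insert i A')
    have "(\<lambda>E. E - ?F i) ` ?F ` (U \<union> A') = (\<lambda>j. f j - f i) ` (U \<union> A')"
      unfolding image_image
    proof (rule image_cong)
      fix j assume "j \<in> U \<union> A'"
      then show "?F j - ?F i = f j - f i" using f[of j] f[of i] insert.prems by auto
    qed simp
    moreover have "res_bound k X N ((\<lambda>j. f j - f i) ` (U \<union> A'))"
      using assms(3)[of i "U \<union> A'"] insert assms(7) by auto
    ultimately have "res_bound k X (Suc N) (insert (?F i) (?F ` (U \<union> A')))"
      using insert f[of i] W by (intro res_bound_cone) auto
    then show ?case by simp
  qed
  then show ?thesis using assms(1) by blast
qed

text \<open>The monomial of the vertex with index \<open>i\<close>, where \<open>A\<close> marks the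
  vertices of the added edge and \<open>W\<close> holds its variable; with empty \<open>W\<close>
  this is the bare string or cycle.\<close>

definition flagged :: "nat set \<Rightarrow> 'x set \<Rightarrow> (nat \<Rightarrow> 'x) \<Rightarrow> nat \<Rightarrow> 'x set" where
  "flagged A W u i = pair u i \<union> (if i \<in> A then W else {})"

definition sqfree_pd :: "'k::field itself \<Rightarrow> 'x set \<Rightarrow> 'x set set \<Rightarrow> enat" where
  "sqfree_pd _ X G = proj_dim (poly_ring X) (quotient_module (poly_ring X)
    (sqfree_ideal X G :: (('x \<Rightarrow>\<^sub>0 nat) \<Rightarrow>\<^sub>0 'k) set))"

lemma sqfree_pd_le: "res_bound TYPE('k::field) X n G \<Longrightarrow> sqfree_pd TYPE('k) X G \<le> enat n"
  unfolding sqfree_pd_def by (rule proj_dim_le_res_bound)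

lemma pd_sqfree: "finite H \<Longrightarrow> pd TYPE('k::field) V H = sqfree_pd TYPE('k) H (vertex_edges H ` V)"
  by (simp add: pd_def sqfree_pd_def hypergraph_ideal_sqfree)

text \<open>The cost of a segment of \<open>l\<close> edges that loses one end vertex,
  \<open>q\<close> telling whether its end edge is present. The bound is two thirds of
  \<open>l\<close> rounded to the nearest integer.\<close>

lemma path_pd_trim:
  assumes "q \<le> 1" "q = 1 \<Longrightarrow> l \<ge> 1"
  shows "q + path_pd (l - Suc q) \<le> (2 * l + 1) div 3"
proof -
  consider "q = 0" "l = 0" | m where "q = 0" "l = Suc m" | "q = 1" "l = 1" | m where "q = 1" "l = m + 2"
  proof (cases "q = 0")
    case True
    then show ?thesis using that by (cases l) auto
  next
    case False
    then have "q = 1" "l \<ge> 1" using assms by auto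
    then show ?thesis using that(3) that(4)[of "l - 2"] by (cases "l = 1") auto
  qed
  then show ?thesis by cases (simp_all add: path_pd_eq)
qed

lemma string_pd_le:
  assumes u: "inj_on u {..\<mu>}" "u ` {..\<mu>} \<subseteq> X"
  shows "sqfree_pd TYPE('k::field) X (pair u ` {..<\<mu>}) \<le> enat (path_pd \<mu>)"
proof -
  have "res_bound TYPE('k) X (0 + path_pd \<mu>) ({} \<union> pair u ` {..<\<mu>})"
    by (rule res_bound_path[OF res_bound_empty, of _ 0]) (use u in \<open>auto simp: atLeast0AtMost\<close>)
  then show ?thesis using sqfree_pd_le by auto
qed

text \<open>Division by the generator of index \<open>i\<close> cuts the string into segments of
  \<open>i\<close> and \<open>\<mu> - Suc i\<close> edges, each trimmed at the cut. The two rounded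
  costs add up to at most \<open>path_pd \<mu>\<close>, and the generator itself contributes the
  additional one.\<close>

lemma string_pd_add_le:
  assumes u: "inj_on u {..\<mu>}" "u ` {..\<mu>} \<subseteq> X" and W: "finite W" "W \<subseteq> X" "W \<inter> u ` {..\<mu>} = {}"
    and A: "A \<subseteq> {..<\<mu>}"
  shows "sqfree_pd TYPE('k::field) X (flagged A W u ` {..<\<mu>}) \<le> enat (path_pd \<mu> + 1)"
proof -
  let ?U = "{..<\<mu>} - A" and ?k = "TYPE('k)"
  note inj = inj_on_eqD[OF u(1)]
  have "res_bound ?k X (Suc (path_pd \<mu>)) ((\<lambda>j. pair u j \<union> (if j \<in> A then W else {})) ` (?U \<union> A))"
  proof (rule res_bound_build)
    have "res_bound ?k X (0 + path_pd \<mu>) ({} \<union> pair u ` ?U)"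
      by (rule res_bound_path[OF res_bound_empty, of _ 0]) (use u in \<open>auto simp: atLeast0AtMost\<close>)
    then show "res_bound ?k X (Suc (path_pd \<mu>)) (pair u ` ?U)" by (auto intro: res_bound_mono)
    show "finite A" using A finite_subset by blast
    show "pair u j \<inter> W = {} \<and> finite (pair u j) \<and> pair u j \<subseteq> X" if "j \<in> ?U \<union> A" for j
    proof -
      have "j \<le> \<mu>" "Suc j \<le> \<mu>" using that A by auto
      then show ?thesis using u(2) W(3) by (auto simp: pair_def)
    qed
    fix i B assume i: "i \<in> A" and B: "B \<subseteq> ?U \<union> A - {i}"
    have i\<mu>: "i < \<mu>" and B\<mu>: "B \<subseteq> {..<\<mu>} - {i}" using i B A by auto
    let ?Z = "pair u i" and ?L = "B \<inter> {..<i}" and ?R = "B \<inter> {Suc i..<\<mu>}"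
    define q where "q = (of_bool (\<exists>j\<in>?L. Suc j = 0 + i) :: nat)"
    define p where "p = (of_bool (Suc i \<in> ?R) :: nat)"
    have L: "res_bound ?k X (0 + 0 + q + path_pd (i - 0 - Suc q)) ({} \<union> (\<lambda>j. pair u j - ?Z) ` ?L)"
    proof -
      have sub: "{0..0 + i} \<subseteq> {..\<mu>}" using i\<mu> by auto
      have "res_bound ?k X (0 + 0 + q + path_pd (i - (if False then Suc 0 else 0) - (if True then Suc q else 0)))
        ({} \<union> (\<lambda>j. pair u j - ?Z) ` ?L)"
      proof (rule res_bound_path_trim[OF res_bound_empty])
        show "inj_on u {0..0 + i}" by (rule inj_on_subset[OF u(1) sub])
        show "u ` {0..0 + i} \<subseteq> X" by (rule order_trans[OF image_mono[OF sub] u(2)])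
        show "u j \<in> ?Z \<longleftrightarrow> False \<and> j = 0 \<or> True \<and> j = 0 + i" if "j \<in> {0..0 + i}" for j
          using that i\<mu> by (auto simp: pair_def inj)
      qed (auto simp: q_def)
      then show ?thesis by simp
    qed
    have "res_bound ?k X (0 + 0 + q + path_pd (i - 0 - Suc q) + p + 0 + path_pd (\<mu> - Suc i - Suc p - 0))
      (({} \<union> (\<lambda>j. pair u j - ?Z) ` ?L) \<union> (\<lambda>j. pair u j - ?Z) ` ?R)"
    proof -
      have sub: "{Suc i..Suc i + (\<mu> - Suc i)} \<subseteq> {..\<mu>}" using i\<mu> by auto
      have "res_bound ?k X (0 + 0 + q + path_pd (i - 0 - Suc q) + p + 0 +
          path_pd (\<mu> - Suc i - (if True then Suc p else 0) - (if False then Suc 0 else 0)))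
        (({} \<union> (\<lambda>j. pair u j - ?Z) ` ?L) \<union> (\<lambda>j. pair u j - ?Z) ` ?R)"
      proof (rule res_bound_path_trim[OF L])
        show "inj_on u {Suc i..Suc i + (\<mu> - Suc i)}" by (rule inj_on_subset[OF u(1) sub])
        show "u ` {Suc i..Suc i + (\<mu> - Suc i)} \<subseteq> X" by (rule order_trans[OF image_mono[OF sub] u(2)])
        show "u j \<notin> E" if "E \<in> {} \<union> (\<lambda>j. pair u j - ?Z) ` ?L" "j \<in> {Suc i..Suc i + (\<mu> - Suc i)}" for E j
          using that i\<mu> by (auto simp: pair_def inj)
        show "u j \<in> ?Z \<longleftrightarrow> True \<and> j = Suc i \<or> False \<and> j = Suc i + (\<mu> - Suc i)"
          if "j \<in> {Suc i..Suc i + (\<mu> - Suc i)}" for j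
          using that i\<mu> by (auto simp: pair_def inj)
      qed (auto simp: p_def)
      then show ?thesis by simp
    qed
    moreover have "({} \<union> (\<lambda>j. pair u j - ?Z) ` ?L) \<union> (\<lambda>j. pair u j - ?Z) ` ?R = (\<lambda>j. pair u j - ?Z) ` B"
    proof -
      have "?L \<union> ?R = B" using B\<mu> by auto
      then show ?thesis by (simp only: image_Un[symmetric] Un_empty_left)
    qed
    moreover have "0 + 0 + q + path_pd (i - 0 - Suc q) + p + 0 + path_pd (\<mu> - Suc i - Suc p - 0) \<le> path_pd \<mu>"
    proof -
      have "q + path_pd (i - Suc q) \<le> (2 * i + 1) div 3"
      proof (rule path_pd_trim)
        assume "q = 1"
        then have "\<exists>j\<in>?L. Suc j = 0 + i" by (simp add: q_def del: One_nat_def)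
        then show "1 \<le> i" by auto
      qed (simp add: q_def)
      moreover have "p + path_pd (\<mu> - Suc i - Suc p) \<le> (2 * (\<mu> - Suc i) + 1) div 3"
      proof (rule path_pd_trim)
        assume "p = 1"
        then have "Suc i \<in> ?R" by (simp add: p_def del: One_nat_def)
        then show "1 \<le> \<mu> - Suc i" by auto
      qed (simp add: p_def)
      moreover have "(2 * i + 1) div 3 + (2 * (\<mu> - Suc i) + 1) div 3 \<le> (2 * \<mu> + 2) div 3"
      proof -
        obtain m where "\<mu> = Suc i + m" using i\<mu> less_iff_Suc_add[of i \<mu>] by auto
        moreover have "(2 * i + 1) div 3 + (2 * m + 1) div 3 \<le> (2 * (Suc i + m) + 2) div 3" by presburger
        ultimately show ?thesis by simp
      qed
      ultimately show ?thesis by (simp add: path_pd_eq[of \<mu>])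
    qed
    ultimately show "res_bound ?k X (path_pd \<mu>) ((\<lambda>j. pair u j - pair u i) ` B)"
      by (metis res_bound_mono)
  qed (use W A in auto)
  moreover have "?U \<union> A = {..<\<mu>}" using A by auto
  ultimately show ?thesis using sqfree_pd_le by (simp add: flagged_def[abs_def])
qed

text \<open>Enumerates the indices 0, 2, 3, 5, 6, 8, ... that are not congruent to 1 modulo
  3.\<close>

definition cover :: "nat \<Rightarrow> nat" where
  "cover v = 3 * (v div 2) + 2 * (v mod 2)"

lemma inj_cover: "inj cover"
proof (rule inj_on_inverseI)
  show "2 * (cover v div 3) + (cover v mod 3) div 2 = v" for v
  proof -
    have "v mod 2 = 0 \<or> v mod 2 = 1" by presburger
    then have "cover v div 3 = v div 2" "(cover v mod 3) div 2 = v mod 2" unfolding cover_def by auto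
    then show ?thesis by simp
  qed
qed

text \<open>The height of a large minimal prime, as a lower bound: every third variable is inverted.\<close>

lemma sqfree_pd_ge_cover:
  assumes inj: "inj_on u {..<n}" and X: "u ` {..<n} \<subseteq> X" and W: "finite W" "W \<subseteq> X" "W \<inter> u ` {..<n} = {}"
    and N: "\<And>v. v < N \<Longrightarrow> cover v < n"
    and kill: "\<And>v. v < N \<Longrightarrow> 3 * (v div 2) + 1 < n \<and> 3 * (v div 2) + v mod 2 < m"
    and free: "\<And>i. i < m \<Longrightarrow> \<exists>j<n. (u i = u j \<or> u (Suc i) = u j) \<and> j mod 3 \<noteq> 1"
  shows "enat N \<le> sqfree_pd TYPE('k::field) X (flagged A W u ` {..<m})"
proof -
  let ?Y = "W \<union> u ` {j. j < n \<and> j mod 3 = 1}"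
  \<comment> \<open>The case \<open>k = 0\<close>: zigzags and facets are empty, and the Koszul
    cycle has a single term.\<close>
  have "enat (N - 0) \<le> sqfree_pd TYPE('k) X (flagged A W u ` {..<m})"
    unfolding sqfree_pd_def
  proof (rule proj_dim_sqfree_ge[where c = "\<lambda>v. u (cover v)" and Y = ?Y])
    show "inj_on (\<lambda>v. u (cover v)) {..<N}"
    proof -
      have "inj_on cover {..<N}" by (rule inj_on_subset[OF inj_cover subset_UNIV])
      moreover have "inj_on u (cover ` {..<N})" by (rule inj_on_subset[OF inj]) (use N in auto)
      ultimately show ?thesis using comp_inj_on[of cover "{..<N}" u] by (simp add: o_def)
    qed
    show "(\<lambda>v. u (cover v)) ` {..<N} \<subseteq> X" using N X by auto
    show "finite ?Y" "?Y \<subseteq> X" using W X by auto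
    show "\<exists>E\<in>flagged A W u ` {..<m}. E \<subseteq> ?Y \<union> (\<lambda>v. u (cover v)) ` insert v (zigzag 0 t)" if v: "v < N" for t v
    proof -
      \<comment> \<open>The edge that joins \<open>u (cover v)\<close> to its inverted neighbour
        \<open>u (3 * (v div 2) + 1)\<close>.\<close>
      let ?i = "3 * (v div 2) + v mod 2"
      have "?i < m" "3 * (v div 2) + 1 < n" using kill[OF v] by auto
      moreover have "flagged A W u ?i \<subseteq> ?Y \<union> {u (cover v)}"
      proof -
        have "(3 * (v div 2) + 1) mod 3 = 1" by presburger
        then have "u (3 * (v div 2) + 1) \<in> ?Y" using kill[OF v] by blast
        moreover have "v mod 2 = 0 \<or> v mod 2 = 1" by presburger
        ultimately show ?thesis by (auto simp: flagged_def pair_def cover_def)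
      qed
      ultimately show ?thesis by (intro bexI[of _ "flagged A W u ?i"]) auto
    qed
    show "\<not> E \<subseteq> ?Y \<union> (\<lambda>v. u (cover v)) ` cross 0 B" if E: "E \<in> flagged A W u ` {..<m}" for B E
    proof
      assume sub: "E \<subseteq> ?Y \<union> (\<lambda>v. u (cover v)) ` cross 0 B"
      obtain i where i: "i < m" "E = flagged A W u i" using E by auto
      obtain j where j: "j < n" "u i = u j \<or> u (Suc i) = u j" "j mod 3 \<noteq> 1" using free[OF i(1)] by blast
      have "cross 0 B = {}" by (auto simp: in_cross)
      then have "E \<subseteq> ?Y" using sub by simp
      moreover have "u i \<in> E \<and> u (Suc i) \<in> E" by (simp add: i(2) flagged_def pair_def)
      then have "u j \<in> E" using j(2) by auto
      ultimately have "u j \<in> ?Y" by (rule subsetD)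
      moreover have "u j \<notin> W" using W(3) j(1) by blast
      ultimately obtain j' where "j' < n" "j' mod 3 = 1" "u j = u j'" by blast
      then show False using inj_on_eqD[OF inj, of j j'] j by simp
    qed
  qed auto
  then show ?thesis by simp
qed

text \<open>Inverted indices are never consecutive, so no edge becomes a unit; and each
  \<open>cover v\<close> with \<open>v < path_pd \<mu>\<close> has its inverted neighbour on the
  string.\<close>

lemma string_pd_ge:
  assumes u: "inj_on u {..\<mu>}" "u ` {..\<mu>} \<subseteq> X" and W: "finite W" "W \<subseteq> X" "W \<inter> u ` {..\<mu>} = {}"
  shows "enat (path_pd \<mu>) \<le> sqfree_pd TYPE('k::field) X (flagged A W u ` {..<\<mu>})"
proof (rule sqfree_pd_ge_cover)
  show "inj_on u {..<Suc \<mu>}" "u ` {..<Suc \<mu>} \<subseteq> X" "W \<inter> u ` {..<Suc \<mu>} = {}"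
    using u W by (simp_all add: lessThan_Suc_atMost)
  show "cover v < Suc \<mu>" "3 * (v div 2) + 1 < Suc \<mu> \<and> 3 * (v div 2) + v mod 2 < \<mu>" if "v < path_pd \<mu>" for v
  proof -
    obtain a b where ab: "v div 2 = a" "v mod 2 = b" by blast
    then have v: "v = 2 * a + b" and b: "b = 0 \<or> b = 1" by auto
    have "3 * (v + 1) \<le> 2 * \<mu> + 2" using that unfolding path_pd_eq by simp
    with v b show "cover v < Suc \<mu>" "3 * (v div 2) + 1 < Suc \<mu> \<and> 3 * (v div 2) + v mod 2 < \<mu>"
      unfolding cover_def ab by auto
  qed
  fix i assume "i < \<mu>"
  moreover have "i mod 3 \<noteq> 1 \<or> Suc i mod 3 \<noteq> 1" by presburger
  ultimately show "\<exists>j<Suc \<mu>. (u i = u j \<or> u (Suc i) = u j) \<and> j mod 3 \<noteq> 1"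
    by (metis Suc_less_eq less_SucI)
qed (use W in auto)

text \<open>The example of a string whose projective dimension grows: after inverting \<open>u\<^sub>1\<close> and \<open>u\<^sub>5\<close>
  the ideal becomes that of a 4-cycle on \<open>u\<^sub>2, u\<^sub>3, u\<^sub>4, y\<close> together with the variables \<open>u\<^sub>0, u\<^sub>6\<close>.\<close>

lemma string_6_pd_ge:
  assumes u: "inj_on u {..6}" "u ` {..6} \<subseteq> X" and y: "y \<in> X" "y \<notin> u ` {..6}"
  shows "enat 5 \<le> sqfree_pd TYPE('k::field) X (flagged {1, 4} {y} u ` {..<6})"
proof -
  \<comment> \<open>The independence complex of the 4-cycle has the two components
    \<open>{u 2, u 4}\<close> and \<open>{u 3, y}\<close>. In this order the zigzags for
    \<open>k = 1\<close> are the points \<open>u 4\<close> and \<open>u 2\<close> of the first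
    component, and the cross-polytope is the pair \<open>u 2\<close>, \<open>u 3\<close>, one point
    from each.\<close>
  let ?c = "(!) [u 2, u 3, u 4, y, u 0, u 6]" and ?Y = "{u 1, u 5}"
  let ?G = "flagged {1, 4} {y} u ` {..<6}"
  have six: "{..<6} = {0, 1, 2, 3, 4, 5 :: nat}" "{..6} = {0, 1, 2, 3, 4, 5, 6 :: nat}" by auto
  note inj = inj_on_eqD[OF u(1)]
  have ne: "u i \<noteq> y" if "i \<le> 6" for i using y(2) that by auto
  have zz: "zigzag 1 0 = {2}" "zigzag 1 1 = {0}" by (auto simp: zigzag_def select_def)
  have cr: "cross 1 B = {if 0 \<in> B then 1 else 0}" for B by (auto simp: cross_def select_def)
  have c: "?c 0 = u 2" "?c 1 = u 3" "?c 2 = u 4" "?c 3 = y" "?c 4 = u 0" "?c 5 = u 6" by simp_all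
  have G: "{u 0, u 1} \<in> ?G" "{u 1, u 2, y} \<in> ?G" "{u 2, u 3} \<in> ?G" "{u 3, u 4} \<in> ?G" "{u 4, u 5, y} \<in> ?G"
    "{u 5, u 6} \<in> ?G"
    unfolding six by (auto simp: flagged_def pair_def numeral_eq_Suc insert_commute)
  have "enat (6 - 1) \<le> sqfree_pd TYPE('k) X ?G"
    unfolding sqfree_pd_def
  proof (rule proj_dim_sqfree_ge[where c = ?c and Y = ?Y])
    show "inj_on ?c {..<6}"
      unfolding six by (auto simp: inj_on_def inj ne ne[symmetric] numeral_eq_Suc)
    show "?c ` {..<6} \<subseteq> X" 
    proof (rule image_subsetI)
      fix v :: nat assume "v \<in> {..<6}"
      then have "v = 0 \<or> v = 1 \<or> v = 2 \<or> v = 3 \<or> v = 4 \<or> v = 5" by auto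
      then show "?c v \<in> X" using u(2) y(1) by (elim disjE) (simp_all only: c, auto)
    qed
    show "?Y \<subseteq> X" using u(2) by auto
    show "\<exists>E\<in>?G. E \<subseteq> ?Y \<union> ?c ` insert v (zigzag 1 t)"
      if t: "t \<le> 1" and v: "v < 6" "v \<notin> zigzag 1 t" "\<not> (v = 3 * t \<and> t < 1)" "v + 1 \<noteq> 3 * t" for t v
    proof -
      have "t = 0 \<or> t = 1" "v = 0 \<or> v = 1 \<or> v = 2 \<or> v = 3 \<or> v = 4 \<or> v = 5" using t v by auto
      moreover have "\<exists>E\<in>?G. E \<subseteq> ?Y \<union> ?c ` insert 1 {2}"
        by (rule bexI[OF _ G(4)]) (simp only: image_insert c, blast)
      moreover have "\<exists>E\<in>?G. E \<subseteq> ?Y \<union> ?c ` insert 3 {2}"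
        by (rule bexI[OF _ G(5)]) (simp only: image_insert c, blast)
      moreover have "\<exists>E\<in>?G. E \<subseteq> ?Y \<union> ?c ` insert 1 {0}"
        by (rule bexI[OF _ G(3)]) (simp only: image_insert c, blast)
      moreover have "\<exists>E\<in>?G. E \<subseteq> ?Y \<union> ?c ` insert 3 {0}"
        by (rule bexI[OF _ G(2)]) (simp only: image_insert c, blast)
      moreover have "\<exists>E\<in>?G. E \<subseteq> ?Y \<union> ?c ` insert 4 S" for S
        by (rule bexI[OF _ G(1)]) (simp only: image_insert c, blast)
      moreover have "\<exists>E\<in>?G. E \<subseteq> ?Y \<union> ?c ` insert 5 S" for S
        by (rule bexI[OF _ G(6)]) (simp only: image_insert c, blast)
      moreover have "v \<noteq> 2 \<and> v \<noteq> 0" using \<open>t = 0 \<or> t = 1\<close> by (elim disjE) (use v zz in auto)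
      ultimately show ?thesis using zz by metis
    qed
    show "\<not> E \<subseteq> ?Y \<union> ?c ` cross 1 B" if EG: "E \<in> ?G" for B E
    proof -
      obtain i where "E = flagged {1, 4} {y} u i" "i < 6" using EG by blast
      moreover from this have "i = 0 \<or> i = 1 \<or> i = 2 \<or> i = 3 \<or> i = 4 \<or> i = 5" by auto
      ultimately have "u 0 \<in> E \<or> y \<in> E \<or> u 4 \<in> E \<or> u 6 \<in> E \<or> u 2 \<in> E \<and> u 3 \<in> E"
        by (elim disjE) (simp_all add: flagged_def pair_def)
      moreover have "?Y \<union> ?c ` cross 1 B = {u 1, u 5, if 0 \<in> B then u 3 else u 2}"
        unfolding cr using c by auto
      moreover have "u i \<noteq> u j" if "i \<in> {0, 2, 3, 4, 6}" "j \<in> {1, 2, 3, 5}" "i \<noteq> j" for i j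
        using that by (auto simp: inj)
      then have "u 0 \<notin> {u 1, u 5, u 2, u 3}" "u 4 \<notin> {u 1, u 5, u 2, u 3}" "u 6 \<notin> {u 1, u 5, u 2, u 3}"
        "u 2 \<notin> {u 1, u 5, u 3}" "u 3 \<notin> {u 1, u 5, u 2}" by simp_all
      moreover have "y \<notin> {u 1, u 5, u 2, u 3}" using ne[of 1] ne[of 2] ne[of 3] ne[of 5] by auto
      ultimately show ?thesis by (auto split: if_splits)
    qed
  qed auto
  then show ?thesis by simp
qed

text \<open>From \<open>\<mu> = 2\<close> on this is two thirds of \<open>\<mu>\<close> rounded to
  the nearest integer, which is the form used in the estimates.\<close>

definition cycle_pd :: "nat \<Rightarrow> nat" where
  "cycle_pd \<mu> = \<mu> - 1 - (\<mu> - 2) div 3"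

lemma cycle_pd_eq: "\<mu> \<ge> 2 \<Longrightarrow> cycle_pd \<mu> = (2 * \<mu> + 1) div 3"
proof -
  assume "\<mu> \<ge> 2"
  then obtain m where m: "\<mu> = m + 2" using le_Suc_ex[of 2 \<mu>] by auto
  have "cycle_pd \<mu> = Suc (path_pd m)" unfolding m cycle_pd_def path_pd_def by (simp add: Suc_diff_le)
  then show ?thesis unfolding m path_pd_eq by simp
qed

text \<open>The variables around the cycle are numbered by all natural numbers with period
  \<open>\<mu>\<close>, so that an arc is an interval and the lemmas on paths apply across the place
  where the numbering closes up.\<close>

locale periodic =
  fixes u :: "nat \<Rightarrow> 'x" and \<mu> :: nat and X :: "'x set" and W :: "'x set"
  assumes \<mu>: "\<mu> \<ge> 3" and period: "\<And>j. u (j + \<mu>) = u j" and inj: "inj_on u {..<\<mu>}"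
    and uX: "u ` {..<\<mu>} \<subseteq> X" and W: "finite W" "W \<subseteq> X" "W \<inter> u ` {..<\<mu>} = {}"
begin

lemma u_mod: "u j = u (j mod \<mu>)"
proof (induction j rule: less_induct)
  case (less j)
  show ?case
  proof (cases "j < \<mu>")
    case False
    then have "u j = u (j - \<mu>)" using period[of "j - \<mu>"] by simp
    also have "\<dots> = u ((j - \<mu>) mod \<mu>)" using False \<mu> by (intro less.IH) auto
    also have "(j - \<mu>) mod \<mu> = j mod \<mu>" using False by (simp add: le_mod_geq)
    finally show ?thesis .
  qed simp
qed

lemma pair_mod: "pair u j = pair u (j mod \<mu>)"
  unfolding pair_def using u_mod[of j] u_mod[of "Suc j"] u_mod[of "Suc (j mod \<mu>)"] by (simp add: mod_Suc_eq)

lemma u_in: "u j \<in> u ` {..<\<mu>}"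
  using u_mod[of j] \<mu> by auto

lemma u_eq_iff: "u i = u j \<longleftrightarrow> i mod \<mu> = j mod \<mu>"
  using u_mod[of i] u_mod[of j] inj_on_eqD[OF inj, of "i mod \<mu>" "j mod \<mu>"] \<mu> by auto

lemma u_eq_near: "u i = u j \<longleftrightarrow> i = j" if "i < j + \<mu>" "j < i + \<mu>" for i j
proof
  assume "u i = u j"
  then have eq: "i mod \<mu> = j mod \<mu>" by (simp add: u_eq_iff)
  show "i = j"
  proof (cases i j rule: le_cases)
    case le
    then have "\<mu> dvd j - i" using eq mod_eq_dvd_iff_nat[of i j \<mu>] by simp
    then show ?thesis using le that by (auto dest: dvd_imp_le)
  next
    case ge
    then have "\<mu> dvd i - j" using eq mod_eq_dvd_iff_nat[of j i \<mu>] by simp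
    then show ?thesis using ge that by (auto dest: dvd_imp_le)
  qed
qed simp

lemma window:
  assumes "i < \<mu>"
  shows "inj_on u {Suc i..Suc i + (\<mu> - 1)}" "u ` {Suc i..Suc i + (\<mu> - 1)} \<subseteq> X"
proof -
  show "inj_on u {Suc i..Suc i + (\<mu> - 1)}"
    by (rule inj_onI) (use u_eq_near \<mu> in auto)
  show "u ` {Suc i..Suc i + (\<mu> - 1)} \<subseteq> X" using u_in uX by blast
qed

text \<open>Cutting the cycle at edge \<open>i\<close> leaves a path from \<open>u (Suc i)\<close>
  to \<open>u (i + \<mu>)\<close>; edges with smaller index are moved up by one period.\<close>

lemma shift_window:
  assumes "i < \<mu>" "B \<subseteq> {..<\<mu>} - {i}"
  obtains B' where "B' \<subseteq> {Suc i..<Suc i + (\<mu> - 1)}" "pair u ` B = pair u ` B'"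
    "(\<lambda>j. pair u j - Z) ` B = (\<lambda>j. pair u j - Z) ` B'"
proof -
  let ?s = "\<lambda>j. if j < i then j + \<mu> else j"
  have "pair u (?s j) = pair u j" if "j \<in> B" for j
    using pair_mod[of "j + \<mu>"] pair_mod[of j] by simp
  then have "pair u ` B = pair u ` ?s ` B" "(\<lambda>j. pair u j - Z) ` B = (\<lambda>j. pair u j - Z) ` ?s ` B"
    unfolding image_image by (auto intro!: image_cong)
  moreover have "?s ` B \<subseteq> {Suc i..<Suc i + (\<mu> - 1)}"
  proof
    fix j' assume "j' \<in> ?s ` B"
    then obtain j where "j \<in> B" "j' = ?s j" by blast
    moreover from this have "j < \<mu>" "j \<noteq> i" using assms(2) by auto
    ultimately show "j' \<in> {Suc i..<Suc i + (\<mu> - 1)}" using assms(1) \<mu> by auto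
  qed
  ultimately show ?thesis by (intro that[of "?s ` B"])
qed

text \<open>Each division leaves one arc of \<open>\<mu> - 1\<close> edges trimmed at both ends, of
  cost at most \<open>cycle_pd \<mu> - 1\<close>. Since \<open>A\<close> is nonempty, the generators
  present at the start lie on a path, where the bound for paths applies.\<close>

lemma cycle_pd_le:
  assumes A: "A \<subseteq> {..<\<mu>}" "A \<noteq> {}" and "V \<subseteq> W"
  shows "sqfree_pd TYPE('k::field) X (flagged A V u ` {..<\<mu>}) \<le> enat (cycle_pd \<mu>)"
proof -
  let ?U = "{..<\<mu>} - A" and ?k = "TYPE('k)"
  define N where "N = cycle_pd \<mu> - 1"
  obtain m where m: "\<mu> = m + 3" using \<mu> le_Suc_ex[of 3 \<mu>] by auto
  have "cycle_pd \<mu> \<ge> 1" using cycle_pd_eq[of \<mu>] unfolding m by simp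
  then have N: "cycle_pd \<mu> = Suc N" by (simp add: N_def)
  have "res_bound ?k X (Suc N) ((\<lambda>j. pair u j \<union> (if j \<in> A then V else {})) ` (?U \<union> A))"
  proof (rule res_bound_build)
    obtain i where i: "i \<in> A" using A by blast
    then have i\<mu>: "i < \<mu>" using A by auto
    have "?U \<subseteq> {..<\<mu>} - {i}" using i by blast
    from shift_window[OF i\<mu> this]
    obtain U' where U': "U' \<subseteq> {Suc i..<Suc i + (\<mu> - 1)}" "pair u ` ?U = pair u ` U'" by metis
    have "res_bound ?k X (0 + path_pd (\<mu> - 1)) ({} \<union> pair u ` U')"
      by (rule res_bound_path[OF res_bound_empty window[OF i\<mu>]]) (use U' in auto)
    moreover have "path_pd (\<mu> - 1) \<le> cycle_pd \<mu>"
      using \<mu> cycle_pd_eq[of \<mu>] by (simp add: path_pd_eq div_le_mono diff_mult_distrib2)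
    ultimately show "res_bound ?k X (Suc N) (pair u ` ?U)" unfolding U'(2) using N by (auto intro: res_bound_mono)
    show "finite A" using A finite_subset by blast
    show "pair u j \<inter> V = {} \<and> finite (pair u j) \<and> pair u j \<subseteq> X" if "j \<in> ?U \<union> A" for j
      using u_in[of j] u_in[of "Suc j"] uX W(3) \<open>V \<subseteq> W\<close> unfolding pair_def by blast
    show "finite V" "V \<subseteq> X" using W \<open>V \<subseteq> W\<close> finite_subset by blast+
    fix i B assume i: "i \<in> A" and B: "B \<subseteq> ?U \<union> A - {i}"
    then have i\<mu>: "i < \<mu>" using A by auto
    let ?Z = "pair u i" and ?a = "Suc i" and ?l = "\<mu> - 1"
    have "B \<subseteq> {..<\<mu>} - {i}" using B A by auto
    from shift_window[OF i\<mu> this, of ?Z] obtain B' where B': "B' \<subseteq> {?a..<?a + ?l}"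
      "(\<lambda>j. pair u j - ?Z) ` B = (\<lambda>j. pair u j - ?Z) ` B'" by metis
    define p where "p = (of_bool (?a \<in> B') :: nat)"
    define q where "q = (of_bool (\<exists>j\<in>B'. Suc j = ?a + ?l) :: nat)"
    have Z: "u j \<in> ?Z \<longleftrightarrow> j = ?a \<or> j = ?a + ?l" if "j \<in> {?a..?a + ?l}" for j
      using that u_eq_near[of j "i + \<mu>"] u_eq_near[of j "Suc i"] period[of i] \<mu> by (auto simp: pair_def)
    have trim: "res_bound ?k X (0 + p + q + path_pd (?l - Suc p - Suc q)) ({} \<union> (\<lambda>j. pair u j - ?Z) ` B')"
      using res_bound_path_trim[OF res_bound_empty window[OF i\<mu>] _ B'(1), of ?Z True True p q ?k] Z \<mu>
      by (simp add: p_def q_def)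
    show "res_bound ?k X N ((\<lambda>j. pair u j - pair u i) ` B)"
    \<comment> \<open>For a triangle with both other edges present, each of these shrinks to the
      same variable \<open>u (i + 2)\<close>, which the general trimming bound would count
      twice.\<close>
    proof (cases "\<mu> = 3 \<and> p = 1 \<and> q = 1")
      case False
      have "p + q + path_pd (?l - Suc p - Suc q) \<le> N"
      proof -
        have pq: "p = 0 \<or> p = 1" "q = 0 \<or> q = 1" by (auto simp: p_def q_def)
        have Nm: "N = (2 * m + 4) div 3" using cycle_pd_eq[of "m + 3"] by (simp add: N_def m)
        have "path_pd m \<le> (2 * m + 4) div 3" unfolding path_pd_eq by (simp add: div_le_mono)
        moreover have "1 + path_pd (m - 1) \<le> (2 * m + 4) div 3"
          unfolding path_pd_eq by (cases m) (simp_all add: div_le_mono)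
        moreover have "2 + path_pd (m - 2) \<le> (2 * m + 4) div 3" if m1: "m \<ge> 1"
        proof (cases "m = 1")
          case False
          then obtain m' where "m = m' + 2" using m1 le_Suc_ex[of 2 m] by auto
          then show ?thesis unfolding path_pd_eq by simp
        qed (simp add: path_pd_eq)
        moreover have "\<mu> - 1 - Suc p - Suc q = m - (p + q)" unfolding m by simp
        moreover have "p + q = 0 \<or> p + q = 1 \<or> p + q = 2 \<and> m \<ge> 1" using pq False m by auto
        ultimately show ?thesis unfolding Nm by (elim disjE) auto
      qed
      then show ?thesis unfolding B'(2) using trim by (auto intro: res_bound_mono)
    next
      case True
      have "(\<lambda>j. pair u j - ?Z) ` B' \<subseteq> {{u (i + 2)}}"
      proof
        fix E assume "E \<in> (\<lambda>j. pair u j - ?Z) ` B'"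
        then obtain j where j: "j \<in> B'" "E = pair u j - ?Z" by blast
        then have "j = i + 1 \<or> j = i + 2" using B' True by auto
        moreover have "u (i + 3) = u i" using period[of i] True by simp
        moreover have "u (i + 2) \<noteq> u i" "u (i + 2) \<noteq> u (i + 1)"
          using u_eq_near[of "i + 2" i] u_eq_near[of "i + 2" "i + 1"] True by auto
        ultimately show "E \<in> {{u (i + 2)}}" using j by (auto simp: pair_def numeral_3_eq_3)
      qed
      moreover have "(\<lambda>j. pair u j - ?Z) ` B' \<noteq> {}" using True by (auto simp: p_def)
      ultimately have eq: "(\<lambda>j. pair u j - ?Z) ` B' = {{u (i + 2)}}" by blast
      have "res_bound ?k X (Suc 0) {{u (i + 2)}}"
        using u_in uX by (intro res_bound_var res_bound_empty) auto
      moreover have "N = 1" using True by (simp add: N_def cycle_pd_def)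
      ultimately show ?thesis unfolding B'(2) eq by simp
    qed
  qed auto
  moreover have "?U \<union> A = {..<\<mu>}" using A by auto
  ultimately show ?thesis using sqfree_pd_le unfolding N flagged_def[abs_def] by metis
qed

lemma cycle_pd_ge:
  assumes "V \<subseteq> W"
  shows "enat (cycle_pd \<mu>) \<le> sqfree_pd TYPE('k::field) X (flagged A V u ` {..<\<mu>})"
proof (cases "\<mu> mod 3 = 1")
  case False
  have V: "finite V" "V \<subseteq> X" "V \<inter> u ` {..<\<mu>} = {}" using assms W finite_subset by blast+
  show ?thesis
  proof (rule sqfree_pd_ge_cover[OF inj uX V])
    show "cover v < \<mu>" "3 * (v div 2) + 1 < \<mu> \<and> 3 * (v div 2) + v mod 2 < \<mu>" if "v < cycle_pd \<mu>" for v
    proof -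
      obtain a b where ab: "v div 2 = a" "v mod 2 = b" by blast
      then have v: "v = 2 * a + b" and b: "b = 0 \<or> b = 1" by auto
      have "3 * (v + 1) \<le> 2 * \<mu> + 1" using that \<mu> cycle_pd_eq[of \<mu>] by simp
      \<comment> \<open>For \<open>\<mu> = 3 * a + 1\<close> the last variable
        \<open>u (3 * a)\<close> would have neither neighbour inverted: the pattern of period three
        does not close up.\<close>
      moreover have "\<mu> \<noteq> 3 * a + 1" using False by auto
      ultimately show "cover v < \<mu>" "3 * (v div 2) + 1 < \<mu> \<and> 3 * (v div 2) + v mod 2 < \<mu>"
        using v b unfolding cover_def ab by auto
    qed
    fix i assume i: "i < \<mu>"
    show "\<exists>j<\<mu>. (u i = u j \<or> u (Suc i) = u j) \<and> j mod 3 \<noteq> 1"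
    proof (cases "i mod 3 = 1")
      case True
      show ?thesis
      proof (cases "Suc i < \<mu>")
        case False
        then have "u (Suc i) = u 0" using i period[of 0] by (simp add: less_Suc_eq not_less_iff_gr_or_eq)
        then show ?thesis using \<mu> by (intro exI[of _ 0]) auto
      next
        case b: True
        have "Suc i mod 3 \<noteq> 1" using True by presburger
        then show ?thesis using b by blast
      qed
    qed (use i in blast)
  qed
next
  case True
  have V: "finite V" "V \<subseteq> X" "V \<inter> u ` {..<\<mu>} = {}" using assms W finite_subset by blast+
  define k where "k = \<mu> div 3"
  have k: "\<mu> = 3 * k + 1" "k \<ge> 1" using True \<mu> unfolding k_def by presburger+
  \<comment> \<open>All variables of the cycle are used: \<open>k\<close> full blocks and the single
    index \<open>3 * k\<close>.\<close>
  have "enat (\<mu> - k) \<le> sqfree_pd TYPE('k) X (flagged A V u ` {..<\<mu>})"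
    unfolding sqfree_pd_def
  proof (rule proj_dim_sqfree_ge[OF inj uX V(1,2)])
    show "3 * k \<le> \<mu>" using k by simp
    have edge: "\<exists>E\<in>flagged A V u ` {..<\<mu>}. E \<subseteq> V \<union> u ` S" if "i < \<mu>" "u i \<in> u ` S" "u (Suc i) \<in> u ` S" for i S
      using that by (intro bexI[of _ "flagged A V u i"]) (auto simp: flagged_def pair_def)
    \<comment> \<open>A zigzag consists of \<open>0, 3, ..., 3t - 3\<close> and
      \<open>3t + 2, ..., 3k - 1\<close>. Every index outside it has a neighbour in it, except
      \<open>3t - 1\<close> and \<open>3t\<close> in the gap; the index \<open>3k\<close> is next to
      both \<open>3k - 1\<close> and \<open>0\<close>, one of which is always present.\<close>
    show "\<exists>E\<in>flagged A V u ` {..<\<mu>}. E \<subseteq> V \<union> u ` insert v (zigzag k t)"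
      if t: "t \<le> k" and v: "v < \<mu>" "v \<notin> zigzag k t" "\<not> (v = 3 * t \<and> t < k)" "v + 1 \<noteq> 3 * t" for t v
    proof -
      have up: ?thesis if "Suc v \<in> zigzag k t" using edge[OF v(1), of "insert v (zigzag k t)"] that by blast
      have down: ?thesis if "v = Suc j" "j \<in> zigzag k t" for j
        using edge[of j "insert v (zigzag k t)"] that v(1) by auto
      have zig: "3 * j \<in> zigzag k t" if "j < t" for j using that t by (simp add: in_zigzag)
      have zag: "3 * j + 2 \<in> zigzag k t" if "t \<le> j" "j < k" for j
      proof -
        have "(3 * j + 2) mod 3 = 2" "(3 * j + 2) div 3 = j" by presburger+
        then show ?thesis unfolding in_zigzag using that by simp
      qed
      show ?thesis
      proof (cases "v = 3 * k")
        case True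
        show ?thesis
        proof (cases "t = k")
          case b: True
          have "u (Suc v) = u 0" using True k period[of 0] by simp
          moreover have "0 \<in> zigzag k t" using zig[of 0] b k by simp
          ultimately show ?thesis using edge[OF v(1), of "insert v (zigzag k t)"] by auto
        next
          case False
          obtain k' where k': "k = Suc k'" using k by (cases k) auto
          then have "3 * k' + 2 \<in> zigzag k t" using zag[of k'] t False by simp
          then show ?thesis using down[of "3 * k' + 2"] True k' by simp
        qed
      next
        case False
        define j where "j = v div 3"
        have j: "j < k" using v(1) False k by (auto simp: j_def)
        have "v = 3 * j \<or> v = 3 * j + 1 \<or> v = 3 * j + 2" unfolding j_def by presburger
        then consider "v = 3 * j" | "v = 3 * j + 1" | "v = 3 * j + 2" by blast
        then show ?thesis
        proof cases
          case 1
          then have "t < j" using v(2,3) zig[of j] j by (metis linorder_neqE_nat)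
          then obtain j' where "j = Suc j'" by (cases j) auto
          with \<open>t < j\<close> j have "3 * j' + 2 \<in> zigzag k t" "v = Suc (3 * j' + 2)"
            using zag[of j'] 1 by auto
          then show ?thesis by (intro down)
        next
          case 2
          show ?thesis
          proof (cases "j < t")
            case True
            then show ?thesis using zig down[of "3 * j"] 2 by simp
          next
            case False
            then show ?thesis using zag[of j] up 2 j by simp
          qed
        next
          case 3
          then have "j < t" using v(2) zag[of j] j by (metis not_le)
          moreover have "Suc j \<noteq> t" using v(4) 3 by auto
          ultimately have "3 * Suc j \<in> zigzag k t" by (intro zig) simp
          moreover have "Suc v = 3 * Suc j" using 3 by simp
          ultimately have "Suc v \<in> zigzag k t" by (simp only:)
          then show ?thesis by (rule up)
        qed
      qed
    qed
    \<comment> \<open>A facet takes one of \<open>3j\<close> and \<open>3j + 1\<close> from each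
      block and never \<open>3k\<close>, so it contains no two neighbours on the cycle.\<close>
    show "\<not> E \<subseteq> V \<union> u ` cross k B" if EG: "E \<in> flagged A V u ` {..<\<mu>}" for B E
    proof
      assume sub: "E \<subseteq> V \<union> u ` cross k B"
      obtain i where i: "i < \<mu>" "E = flagged A V u i" using EG by auto
      have cr: "x \<in> cross k B" if "x < \<mu>" "u x \<in> E" for x
      proof -
        have "u x \<notin> V" using V(3) u_in by blast
        then obtain x' where "x' \<in> cross k B" "u x = u x'" using sub \<open>u x \<in> E\<close> by blast
        moreover have "x' < \<mu>" using calculation(1) k by (simp add: in_cross)
        ultimately show ?thesis using inj_on_eqD[OF inj, of x x'] \<open>x < \<mu>\<close> by auto
      qed
      have E: "u i \<in> E" "u (Suc i) \<in> E" using i(2) by (auto simp: flagged_def pair_def)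
      have "i \<in> cross k B" by (rule cr[OF i(1) E(1)])
      then have i3: "i < 3 * k" "i mod 3 = (if i div 3 \<in> B then 1 else 0)" by (auto simp: in_cross)
      then have "Suc i \<in> cross k B" using cr[OF _ E(2)] k by simp
      then have "Suc i mod 3 = (if Suc i div 3 \<in> B then 1 else 0)" by (simp add: in_cross)
      moreover have "Suc i div 3 = i div 3 \<and> Suc i mod 3 = Suc (i mod 3)"
        using i3(2) by (auto split: if_splits; presburger)
      ultimately show False using i3(2) by simp
    qed
  qed
  moreover have "\<mu> - k = cycle_pd \<mu>" using k cycle_pd_eq[of \<mu>] by simp
  ultimately show ?thesis by simp
qed

end

section \<open>From strings and cycles of vertices to monomials in their edges\<close>

lemma vertex_edges_insert:
  assumes "F \<notin> H"
  shows "vertex_edges (H \<union> {F}) v = vertex_edges H v \<union> (if v \<in> F then {F} else {})"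
  by (auto simp: vertex_edges_def)

text \<open>The intersection turns the closed ends into the edges number 0 and \<open>\<mu>\<close>,
  so that all edges are numbered uniformly and the vertex \<open>w (Suc j)\<close> lies on exactly
  the edges \<open>j\<close> and \<open>Suc j\<close>.\<close>

definition string_edge :: "nat \<Rightarrow> (nat \<Rightarrow> 'v) \<Rightarrow> nat \<Rightarrow> 'v set" where
  "string_edge \<mu> w i = w ` ({i, Suc i} \<inter> {1..\<mu>})"

text \<open>For \<open>\<mu> = 1\<close> the edges number 0 and 1 would both be
  \<open>{w 1}\<close>; from \<open>\<mu> = 2\<close> on the enumeration is injective.\<close>

lemma string_edge_props:
  assumes os: "open_string \<mu> w V H" and \<mu>: "\<mu> \<ge> 2"
  shows "H = string_edge \<mu> w ` {..\<mu>}" "inj_on (string_edge \<mu> w) {..\<mu>}"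
    "V = (\<lambda>j. w (Suc j)) ` {..<\<mu>}" "\<And>j. j < \<mu> \<Longrightarrow> vertex_edges H (w (Suc j)) = pair (string_edge \<mu> w) j"
proof -
  let ?u = "string_edge \<mu> w" and ?I = "\<lambda>i. {i, Suc i} \<inter> {1..\<mu>}"
  have w: "inj_on w {1..\<mu>}" and V: "V = w ` {1..\<mu>}"
    and H: "H = {{w i, w (i + 1)} | i. 1 \<le> i \<and> i < \<mu>} \<union> {{w 1}, {w \<mu>}}"
    using os by (auto simp: open_string_def)
  have I: "?I 0 = {1}" "?I \<mu> = {\<mu>}" "?I i = {i, Suc i}" if "1 \<le> i" "i < \<mu>" for i
    using that \<mu> by auto
  have I0: "?I 0 = {1}" "?I \<mu> = {\<mu>}" using \<mu> by auto
  have mid: "?u i = {w i, w (i + 1)}" if "1 \<le> i" "i < \<mu>" for i using I(3)[OF that] by (simp add: string_edge_def)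
  have ends: "?u 0 = {w 1}" "?u \<mu> = {w \<mu>}" using I0 by (simp_all add: string_edge_def)
  show eq: "H = ?u ` {..\<mu>}"
  proof
    show "H \<subseteq> ?u ` {..\<mu>}"
    proof
      fix E assume "E \<in> H"
      then consider i where "1 \<le> i" "i < \<mu>" "E = {w i, w (i + 1)}" | "E = {w 1}" | "E = {w \<mu>}" unfolding H by blast
      then show "E \<in> ?u ` {..\<mu>}"
      proof cases
        case 1
        then show ?thesis using mid by (intro image_eqI[of _ _ i]) auto
      qed (use ends in \<open>blast intro: image_eqI[of _ _ 0] image_eqI[of _ _ \<mu>]\<close>)+
    qed
    show "?u ` {..\<mu>} \<subseteq> H"
    proof
      fix E assume "E \<in> ?u ` {..\<mu>}"
      then obtain i where i: "i \<le> \<mu>" "E = ?u i" by blast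
      then consider "i = 0" | "i = \<mu>" | "1 \<le> i" "i < \<mu>" by linarith
      then show "E \<in> H" unfolding H using i(2) ends mid by cases auto
    qed
  qed
  show inj: "inj_on ?u {..\<mu>}"
  proof (rule inj_onI)
    fix i j assume ij: "i \<in> {..\<mu>}" "j \<in> {..\<mu>}" and "?u i = ?u j"
    then have "?I i = ?I j" using inj_on_image_eq_iff[OF w, of "?I i" "?I j"] by (simp add: string_edge_def)
    then have mem: "x \<in> ?I i \<longleftrightarrow> x \<in> ?I j" for x by simp
    have less: False if "a < b" "b \<le> \<mu>" "\<And>x. x \<in> ?I a \<longleftrightarrow> x \<in> ?I b" for a b
    proof (cases "a = 0")
      case True
      then have "b \<noteq> 0" "b = 1 \<or> b \<notin> ?I b" using that(1) that(3)[of b] by auto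
      then have "b = 1" using that(2) by auto
      then show False using that(3)[of 2] True \<mu> by auto
    next
      case False
      then show False using that(3)[of a] that(1,2) by auto
    qed
    show "i = j" using less[of i j] less[of j i] mem ij by (metis atMost_iff linorder_neqE_nat)
  qed
  have "{1..\<mu>} = Suc ` {..<\<mu>}" by (simp add: image_Suc_lessThan)
  then show "V = (\<lambda>j. w (Suc j)) ` {..<\<mu>}" unfolding V by (simp add: image_image)
  fix j assume j: "j < \<mu>"
  have "w (Suc j) \<in> ?u i \<longleftrightarrow> Suc j \<in> ?I i" for i
    unfolding string_edge_def by (rule inj_on_image_mem_iff[OF w]) (use j in auto)
  then have "w (Suc j) \<in> ?u i \<longleftrightarrow> i = j \<or> i = Suc j" for i using j by auto
  then show "vertex_edges H (w (Suc j)) = pair ?u j"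
    unfolding vertex_edges_def eq pair_def using j by auto
qed

text \<open>Reduction modulo \<open>\<mu>\<close> makes the enumeration periodic. The edges
  \<open>j\<close> and \<open>Suc j\<close> meet in \<open>w (Suc (Suc j mod \<mu>))\<close>, and
  the vertices are listed with this shift.\<close>

definition cycle_edge :: "nat \<Rightarrow> (nat \<Rightarrow> 'v) \<Rightarrow> nat \<Rightarrow> 'v set" where
  "cycle_edge \<mu> w j = {w (Suc (j mod \<mu>)), w (Suc (Suc j mod \<mu>))}"

lemma cycle_edge_props:
  assumes oc: "open_cycle \<mu> w V H"
  shows "H = cycle_edge \<mu> w ` {..<\<mu>}" "inj_on (cycle_edge \<mu> w) {..<\<mu>}"
    "V = (\<lambda>j. w (Suc (Suc j mod \<mu>))) ` {..<\<mu>}"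
    "\<And>j. j < \<mu> \<Longrightarrow> vertex_edges H (w (Suc (Suc j mod \<mu>))) = pair (cycle_edge \<mu> w) j"
proof -
  let ?u = "cycle_edge \<mu> w"
  have \<mu>: "\<mu> \<ge> 3" and w: "inj_on w {1..\<mu>}" and V: "V = w ` {1..\<mu>}"
    and H: "H = {{w i, w (i + 1)} | i. 1 \<le> i \<and> i < \<mu>} \<union> {{w \<mu>, w 1}}"
    using oc by (auto simp: open_cycle_def)
  have w_eq: "w (Suc i) = w (Suc j) \<longleftrightarrow> i = j" if "i < \<mu>" "j < \<mu>" for i j
    using inj_on_eqD[OF w, of "Suc i" "Suc j"] that by auto
  have mid: "?u i = {w (Suc i), w (Suc (Suc i))}" if "Suc i < \<mu>" for i using that by (simp add: cycle_edge_def)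
  have last: "?u (\<mu> - 1) = {w \<mu>, w 1}" using \<mu> by (simp add: cycle_edge_def)
  show eq: "H = ?u ` {..<\<mu>}"
  proof
    show "H \<subseteq> ?u ` {..<\<mu>}"
    proof
      fix E assume "E \<in> H"
      then consider i where "1 \<le> i" "i < \<mu>" "E = {w i, w (i + 1)}" | "E = {w \<mu>, w 1}" unfolding H by blast
      then show "E \<in> ?u ` {..<\<mu>}"
      proof cases
        case 1
        then show ?thesis using mid[of "i - 1"] by (intro image_eqI[of _ _ "i - 1"]) auto
      next
        case 2
        then show ?thesis using last \<mu> by (intro image_eqI[of _ _ "\<mu> - 1"]) auto
      qed
    qed
    show "?u ` {..<\<mu>} \<subseteq> H"
    proof
      fix E assume "E \<in> ?u ` {..<\<mu>}"
      then obtain i where i: "i < \<mu>" "E = ?u i" by blast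
      then consider "Suc i < \<mu>" | "i = \<mu> - 1" by linarith
      then show "E \<in> H"
      proof cases
        case 1
        then have "E = {w (Suc i), w (Suc i + 1)}" using i(2) mid by simp
        then show ?thesis unfolding H using 1 by (intro UnI1 CollectI exI[of _ "Suc i"]) auto
      next
        case 2
        then show ?thesis unfolding H using i(2) last by simp
      qed
    qed
  qed
  have lt: "j mod \<mu> < \<mu>" for j using \<mu> by simp
  have mem: "w (Suc m) \<in> ?u i \<longleftrightarrow> m = i mod \<mu> \<or> m = Suc i mod \<mu>" if "m < \<mu>" for m i
    using w_eq[OF that lt] by (auto simp: cycle_edge_def)
  show "inj_on ?u {..<\<mu>}"
  proof (rule inj_onI)
    fix i j assume ij: "i \<in> {..<\<mu>}" "j \<in> {..<\<mu>}" and eq: "?u i = ?u j"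
    have "w (Suc i) \<in> ?u j" "w (Suc j) \<in> ?u i" using mem[of i i] mem[of j j] ij eq by auto
    then have "i = j \<or> i = Suc j mod \<mu> \<and> j = Suc i mod \<mu>" using mem[of i j] mem[of j i] ij by auto
    then show "i = j" using ij \<mu> by (auto simp: mod_Suc split: if_splits)
  qed
  have "{1..\<mu>} = (\<lambda>j. Suc (Suc j mod \<mu>)) ` {..<\<mu>}"
  proof
    show "(\<lambda>j. Suc (Suc j mod \<mu>)) ` {..<\<mu>} \<subseteq> {1..\<mu>}" using lt by (auto simp: Suc_le_eq)
    show "{1..\<mu>} \<subseteq> (\<lambda>j. Suc (Suc j mod \<mu>)) ` {..<\<mu>}"
    proof
      fix x assume x: "x \<in> {1..\<mu>}"
      show "x \<in> (\<lambda>j. Suc (Suc j mod \<mu>)) ` {..<\<mu>}"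
      proof (cases "x = 1")
        case True
        then show ?thesis using \<mu> by (intro image_eqI[of _ _ "\<mu> - 1"]) auto
      next
        case False
        then show ?thesis using x by (intro image_eqI[of _ _ "x - 2"]) (auto simp: Suc_diff_Suc numeral_2_eq_2)
      qed
    qed
  qed
  then show "V = (\<lambda>j. w (Suc (Suc j mod \<mu>))) ` {..<\<mu>}" unfolding V by (simp add: image_image)
  fix j assume j: "j < \<mu>"
  have u_mod: "?u (Suc j) = ?u (Suc j mod \<mu>)" by (simp add: cycle_edge_def mod_Suc_eq)
  have "w (Suc (Suc j mod \<mu>)) \<in> ?u i \<longleftrightarrow> i = j \<or> i = Suc j mod \<mu>" if "i < \<mu>" for i
    using mem[OF lt, of "Suc j" i] that j \<mu> by (auto simp: mod_Suc split: if_splits)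
  then show "vertex_edges H (w (Suc (Suc j mod \<mu>))) = pair ?u j"
    unfolding vertex_edges_def eq pair_def u_mod using j lt[of "Suc j"] by auto
qed

lemma open_string_pd:
  assumes os: "open_string \<mu> w VS HS" and \<mu>: "\<mu> \<ge> 2"
  shows "pd TYPE('k::field) VS HS = enat (\<mu> - \<mu> div 3)"
proof -
  note pr = string_edge_props[OF os \<mu>]
  let ?u = "string_edge \<mu> w"
  have G: "vertex_edges HS ` VS = pair ?u ` {..<\<mu>}" unfolding pr(3) image_image using pr(4) by simp
  have f: "flagged {} {} ?u = pair ?u" by (simp add: flagged_def[abs_def])
  have "pd TYPE('k) VS HS = sqfree_pd TYPE('k) HS (pair ?u ` {..<\<mu>})"
  proof -
    have "finite HS" using pr(1) by simp
    then show ?thesis by (simp only: pd_sqfree G)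
  qed
  moreover have "sqfree_pd TYPE('k) HS (pair ?u ` {..<\<mu>}) \<le> enat (path_pd \<mu>)"
    using pr(1,2) by (intro string_pd_le) auto
  moreover have "enat (path_pd \<mu>) \<le> sqfree_pd TYPE('k) HS (pair ?u ` {..<\<mu>})"
    using string_pd_ge[of ?u \<mu> HS "{}" "{}", where 'k = 'k] pr(1,2) unfolding f by simp
  ultimately show ?thesis by (simp add: path_pd_def)
qed

lemma string_add_edge:
  assumes os: "open_string \<mu> w VS HS" and \<mu>: "\<mu> \<ge> 2" and F: "F \<notin> HS"
  defines "A \<equiv> {j. j < \<mu> \<and> w (Suc j) \<in> F}" and "u \<equiv> string_edge \<mu> w"
  shows "pd TYPE('k::field) VS (HS \<union> {F}) = sqfree_pd TYPE('k) (HS \<union> {F}) (flagged A {F} u ` {..<\<mu>})"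
    "inj_on u {..\<mu>}" "u ` {..\<mu>} \<subseteq> HS \<union> {F}" "F \<notin> u ` {..\<mu>}"
proof -
  note pr = string_edge_props[OF os \<mu>, folded u_def]
  have "vertex_edges (HS \<union> {F}) (w (Suc j)) = flagged A {F} u j" if "j < \<mu>" for j
    unfolding vertex_edges_insert[OF F] pr(4)[OF that] using that by (simp add: flagged_def A_def)
  then have G: "vertex_edges (HS \<union> {F}) ` VS = flagged A {F} u ` {..<\<mu>}"
    unfolding pr(3) image_image by simp
  have "finite (HS \<union> {F})" using pr(1) by simp
  then show "pd TYPE('k) VS (HS \<union> {F}) = sqfree_pd TYPE('k) (HS \<union> {F}) (flagged A {F} u ` {..<\<mu>})"
    by (simp only: pd_sqfree G)
  show "inj_on u {..\<mu>}" "u ` {..\<mu>} \<subseteq> HS \<union> {F}" "F \<notin> u ` {..\<mu>}" using pr(1,2) F by auto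
qed

lemma open_string_pd_bounds:
  assumes os: "open_string \<mu> w VS HS" and \<mu>: "\<mu> \<ge> 2"
  shows "pd TYPE('k::field) VS (HS \<union> {F}) = enat (path_pd \<mu>) \<or> pd TYPE('k) VS (HS \<union> {F}) = enat (path_pd \<mu> + 1)"
proof (cases "F \<in> HS")
  case True
  then show ?thesis using open_string_pd[OF os \<mu>, where 'k = 'k] by (simp add: insert_absorb path_pd_def)
next
  case False
  note add = string_add_edge[OF os \<mu> False]
  let ?A = "{j. j < \<mu> \<and> w (Suc j) \<in> F}" and ?u = "string_edge \<mu> w" and ?p = "pd TYPE('k) VS (HS \<union> {F})"
  have "enat (path_pd \<mu>) \<le> ?p"
    unfolding add(1) by (rule string_pd_ge) (use add(2-4) in auto)
  moreover have "?p \<le> enat (path_pd \<mu> + 1)"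
    unfolding add(1) by (rule string_pd_add_le) (use add(2-4) in auto)
  ultimately show ?thesis by (cases ?p) auto
qed

text \<open>The positions 2 and 5 are the indices 1 and 4 counted from zero, so
  \<open>string_6_pd_ge\<close> gives 5, against 4 for the string alone.\<close>

lemma open_string_6_pd:
  assumes os: "open_string 6 w VS HS" and F: "{i \<in> {1..6}. w i \<in> F} = {2, 5}" and FV: "F \<subseteq> VS"
  shows "pd TYPE('k::field) VS (HS \<union> {F}) = pd TYPE('k) VS HS + 1"
proof -
  have w: "inj_on w {1..6}" and V: "VS = w ` {1..6}" using os by (auto simp: open_string_def)
  have "w ` {2, 5} = F" using FV unfolding F[symmetric] V by auto
  have ne: "F \<notin> HS"
  proof
    assume "F \<in> HS"
    then obtain i where i: "i \<le> 6" "F = w ` ({i, Suc i} \<inter> {1..6})"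
      using string_edge_props(1)[OF os] by (auto simp: string_edge_def)
    then have "{2, 5} = {i, Suc i} \<inter> {1..6}"
      using inj_on_image_eq_iff[OF w, of "{2, 5}" "{i, Suc i} \<inter> {1..6}"] \<open>w ` {2, 5} = F\<close> by auto
    then have "2 \<in> {i, Suc i}" "5 \<in> {i, Suc i}" by blast+
    then show False by auto
  qed
  have A: "{j. j < 6 \<and> w (Suc j) \<in> F} = {1, 4}"
  proof -
    have "w (Suc j) \<in> F \<longleftrightarrow> Suc j \<in> {2, 5}" if "j < 6" for j
    proof -
      have "Suc j \<in> {i \<in> {1..6}. w i \<in> F} \<longleftrightarrow> w (Suc j) \<in> F" using that by auto
      then show ?thesis unfolding F by (simp only:)
    qed
    note * = this
    show ?thesis
    proof (rule Set.set_eqI)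
      fix j show "j \<in> {j. j < 6 \<and> w (Suc j) \<in> F} \<longleftrightarrow> j \<in> {1, 4}" using *[of j] by (cases "j < 6") auto
    qed
  qed
  have "pd TYPE('k) VS (HS \<union> {F}) = sqfree_pd TYPE('k) (HS \<union> {F}) (flagged {1, 4} {F} (string_edge 6 w) ` {..<6})"
    using string_add_edge(1)[OF os _ ne, unfolded A] by simp
  moreover have "enat 5 \<le> sqfree_pd TYPE('k) (HS \<union> {F}) (flagged {1, 4} {F} (string_edge 6 w) ` {..<6})"
    by (rule string_6_pd_ge) (use string_add_edge(2-4)[OF os _ ne] in auto)
  ultimately have "enat 5 \<le> pd TYPE('k) VS (HS \<union> {F})" by simp
  moreover have "pd TYPE('k) VS (HS \<union> {F}) = enat 4 \<or> pd TYPE('k) VS (HS \<union> {F}) = enat 5"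
    using open_string_pd_bounds[OF os, of F, where 'k = 'k] by (simp add: path_pd_def)
  ultimately have "pd TYPE('k) VS (HS \<union> {F}) = enat 5" by auto
  moreover have "pd TYPE('k) VS HS = enat 4" using open_string_pd[OF os, where 'k = 'k] by simp
  ultimately show ?thesis by (simp add: one_enat_def)
qed

lemma open_cycle_pd:
  assumes oc: "open_cycle \<mu> w VC HC"
  shows "pd TYPE('k::field) VC HC = enat (cycle_pd \<mu>)"
    and "F \<subseteq> VC \<Longrightarrow> F \<noteq> {} \<Longrightarrow> pd TYPE('k) VC (HC \<union> {F}) = enat (cycle_pd \<mu>)"
proof -
  note pr = cycle_edge_props[OF oc]
  let ?u = "cycle_edge \<mu> w"
  have \<mu>: "\<mu> \<ge> 3" using oc by (simp add: open_cycle_def)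
  have period: "?u (j + \<mu>) = ?u j" for j
  proof -
    have "Suc (j + \<mu>) mod \<mu> = Suc j mod \<mu>" using mod_add_self2[of "Suc j" \<mu>] by simp
    then show ?thesis by (simp add: cycle_edge_def)
  qed
  have fin: "finite HC" using pr(1) by simp
  have ge_le: "sqfree_pd TYPE('k) X (flagged A W ?u ` {..<\<mu>}) = enat (cycle_pd \<mu>)"
    if "HC \<subseteq> X" "finite W" "W \<subseteq> X" "W \<inter> HC = {}" "A \<subseteq> {..<\<mu>}" "A \<noteq> {}" for X W A
  proof -
    interpret periodic ?u \<mu> X W
      using \<mu> period pr(1,2) that by unfold_locales auto
    show ?thesis using cycle_pd_le[OF that(5,6) order_refl] cycle_pd_ge[OF order_refl] by (rule antisym)
  qed
  \<comment> \<open>The bare cycle is read as one with a marked vertex and an empty mark, since the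
    upper bound asks for a nonempty \<open>A\<close>.\<close>
  have G: "vertex_edges HC ` VC = flagged {0} {} ?u ` {..<\<mu>}"
    unfolding pr(3) image_image using pr(4) by (simp add: flagged_def)
  have "{0} \<subseteq> {..<\<mu>}" using \<mu> by auto
  then show C: "pd TYPE('k) VC HC = enat (cycle_pd \<mu>)"
    unfolding pd_sqfree[OF fin] G by (intro ge_le) auto
  assume F: "F \<subseteq> VC" "F \<noteq> {}"
  show "pd TYPE('k) VC (HC \<union> {F}) = enat (cycle_pd \<mu>)"
  proof (cases "F \<in> HC")
    case True
    then show ?thesis using C by (simp add: insert_absorb)
  next
    case False
    let ?A = "{j. j < \<mu> \<and> w (Suc (Suc j mod \<mu>)) \<in> F}"
    have "vertex_edges (HC \<union> {F}) (w (Suc (Suc j mod \<mu>))) = flagged ?A {F} ?u j" if "j < \<mu>" for j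
      unfolding vertex_edges_insert[OF False] pr(4)[OF that] using that by (simp add: flagged_def)
    then have G: "vertex_edges (HC \<union> {F}) ` VC = flagged ?A {F} ?u ` {..<\<mu>}"
      unfolding pr(3) image_image by simp
    have "?A \<noteq> {}" using F unfolding pr(3) by auto
    moreover have "finite (HC \<union> {F})" using fin by simp
    ultimately show ?thesis using False by (simp only: pd_sqfree G) (intro ge_le, auto)
  qed
qed

text \<open>Sending \<open>w i\<close> to \<open>w' i\<close> carries one string to the other, and
  \<open>F\<close> to \<open>F'\<close> because both are determined by their common set of
  positions.\<close>

lemma open_string_relabel:
  fixes w w' :: "nat \<Rightarrow> 'v"
  assumes os: "open_string \<mu> w V H" "open_string \<mu> w' V' H'" and F: "F \<subseteq> V" "F' \<subseteq> V'"
    and eq: "{i \<in> {1..\<mu>}. w i \<in> F} = {i \<in> {1..\<mu>}. w' i \<in> F'}"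
  shows "pd TYPE('k::field) V' (H' \<union> {F'}) = pd TYPE('k) V (H \<union> {F})"
proof -
  let ?f = "\<lambda>v. w' (the_inv_into {1..\<mu>} w v)"
  have \<mu>: "\<mu> \<ge> 1" and w: "inj_on w {1..\<mu>}" "inj_on w' {1..\<mu>}" and V: "V = w ` {1..\<mu>}" "V' = w' ` {1..\<mu>}"
    and H: "H = {{w i, w (i + 1)} | i. 1 \<le> i \<and> i < \<mu>} \<union> {{w 1}, {w \<mu>}}"
      "H' = {{w' i, w' (i + 1)} | i. 1 \<le> i \<and> i < \<mu>} \<union> {{w' 1}, {w' \<mu>}}"
    using os by (auto simp: open_string_def)
  have f: "?f (w i) = w' i" if "i \<in> {1..\<mu>}" for i using the_inv_into_f_f[OF w(1) that] by simp
  have fim: "?f ` w ` S = w' ` S" if "S \<subseteq> {1..\<mu>}" for S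
    using f that by (auto simp: image_image subset_iff intro!: image_cong)
  have inj: "inj_on ?f V"
  proof (rule inj_onI)
    fix x y assume xy: "x \<in> V" "y \<in> V" and eq: "?f x = ?f y"
    obtain i j where "x = w i" "y = w j" "i \<in> {1..\<mu>}" "j \<in> {1..\<mu>}" using xy V(1) by blast
    then show "x = y" using eq f inj_on_eqD[OF w(2), of i j] by metis
  qed
  have FI: "F = w ` {i \<in> {1..\<mu>}. w i \<in> F}" "F' = w' ` {i \<in> {1..\<mu>}. w' i \<in> F'}"
    using F V by auto
  have f12: "?f ` F = F'" 
  proof -
    let ?I = "{i \<in> {1..\<mu>}. w i \<in> F}"
    have "?f ` F = ?f ` w ` ?I" by (rule arg_cong[OF FI(1)])
    also have "\<dots> = w' ` ?I" by (rule fim) auto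
    also have "\<dots> = F'" by (rule FI(2)[folded eq, symmetric])
    finally show ?thesis .
  qed
  have "(`) ?f ` H = H'"
  proof -
    have pairs: "?f ` {w i, w (i + 1)} = {w' i, w' (i + 1)}" if "1 \<le> i" "i < \<mu>" for i
      using f[of i] f[of "i + 1"] that by simp
    have "(`) ?f ` {{w i, w (i + 1)} | i. 1 \<le> i \<and> i < \<mu>} = {{w' i, w' (i + 1)} | i. 1 \<le> i \<and> i < \<mu>}"
    proof -
      have img: "{{v i, v (i + 1)} | i. 1 \<le> i \<and> i < \<mu>} = (\<lambda>i. {v i, v (i + 1)}) ` {1..<\<mu>}"
        for v :: "nat \<Rightarrow> 'v" 
        unfolding setcompr_eq_image by (rule arg_cong[where f = "(`) _"]) auto
      show ?thesis unfolding img[of w] img[of w'] image_image by (rule image_cong[OF refl], rule pairs) simp_all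
    qed
    moreover have "?f ` {w 1} = {w' 1}" "?f ` {w \<mu>} = {w' \<mu>}" using f \<mu> by auto
    ultimately show ?thesis unfolding H by (simp add: image_Un)
  qed
  then have "(`) ?f ` (H \<union> {F}) = H' \<union> {F'}" using f12 by (simp add: image_Un)
  moreover have "?f ` V = V'" using fim[of "{1..\<mu>}"] V by simp
  moreover have "H \<union> {F} \<subseteq> Pow V" using F(1) \<mu> unfolding H V by auto
  then have "finite (H \<union> {F})" using finite_subset[of "H \<union> {F}" "Pow V"] V by simp
  ultimately show ?thesis
    using pd_relabel[of "H \<union> {F}" V ?f, where 'k = 'k] inj \<open>H \<union> {F} \<subseteq> Pow V\<close> by simp
qed

theorem theorem1p1:
  shows
    "(\<exists>D :: nat \<Rightarrow> nat set \<Rightarrow> bool.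
        (\<forall>(V :: 'v set) H F \<mu> w VS HS.
           hypergraph V H \<and> separated V H \<and> F \<in> H \<and> edge_dim F > 0 \<and>
           open_string \<mu> w VS HS \<and> F \<subseteq> VS \<and> H = HS \<union> {F} \<longrightarrow>
           pd TYPE('k::field) VS HS = enat (\<mu> - \<mu> div 3) \<and>
           (if D \<mu> {i \<in> {1..\<mu>}. w i \<in> F}
            then pd TYPE('k) V H = pd TYPE('k) VS HS + 1
            else pd TYPE('k) V H = pd TYPE('k) VS HS)) \<and>
        (\<exists>\<mu> A B. A \<subseteq> {1..\<mu>} \<and> B \<subseteq> {1..\<mu>} \<and> edge_dim A > 0 \<and> edge_dim B > 0 \<and>
           D \<mu> A \<and> \<not> D \<mu> B)) \<and>
     (\<forall>(V :: 'v set) H F \<mu> w VC HC.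
        hypergraph V H \<and> separated V H \<and> F \<in> H \<and> edge_dim F > 0 \<and>
        open_cycle \<mu> w VC HC \<and> F \<subseteq> VC \<and> H = HC \<union> {F} \<longrightarrow>
        pd TYPE('k) V H = pd TYPE('k) VC HC \<and>
        pd TYPE('k) VC HC = enat (\<mu> - 1 - (\<mu> - 2) div 3))"
proof (intro conjI allI impI)
  \<comment> \<open>If the type \<open>'v\<close> has too few elements for a string of length
    \<open>\<mu>\<close>, the universal statement is vacuously true. Excluding \<open>{1, 2}\<close>
    explicitly guarantees a position where \<open>D\<close> fails even then; it is harmless because
    an edge at these positions already belongs to the string, so nothing grows.\<close>
  define D where "D \<mu> I \<longleftrightarrow> I \<noteq> {1, 2} \<and> (\<forall>(VS :: 'v set) HS F w.
    open_string \<mu> w VS HS \<and> F \<subseteq> VS \<and> {i \<in> {1..\<mu>}. w i \<in> F} = I \<longrightarrow>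
    pd TYPE('k) VS (HS \<union> {F}) = pd TYPE('k) VS HS + 1)" for \<mu> :: nat and I
  show "\<exists>D :: nat \<Rightarrow> nat set \<Rightarrow> bool.
        (\<forall>(V :: 'v set) H F \<mu> w VS HS.
           hypergraph V H \<and> separated V H \<and> F \<in> H \<and> edge_dim F > 0 \<and>
           open_string \<mu> w VS HS \<and> F \<subseteq> VS \<and> H = HS \<union> {F} \<longrightarrow>
           pd TYPE('k) VS HS = enat (\<mu> - \<mu> div 3) \<and>
           (if D \<mu> {i \<in> {1..\<mu>}. w i \<in> F}
            then pd TYPE('k) V H = pd TYPE('k) VS HS + 1
            else pd TYPE('k) V H = pd TYPE('k) VS HS)) \<and>
        (\<exists>\<mu> A B. A \<subseteq> {1..\<mu>} \<and> B \<subseteq> {1..\<mu>} \<and> edge_dim A > 0 \<and> edge_dim B > 0 \<and> D \<mu> A \<and> \<not> D \<mu> B)"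
  proof (intro exI[of _ D] conjI allI impI; (elim conjE)?)
    fix V H F :: "'v set" and \<mu> w VS HS
    show "\<exists>\<mu> A B. A \<subseteq> {1..\<mu>} \<and> B \<subseteq> {1..\<mu>} \<and> edge_dim A > 0 \<and> edge_dim B > 0 \<and> D \<mu> A \<and> \<not> D \<mu> B"
    proof (intro exI conjI)
      show "D 6 {2, 5}" unfolding D_def
      proof (intro conjI allI impI; (elim conjE)?)
        have "(5::nat) \<notin> {1, 2}" by simp
        then show "{2, 5 :: nat} \<noteq> {1, 2}" by blast
      qed (rule open_string_6_pd)
      show "\<not> D 6 {1, 2}" by (simp add: D_def)
    qed (auto simp: edge_dim_def)
  next
    fix V :: "'v set" and H F \<mu> w VS HS
    assume hyp: "hypergraph V H" and F: "edge_dim F > 0" "F \<subseteq> VS"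
      and os: "open_string \<mu> w VS HS" and H: "H = HS \<union> {F}"
    have w: "inj_on w {1..\<mu>}" "VS = w ` {1..\<mu>}" using os by (auto simp: open_string_def)
    have "card F \<ge> 2" using F(1) by (simp add: edge_dim_def)
    moreover have "card F \<le> card VS" using F(2) w(2) by (intro card_mono) auto
    moreover have "card VS = \<mu>" using w card_image[OF w(1)] by simp
    ultimately have \<mu>: "\<mu> \<ge> 2" by simp
    \<comment> \<open>The string already covers its vertices and \<open>F\<close> adds none, so
      \<open>V\<close> must be the vertex set of the string.\<close>
    have "\<Union>HS = VS"
    proof
      show "\<Union>HS \<subseteq> VS" using string_edge_props(1)[OF os \<mu>] w(2) by (auto simp: string_edge_def)
      show "VS \<subseteq> \<Union>HS"
      proof
        fix v assume "v \<in> VS"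
        then obtain j where "j < \<mu>" "v = w (Suc j)" using string_edge_props(3)[OF os \<mu>] by blast
        then have "vertex_edges HS v \<noteq> {}" using string_edge_props(4)[OF os \<mu>] by (simp add: pair_def)
        then show "v \<in> \<Union>HS" by (auto simp: vertex_edges_def)
      qed
    qed
    then have V: "V = VS" using hyp F(2) unfolding hypergraph_def H by auto
    show p: "pd TYPE('k) VS HS = enat (\<mu> - \<mu> div 3)" by (rule open_string_pd[OF os \<mu>])
    let ?I = "{i \<in> {1..\<mu>}. w i \<in> F}"
    show "if D \<mu> ?I then pd TYPE('k) V H = pd TYPE('k) VS HS + 1 else pd TYPE('k) V H = pd TYPE('k) VS HS"
    proof (cases "D \<mu> ?I")
      case True
      have "pd TYPE('k) VS (HS \<union> {F}) = pd TYPE('k) VS HS + 1"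
        by (rule True[unfolded D_def, THEN conjunct2, rule_format, OF conjI[OF os conjI[OF F(2) refl]]])
      then show ?thesis unfolding V H if_P[OF True] .
    next
      case False
      have "pd TYPE('k) V H = pd TYPE('k) VS HS"
      proof (cases "?I = {1, 2}")
        case True
        have "F = w ` ?I" using F(2) w(2) by auto
        then have "F = {w 1, w (1 + 1)}" unfolding True by (simp add: numeral_2_eq_2)
        then have "F \<in> HS" using os \<mu> unfolding open_string_def by (auto simp: numeral_2_eq_2)
        then show ?thesis unfolding V H by (simp add: insert_absorb)
      next
        case b: False
        have "\<not> (\<forall>(VS :: 'v set) HS F w. open_string \<mu> w VS HS \<and> F \<subseteq> VS \<and> {i \<in> {1..\<mu>}. w i \<in> F} = ?I \<longrightarrow>
          pd TYPE('k) VS (HS \<union> {F}) = pd TYPE('k) VS HS + 1)" (is "\<not> ?all")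
        proof
          assume ?all
          with b have "D \<mu> ?I" unfolding D_def by (rule conjI)
          with False show "False" by (rule notE)
        qed
        \<comment> \<open>A string and an edge at the same positions whose projective dimension does
          not grow; by the dichotomy it stays the same, and relabelling carries this over to
          \<open>F\<close>.\<close>
        then obtain VS' :: "'v set" and HS' F' w' where os': "open_string \<mu> w' VS' HS'" and F': "F' \<subseteq> VS'"
          and I: "{i \<in> {1..\<mu>}. w' i \<in> F'} = ?I"
          and no: "pd TYPE('k) VS' (HS' \<union> {F'}) \<noteq> pd TYPE('k) VS' HS' + 1"
          unfolding not_all not_imp by (elim exE conjE) (rule that)
        have "pd TYPE('k) VS' (HS' \<union> {F'}) = enat (path_pd \<mu>)"
          using open_string_pd_bounds[OF os' \<mu>, of F', where 'k = 'k] no open_string_pd[OF os' \<mu>, where 'k = 'k]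
          by (auto simp: path_pd_def one_enat_def)
        then show ?thesis
          unfolding V H p using open_string_relabel[OF os' os F' F(2) I, where 'k = 'k] by (simp add: path_pd_def)
      qed
      then show ?thesis using False by simp
    qed
  qed
next
  fix V :: "'v set" and H F \<mu> w VC HC
  assume as: "hypergraph V H \<and> separated V H \<and> F \<in> H \<and> edge_dim F > 0 \<and>
        open_cycle \<mu> w VC HC \<and> F \<subseteq> VC \<and> H = HC \<union> {F}"
  then have oc: "open_cycle \<mu> w VC HC" and F: "F \<subseteq> VC" "F \<noteq> {}" and H: "H = HC \<union> {F}"
    by (auto simp: edge_dim_def)
  have "\<Union>HC = VC"
  proof
    show "\<Union>HC \<subseteq> VC" using oc unfolding open_cycle_def by auto
    show "VC \<subseteq> \<Union>HC"
    proof
      fix v assume "v \<in> VC"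
      then obtain j where "j < \<mu>" "v = w (Suc (Suc j mod \<mu>))" using cycle_edge_props(3)[OF oc] by blast
      then have "vertex_edges HC v \<noteq> {}" using cycle_edge_props(4)[OF oc] by (simp add: pair_def)
      then show "v \<in> \<Union>HC" by (auto simp: vertex_edges_def)
    qed
  qed
  then have V: "V = VC" using as F unfolding hypergraph_def H by auto
  show "pd TYPE('k) V H = pd TYPE('k) VC HC" "pd TYPE('k) VC HC = enat (\<mu> - 1 - (\<mu> - 2) div 3)"
    unfolding V H using open_cycle_pd[OF oc, where 'k = 'k] F by (auto simp: cycle_pd_def)
qed

end
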